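(* Let $X$ be a real Banach space. Let $\mathcal{A}$ be an operator ideal such that $\mathcal{A}=\mathcal{A}^{dd}$. Suppose $\mathcal{A}$ satisfies that $T^{**}\in\mathcal{A}(Z^{**},Z)$ whenever $T\in\mathcal{A}(Z,Z)$, for every Banach space $Z$. Then the following are equivalent. (a) $\mathrm{Lip}_0(X)$ has the $\mathcal{A}$-BAP with conjugate operators. (b) $\mathfrak{F}(X)$ has the $\mathcal{A}$-BAP and it is strongly extendably locally reflexive.
   Context: All Banach spaces are real. $\mathrm{Lip}_0(X)$ is the Banach space of Lipschitz functions $f:X\to\mathbb{R}$ with $f(0)=0$, with norm $\|f\|_{\mathrm{Lip}}=\sup_{x\neq y}|f(x)-f(y)|/\|x-y\|$. For $x\in X$ let $\delta_x\in \mathrm{Lip}_0(X)^*$, $\delta_x(f)=f(x)$. The Lipschitz-free space is $\mathfrak{F}(X)=\overline{\mathrm{span}}\{\delta_x: x\in X\}\subseteq \mathrm{Lip}_0(X)^*$; $\mathrm{Lip}_0(X)$ is isometrically identified with the dual $\mathfrak{F}(X)^*$. Operator ideals are (linear) operator ideals in the usual sense. $\mathcal{A}^{dd}(X,Y)=\{T\in\mathcal{L}(X,Y):T^{**}\in\mathcal{A}(X^{**},Y^{**})\}$. For $T\in\mathcal{L}(Z,Z)$, writing $T^{**}\in\mathcal{A}(Z^{**},Z)$ means that $T^{**}(Z^{**})\subseteq Z$ (with $Z$ canonically embedded in $Z^{**}$) and that $T^{**}$, regarded as an operator from $Z^{**}$ into $Z$, belongs to $\mathcal{A}$. $\tau_c$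 is the compact-open topology (uniform convergence on compact subsets of the domain). For $\lambda\ge1$, $\mathcal{A}^\lambda(Z,Z)=\{T\in\mathcal{A}(Z,Z):\|T\|\le\lambda\}$ and $\mathcal{A}_c^\lambda(Z^*,Z^* )=\{T^*:T\in\mathcal{A}^\lambda(Z,Z)\}$. A Banach space $Z$ has the $\mathcal{A}$-BAP if $\mathrm{Id}_Z\in\overline{\mathcal{A}^\lambda(Z,Z)}^{\tau_c}$ for some $\lambda\ge1$. The dual space $Z^*$ has the $\mathcal{A}$-BAP with conjugate operators if $\mathrm{Id}_{Z^*}\in\overline{\mathcal{A}_c^\lambda(Z^*,Z^* )}^{\tau_c}$ for some $\lambda\ge1$; for $\mathrm{Lip}_0(X)$ this is understood with $Z=\mathfrak{F}(X)$, $Z^*=\mathrm{Lip}_0(X)$. A Banach space $Z$ is strongly extendably locally reflexive if there is $\lambda\ge1$ such that for all finite-dimensional subspaces $E\subseteq Z^{**}$ and $F\subseteq Z^*$ and every $\varepsilon>0$, there exists $T\in\mathcal{L}(Z^{**},Z^{**})$ with $\|T\|\le\lambda+\varepsilon$ such that $T(E)\subseteq Z$, $T^*(Z^* )\subseteq Z^*$ and $(Tz^{**})(z^* )=z^{**}(z^* )$ for all $z^{**}\in E$ and $z^*\in F$. *)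

theory Defs
  imports "HOL-Analysis.Analysis" "HOL-Algebra.Module"
begin

section \<open>Banach spaces as carrier-based structures\<close>

text \<open>
  An operator ideal assigns a set of operators to every pair of Banach spaces, so Banach spaces
  have to be objects that can be quantified over. They are modules (in the sense of HOL-Algebra)
  over the reals together with a norm. The fields \<^term>\<open>mult\<close> and \<^term>\<open>one\<close> inherited from
  the module record are irrelevant.
\<close>

definition real_ring :: "real ring" where
  "real_ring = \<lparr>carrier = UNIV, mult = (*), one = 1, zero = 0, add = (+)\<rparr>"

record 'a nspace = "(real, 'a) module" +
  vnorm :: "'a \<Rightarrow> real"

text \<open>The locale \<^locale>\<open>Metric_space\<close> constrains the distance also off the carrier.\<close>

definition vdist :: "'a nspace \<Rightarrow> 'a \<Rightarrow> 'a \<Rightarrow> real" where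
  "vdist V x y = (if x \<in> carrier V \<and> y \<in> carrier V then vnorm V (x \<ominus>\<^bsub>V\<^esub> y) else 0)"

abbreviation vtopology :: "'a nspace \<Rightarrow> 'a topology" where
  "vtopology V \<equiv> Metric_space.mtopology (carrier V) (vdist V)"

locale banach_space = Module.module real_ring V for V :: "'a nspace" (structure) +
  assumes vnorm_eq_zero: "x \<in> carrier V \<Longrightarrow> vnorm V x = 0 \<longleftrightarrow> x = \<zero>"
    and vnorm_smult: "x \<in> carrier V \<Longrightarrow> vnorm V (a \<odot> x) = \<bar>a\<bar> * vnorm V x"
    and vnorm_triangle:
      "\<lbrakk>x \<in> carrier V; y \<in> carrier V\<rbrakk> \<Longrightarrow> vnorm V (x \<oplus> y) \<le> vnorm V x + vnorm V y"
    and complete: "Metric_space.mcomplete (carrier V) (vdist V)"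

definition real_space :: "real nspace" where
  "real_space = \<lparr>carrier = UNIV, mult = (*), one = 1, zero = 0, add = (+), smult = (*), vnorm = abs\<rparr>"

definition linspan :: "'a nspace \<Rightarrow> 'a set \<Rightarrow> 'a set" where
  "linspan V B = \<Inter>{H. submodule H real_ring V \<and> B \<subseteq> H}"

definition fin_dim_subspace :: "'a nspace \<Rightarrow> 'a set \<Rightarrow> bool" where
  "fin_dim_subspace V E \<longleftrightarrow> (\<exists>B. finite B \<and> B \<subseteq> carrier V \<and> E = linspan V B)"


section \<open>Operators, duals and adjoints\<close>

text \<open>
  Operators are extensional, i.e. \<^term>\<open>undefined\<close> off the carrier of their domain, so that
  equal operators are equal as functions.
\<close>

definition bounded_ops :: "'a nspace \<Rightarrow> 'b nspace \<Rightarrow> ('a \<Rightarrow> 'b) set" where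
  "bounded_ops V W = {T \<in> carrier V \<rightarrow>\<^sub>E carrier W.
     (\<forall>x\<in>carrier V. \<forall>y\<in>carrier V. T (x \<oplus>\<^bsub>V\<^esub> y) = T x \<oplus>\<^bsub>W\<^esub> T y) \<and>
     (\<forall>a. \<forall>x\<in>carrier V. T (a \<odot>\<^bsub>V\<^esub> x) = a \<odot>\<^bsub>W\<^esub> T x) \<and>
     (\<exists>C. \<forall>x\<in>carrier V. vnorm W (T x) \<le> C * vnorm V x)}"

text \<open>
  As in \<^const>\<open>onorm\<close>, the term for \<open>x = 0\<close> is \<open>0 / 0 = 0\<close>; it only matters for the zero space.
\<close>

definition opnorm :: "'a nspace \<Rightarrow> 'b nspace \<Rightarrow> ('a \<Rightarrow> 'b) \<Rightarrow> real" where
  "opnorm V W T = (SUP x\<in>carrier V. vnorm W (T x) / vnorm V x)"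

definition op_space :: "'a nspace \<Rightarrow> 'b nspace \<Rightarrow> ('a \<Rightarrow> 'b) nspace" where
  "op_space V W = \<lparr>carrier = bounded_ops V W, mult = undefined, one = undefined,
     zero = (\<lambda>x\<in>carrier V. \<zero>\<^bsub>W\<^esub>),
     add = (\<lambda>S T. \<lambda>x\<in>carrier V. S x \<oplus>\<^bsub>W\<^esub> T x),
     smult = (\<lambda>a T. \<lambda>x\<in>carrier V. a \<odot>\<^bsub>W\<^esub> T x),
     vnorm = opnorm V W\<rparr>"

abbreviation dual :: "'a nspace \<Rightarrow> ('a \<Rightarrow> real) nspace" where
  "dual V \<equiv> op_space V real_space"

abbreviation bidual :: "'a nspace \<Rightarrow> (('a \<Rightarrow> real) \<Rightarrow> real) nspace" where
  "bidual V \<equiv> dual (dual V)"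

definition canon :: "'a nspace \<Rightarrow> 'a \<Rightarrow> ('a \<Rightarrow> real) \<Rightarrow> real" where
  "canon V = (\<lambda>x\<in>carrier V. \<lambda>f\<in>carrier (dual V). f x)"

definition adjoint ::
    "'a nspace \<Rightarrow> 'b nspace \<Rightarrow> ('a \<Rightarrow> 'b) \<Rightarrow> ('b \<Rightarrow> real) \<Rightarrow> 'a \<Rightarrow> real" where
  "adjoint V W T = (\<lambda>g\<in>carrier (dual W). compose (carrier V) g T)"

abbreviation biadjoint where
  "biadjoint V W T \<equiv> adjoint (dual W) (dual V) (adjoint V W T)"

definition isometric_iso :: "'a nspace \<Rightarrow> 'b nspace \<Rightarrow> ('a \<Rightarrow> 'b) \<Rightarrow> bool" where
  "isometric_iso V W i \<longleftrightarrow> i \<in> bounded_ops V W \<and> bij_betw i (carrier V) (carrier W) \<and>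
     (\<forall>x\<in>carrier V. vnorm W (i x) = vnorm V x)"

text \<open>
  The compact-open topology on the bounded operators, given as the topology of uniform convergence
  on compact sets.
\<close>

definition tau_c :: "'a nspace \<Rightarrow> 'b nspace \<Rightarrow> ('a \<Rightarrow> 'b) topology" where
  "tau_c V W = topology_generated_by
     {{S \<in> bounded_ops V W. \<forall>x\<in>K. vdist W (S x) (T x) < e} | T K e.
        T \<in> bounded_ops V W \<and> compactin (vtopology V) K \<and> e > 0}"


section \<open>Operator ideals\<close>

text \<open>
  HOL has no type of all Banach spaces. Operator ideals are therefore taken on the class of all
  Banach spaces whose carrier is a set of elements of a type \<open>'u\<close>, which is arbitrary and plays
  the role of a universe. Up to isometric isomorphism these are exactly the Banach spaces
  satisfying \<open>fits\<close> below. Conditions on all Banach spaces that involve biduals are imposed on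
  those spaces whose biduals fit too; an ideal on the class of all Banach spaces restricts to an
  ideal on the universe and inherits these conditions.
\<close>

type_synonym 'u ideal = "'u nspace \<Rightarrow> 'u nspace \<Rightarrow> ('u \<Rightarrow> 'u) set"

definition fits :: "'u itself \<Rightarrow> 'a nspace \<Rightarrow> bool" where
  "fits _ V \<longleftrightarrow> (\<exists>g :: 'a \<Rightarrow> 'u. inj_on g (carrier V))"

text \<open>
  Being a linear subspace that contains the operators of rank at most one amounts to being a linear
  subspace that contains all operators of finite rank.
\<close>

definition operator_ideal :: "'u ideal \<Rightarrow> bool" where
  "operator_ideal A \<longleftrightarrow>
     (\<forall>V W. banach_space V \<and> banach_space W \<longrightarrow>
        submodule (A V W) real_ring (op_space V W) \<and>
        (\<forall>f\<in>carrier (dual V). \<forall>y\<in>carrier W. (\<lambda>x\<in>carrier V. f x \<odot>\<^bsub>W\<^esub> y) \<in> A V W)) \<and>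
     (\<forall>U V W Y. banach_space U \<and> banach_space V \<and> banach_space W \<and> banach_space Y \<longrightarrow>
        (\<forall>S\<in>bounded_ops U V. \<forall>T\<in>A V W. \<forall>R\<in>bounded_ops W Y.
           compose (carrier U) R (compose (carrier U) T S) \<in> A U Y))"

text \<open>
  The operators of the ideal between Banach spaces carried by other types, such as biduals: an
  operator is tested on isometric copies inside the universe. By the ideal property the choice of
  the copies is immaterial, and on the universe itself this is \<open>A\<close> again.
\<close>

definition ideal_ops :: "'u ideal \<Rightarrow> 'a nspace \<Rightarrow> 'b nspace \<Rightarrow> ('a \<Rightarrow> 'b) set" where
  "ideal_ops A V W = {T \<in> bounded_ops V W.
     \<exists>V' W' i j. banach_space V' \<and> banach_space W' \<and>
       isometric_iso V V' i \<and> isometric_iso W W' j \<and>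
       (\<lambda>x\<in>carrier V'. j (T (inv_into (carrier V) i x))) \<in> A V' W'}"

definition dd_ideal :: "'u ideal \<Rightarrow> 'u ideal" where
  "dd_ideal A V W = {T \<in> bounded_ops V W. biadjoint V W T \<in> ideal_ops A (bidual V) (bidual W)}"

text \<open>The meaning of \<open>T\<^sup>*\<^sup>* \<in> A(Z\<^sup>*\<^sup>*, Z)\<close> for an operator \<open>T\<close> on \<open>Z\<close>.\<close>

definition biadjoint_into_space :: "'u ideal \<Rightarrow> 'a nspace \<Rightarrow> ('a \<Rightarrow> 'a) \<Rightarrow> bool" where
  "biadjoint_into_space A Z T \<longleftrightarrow>
     biadjoint Z Z T ` carrier (bidual Z) \<subseteq> canon Z ` carrier Z \<and>
     (\<lambda>\<phi>\<in>carrier (bidual Z). inv_into (carrier Z) (canon Z) (biadjoint Z Z T \<phi>))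
       \<in> ideal_ops A (bidual Z) Z"


section \<open>Approximation properties and local reflexivity\<close>

definition ideal_ball :: "'u ideal \<Rightarrow> real \<Rightarrow> 'a nspace \<Rightarrow> ('a \<Rightarrow> 'a) set" where
  "ideal_ball A l Z = {T \<in> ideal_ops A Z Z. opnorm Z Z T \<le> l}"

definition has_BAP :: "'u ideal \<Rightarrow> 'a nspace \<Rightarrow> bool" where
  "has_BAP A Z \<longleftrightarrow>
     (\<exists>l\<ge>1. (\<lambda>x\<in>carrier Z. x) \<in> tau_c Z Z closure_of ideal_ball A l Z)"

text \<open>
  In the next two definitions \<open>Y\<close> is the dual space of \<open>Z\<close> by means of an isometric isomorphism
  \<open>J\<close> from \<open>Y\<close> onto \<open>dual Z\<close>, through which adjoints of operators on \<open>Z\<close> are read as operators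
  on \<open>Y\<close>.
\<close>

definition conj_ball ::
    "'u ideal \<Rightarrow> real \<Rightarrow> 'a nspace \<Rightarrow> 'b nspace \<Rightarrow> ('b \<Rightarrow> 'a \<Rightarrow> real) \<Rightarrow> ('b \<Rightarrow> 'b) set" where
  "conj_ball A l Z Y J = {S \<in> bounded_ops Y Y.
     \<exists>T\<in>ideal_ball A l Z. \<forall>y\<in>carrier Y. J (S y) = adjoint Z Z T (J y)}"

definition has_BAP_conj ::
    "'u ideal \<Rightarrow> 'a nspace \<Rightarrow> 'b nspace \<Rightarrow> ('b \<Rightarrow> 'a \<Rightarrow> real) \<Rightarrow> bool" where
  "has_BAP_conj A Z Y J \<longleftrightarrow>
     (\<exists>l\<ge>1. (\<lambda>y\<in>carrier Y. y) \<in> tau_c Y Y closure_of conj_ball A l Z Y J)"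

definition strongly_ext_loc_reflexive :: "'a nspace \<Rightarrow> bool" where
  "strongly_ext_loc_reflexive Z \<longleftrightarrow>
     (\<exists>l\<ge>1. \<forall>E F. fin_dim_subspace (bidual Z) E \<and> fin_dim_subspace (dual Z) F \<longrightarrow>
        (\<forall>e>0. \<exists>T\<in>bounded_ops (bidual Z) (bidual Z).
           opnorm (bidual Z) (bidual Z) T \<le> l + e \<and>
           T ` E \<subseteq> canon Z ` carrier Z \<and>
           adjoint (bidual Z) (bidual Z) T ` (canon (dual Z) ` carrier (dual Z))
             \<subseteq> canon (dual Z) ` carrier (dual Z) \<and>
           (\<forall>\<phi>\<in>E. \<forall>f\<in>F. T \<phi> f = \<phi> f)))"


section \<open>Lipschitz functions and the Lipschitz-free space\<close>

text \<open>
  The supremum defining the norm runs over all pairs: those with \<open>x = y\<close> contribute \<open>0 / 0 = 0\<close>,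
  which only matters when \<open>'a\<close> is the zero space.
\<close>

definition lip0 :: "('a::real_normed_vector \<Rightarrow> real) nspace" where
  "lip0 = \<lparr>carrier = {f. f 0 = 0 \<and> (\<exists>C. C-lipschitz_on UNIV f)},
     mult = undefined, one = undefined,
     zero = (\<lambda>x. 0), add = (\<lambda>f g x. f x + g x), smult = (\<lambda>a f x. a * f x),
     vnorm = (\<lambda>f. SUP (x, y). \<bar>f x - f y\<bar> / norm (x - y))\<rparr>"

definition delta :: "'a::real_normed_vector \<Rightarrow> ('a \<Rightarrow> real) \<Rightarrow> real" where
  "delta x = (\<lambda>f\<in>carrier lip0. f x)"

definition free_space :: "(('a::real_normed_vector \<Rightarrow> real) \<Rightarrow> real) nspace" where
  "free_space = (dual lip0)\<lparr>carrier := vtopology (dual lip0) closure_of linspan (dual lip0) (range delta)\<rparr>"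

text \<open>The isometric identification of the Lipschitz functions with the dual of the free space.\<close>

definition lip0_dual_map :: "('a::real_normed_vector \<Rightarrow> real) \<Rightarrow> (('a \<Rightarrow> real) \<Rightarrow> real) \<Rightarrow> real" where
  "lip0_dual_map f = (\<lambda>\<mu>\<in>carrier free_space. \<mu> f)"

end

theory Submission
  imports Defs
begin

text \<open>
  Let \<open>Z\<close> be a normed space with dual \<open>Z\<^sup>*\<close>. The equivalence comes from the two facts that, for a
  bounded set of operators on \<open>Z\<close>, convergence to the identity uniformly on compact sets is
  convergence at each point (lemma \<open>id_in_tau_c_closure_iff\<close>), and that a convex set of operators
  which approximates the identity weakly, i.e. up to finitely many functionals at a time, also
  approximates it in norm (\<open>weak_approximation_imp_norm_approximation\<close>, a form of Mazur's theorem,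
  which rests on the Hahn-Banach theorem \<open>hahn_banach_cone\<close>). The operators of norm at most \<open>l\<close>
  in the ideal form such a bounded convex set, and so do their adjoints. The condition on the ideal
  says that for each of its operators \<open>T\<close> on \<open>Z\<close> the biadjoint factors through an operator \<open>U\<close> of
  the ideal from \<open>Z\<^sup>*\<^sup>*\<close> to \<open>Z\<close>, with \<open>f (U \<phi>) = \<phi> (T\<^sup>* f)\<close> (\<open>biadjoint_factor\<close>).

  Suppose that the adjoints approximate the identity of \<open>Z\<^sup>*\<close>. As
  \<open>f (T x) - f x = (T\<^sup>* f - f) x\<close>, the operators themselves approximate the identity of \<open>Z\<close> weakly,
  hence in norm. For local reflexivity at a finite-dimensional \<open>F\<close> in \<open>Z\<^sup>*\<close>, take \<open>S\<close> in the ideal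
  with \<open>S\<^sup>*\<close> close to the identity on finitely many functionals and add to it a small operator of
  finite rank, so that the adjoint of the sum \<open>R\<close> fixes \<open>F\<close> pointwise. Then \<open>R\<^sup>*\<^sup>*\<close> maps all of \<open>Z\<^sup>*\<^sup>*\<close>
  into \<open>Z\<close>, its adjoint maps \<open>Z\<^sup>*\<close> into itself, and \<open>(R\<^sup>*\<^sup>* \<phi>) f = \<phi> (R\<^sup>* f) = \<phi> f\<close> for \<open>f\<close> in \<open>F\<close>.

  Conversely, let finitely many \<open>\<phi>\<close> in \<open>Z\<^sup>*\<^sup>*\<close> and \<open>f\<close> in \<open>Z\<^sup>*\<close> be given. Local reflexivity yields \<open>T\<close>
  on \<open>Z\<^sup>*\<^sup>*\<close> with \<open>T \<phi> = z\<close> in \<open>Z\<close>, \<open>f z = \<phi> f\<close>, and \<open>T\<^sup>*\<close> mapping \<open>Z\<^sup>*\<close> into itself. Choose \<open>R\<close> in the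
  ideal with \<open>R z\<close> close to \<open>z\<close>. The operator \<open>S = R\<^sup>*\<^sup>* T\<close>, restricted to \<open>Z\<close>, lies in the ideal and
  satisfies \<open>S\<^sup>* = T\<^sup>* R\<^sup>*\<close> on \<open>Z\<^sup>*\<close>, so \<open>\<phi> (S\<^sup>* f) = (T \<phi>) (R\<^sup>* f) = f (R z)\<close>, which is close to
  \<open>f z = \<phi> f\<close>. Thus the operators \<open>S\<^sup>*\<close> approximate the identity of \<open>Z\<^sup>*\<close> weakly, hence in norm.

  It remains to know that the Lipschitz functions are the dual of the Lipschitz-free space
  (\<open>isometric_iso_lip0_dual_map\<close>): a functional \<open>g\<close> on the free space is evaluation at the Lipschitz
  function \<open>\<lambda>x. g (delta x)\<close>.
\<close>

section \<open>Normed spaces\<close>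

locale normed_space = Module.module real_ring V for V :: "'a nspace" (structure) +
  assumes norm_eq_zero: "x \<in> carrier V \<Longrightarrow> vnorm V x = 0 \<longleftrightarrow> x = \<zero>"
    and norm_smult: "x \<in> carrier V \<Longrightarrow> vnorm V (a \<odot> x) = \<bar>a\<bar> * vnorm V x"
    and norm_triangle:
      "\<lbrakk>x \<in> carrier V; y \<in> carrier V\<rbrakk> \<Longrightarrow> vnorm V (x \<oplus> y) \<le> vnorm V x + vnorm V y"

lemma real_ring_simps [simp]:
  "carrier real_ring = UNIV" "mult real_ring = (*)" "one real_ring = 1"
  "zero real_ring = 0" "add real_ring = (+)"
  by (simp_all add: real_ring_def)

lemma real_space_simps [simp]:
  "carrier real_space = UNIV" "zero real_space = 0" "add real_space = (+)"
  "smult real_space = (*)" "vnorm real_space = abs"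
  by (simp_all add: real_space_def)

lemma cring_real_ring: "cring real_ring"
proof (intro cringI abelian_groupI comm_monoidI)
  fix x :: real
  show "\<exists>y\<in>carrier real_ring. y \<oplus>\<^bsub>real_ring\<^esub> x = \<zero>\<^bsub>real_ring\<^esub>"
    by (auto intro: exI[of _ "- x"])
qed (auto simp: algebra_simps)

lemma module_realI:
  fixes V :: "'a nspace" (structure)
  assumes "\<And>x y. \<lbrakk>x \<in> carrier V; y \<in> carrier V\<rbrakk> \<Longrightarrow> x \<oplus> y \<in> carrier V"
    and "\<zero> \<in> carrier V"
    and "\<And>a x. x \<in> carrier V \<Longrightarrow> a \<odot> x \<in> carrier V"
    and "\<And>x y z. \<lbrakk>x \<in> carrier V; y \<in> carrier V; z \<in> carrier V\<rbrakk> \<Longrightarrow> (x \<oplus> y) \<oplus> z = x \<oplus> (y \<oplus> z)"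
    and "\<And>x y. \<lbrakk>x \<in> carrier V; y \<in> carrier V\<rbrakk> \<Longrightarrow> x \<oplus> y = y \<oplus> x"
    and "\<And>x. x \<in> carrier V \<Longrightarrow> \<zero> \<oplus> x = x"
    and "\<And>x. x \<in> carrier V \<Longrightarrow> (-1) \<odot> x \<oplus> x = \<zero>"
    and "\<And>a b x. x \<in> carrier V \<Longrightarrow> (a + b) \<odot> x = a \<odot> x \<oplus> b \<odot> x"
    and "\<And>a x y. \<lbrakk>x \<in> carrier V; y \<in> carrier V\<rbrakk> \<Longrightarrow> a \<odot> (x \<oplus> y) = a \<odot> x \<oplus> a \<odot> y"
    and "\<And>a b x. x \<in> carrier V \<Longrightarrow> (a * b) \<odot> x = a \<odot> (b \<odot> x)"
    and "\<And>x. x \<in> carrier V \<Longrightarrow> 1 \<odot> x = x"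
  shows "Module.module real_ring V"
proof (rule moduleI)
  show "abelian_group V"
  proof (rule abelian_groupI)
    show "\<exists>y\<in>carrier V. y \<oplus> x = \<zero>" if "x \<in> carrier V" for x
      using assms(3,7) that by blast
  qed (assumption | rule assms(1,2,4,5,6))+
qed (simp_all add: cring_real_ring assms(3,8-))

context normed_space
begin

lemma add_mem: "x \<in> carrier V \<Longrightarrow> y \<in> carrier V \<Longrightarrow> x \<oplus> y \<in> carrier V"
  by simp

lemma zero_mem: "\<zero> \<in> carrier V"
  by simp

lemma smult_mem: "x \<in> carrier V \<Longrightarrow> a \<odot> x \<in> carrier V"
  by simp

lemma smult_1: "x \<in> carrier V \<Longrightarrow> 1 \<odot> x = x"
  using smult_one by simp

lemma smult_0: "x \<in> carrier V \<Longrightarrow> 0 \<odot> x = \<zero>"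
  using smult_l_null by simp

lemma smult_plus: "x \<in> carrier V \<Longrightarrow> (a + b) \<odot> x = a \<odot> x \<oplus> b \<odot> x"
  using smult_l_distr by simp

lemma smult_vadd: "x \<in> carrier V \<Longrightarrow> y \<in> carrier V \<Longrightarrow> a \<odot> (x \<oplus> y) = a \<odot> x \<oplus> a \<odot> y"
  using smult_r_distr by simp

lemma smult_times: "x \<in> carrier V \<Longrightarrow> a \<odot> (b \<odot> x) = (a * b) \<odot> x"
  using smult_assoc1 by simp

lemma smult_zero: "a \<odot> \<zero> = \<zero>"
  using smult_r_null by simp

text \<open>
  Differences are written with the scalar \<open>-1\<close> throughout, since the group inverse of a module is
  a definite description that simplification does not evaluate.
\<close>

lemma vminus_eq: "x \<in> carrier V \<Longrightarrow> y \<in> carrier V \<Longrightarrow> x \<ominus> y = x \<oplus> (-1) \<odot> y"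
proof -
  assume xy: "x \<in> carrier V" "y \<in> carrier V"
  have "(-1) \<odot> y \<oplus> y = ((-1) + 1) \<odot> y"
    using xy smult_plus[of y "-1" 1] by (simp only: smult_1)
  then have "(-1) \<odot> y \<oplus> y = \<zero>"
    using xy by (simp add: smult_0)
  then have "(-1) \<odot> y = \<ominus> y"
    using xy by (metis M.minus_equality smult_mem)
  then show ?thesis
    by (simp add: a_minus_def)
qed

lemma norm_zero: "vnorm V \<zero> = 0"
  using norm_eq_zero by simp

lemma norm_nonneg: "x \<in> carrier V \<Longrightarrow> 0 \<le> vnorm V x"
proof -
  assume x: "x \<in> carrier V"
  have "x \<oplus> (-1) \<odot> x = \<zero>"
    using x vminus_eq[of x x] by (simp add: M.r_neg a_minus_def)
  then have "0 \<le> vnorm V x + vnorm V ((-1) \<odot> x)"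
    using x norm_triangle[of x "(-1) \<odot> x"] norm_zero by simp
  then show ?thesis
    using x norm_smult[of x "-1"] by simp
qed

lemma vdist_eq: "x \<in> carrier V \<Longrightarrow> y \<in> carrier V \<Longrightarrow> vdist V x y = vnorm V (x \<oplus> (-1) \<odot> y)"
  by (simp add: vdist_def vminus_eq)

lemma smult_minus_add: "x \<in> carrier V \<Longrightarrow> y \<in> carrier V \<Longrightarrow> (-1) \<odot> (x \<oplus> (-1) \<odot> y) = y \<oplus> (-1) \<odot> x"
  by (simp add: smult_vadd smult_times smult_1 M.a_comm)

lemma minus_cancel: "x \<in> carrier V \<Longrightarrow> x \<oplus> (-1) \<odot> x = \<zero>"
  using vminus_eq[of x x] by (simp add: M.r_neg a_minus_def)

lemma minus_add_minus:
  "x \<in> carrier V \<Longrightarrow> y \<in> carrier V \<Longrightarrow> z \<in> carrier V \<Longrightarrow>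
   x \<oplus> (-1) \<odot> z = (x \<oplus> (-1) \<odot> y) \<oplus> (y \<oplus> (-1) \<odot> z)"
proof -
  assume c: "x \<in> carrier V" "y \<in> carrier V" "z \<in> carrier V"
  then have "(x \<oplus> (-1) \<odot> y) \<oplus> (y \<oplus> (-1) \<odot> z) = (x \<oplus> (y \<oplus> (-1) \<odot> y)) \<oplus> (-1) \<odot> z"
    by (simp add: M.a_ac smult_mem)
  then show ?thesis
    using c by (simp add: minus_cancel)
qed

lemma eq_if_minus_zero: "x \<in> carrier V \<Longrightarrow> y \<in> carrier V \<Longrightarrow> x \<oplus> (-1) \<odot> y = \<zero> \<Longrightarrow> x = y"
proof -
  assume c: "x \<in> carrier V" "y \<in> carrier V" and 0: "x \<oplus> (-1) \<odot> y = \<zero>"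
  have "x = x \<oplus> ((-1) \<odot> y \<oplus> y)"
    using c minus_cancel[of y] by (simp add: M.a_comm smult_mem)
  also have "\<dots> = y"
    using c 0 by (simp add: M.a_assoc[symmetric] smult_mem)
  finally show ?thesis .
qed

sublocale metric: Metric_space "carrier V" "vdist V"
proof
  show "0 \<le> vdist V x y" for x y
    using norm_nonneg[of "x \<oplus> (-1) \<odot> y"] by (cases "x \<in> carrier V \<and> y \<in> carrier V")
      (auto simp: vdist_eq, auto simp: vdist_def)
  show "vdist V x y = vdist V y x" for x y
  proof (cases "x \<in> carrier V \<and> y \<in> carrier V")
    case True
    then show ?thesis
      using norm_smult[of "x \<oplus> (-1) \<odot> y" "-1"] by (simp add: vdist_eq smult_minus_add)
  qed (auto simp: vdist_def)
  show "vdist V x y = 0 \<longleftrightarrow> x = y" if "x \<in> carrier V" "y \<in> carrier V" for x y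
    using that eq_if_minus_zero[of x y] minus_cancel[of x]
    by (auto simp: vdist_eq norm_eq_zero)
  show "vdist V x z \<le> vdist V x y + vdist V y z"
    if "x \<in> carrier V" "y \<in> carrier V" "z \<in> carrier V" for x y z
    using that norm_triangle[of "x \<oplus> (-1) \<odot> y" "y \<oplus> (-1) \<odot> z"] minus_add_minus[of x y z]
    by (simp add: vdist_eq)
qed

lemma submodule_realI:
  assumes "H \<subseteq> carrier V" "\<zero> \<in> H" "\<And>x y. \<lbrakk>x \<in> H; y \<in> H\<rbrakk> \<Longrightarrow> x \<oplus> y \<in> H"
    and "\<And>a x. x \<in> H \<Longrightarrow> a \<odot> x \<in> H"
  shows "submodule H real_ring V"
proof (rule submoduleI)
  fix x assume x: "x \<in> H"
  have "\<ominus> x = (-1) \<odot> x"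
    using x assms(1) vminus_eq[of \<zero> x] by (auto simp: a_minus_def)
  then show "\<ominus> x \<in> H"
    using assms(4) x by simp
qed (use assms in auto)

end

lemma submodule_realD:
  assumes "submodule H real_ring V"
  shows "H \<subseteq> carrier V" "\<zero>\<^bsub>V\<^esub> \<in> H" "\<And>x y. \<lbrakk>x \<in> H; y \<in> H\<rbrakk> \<Longrightarrow> x \<oplus>\<^bsub>V\<^esub> y \<in> H"
    "\<And>a x. x \<in> H \<Longrightarrow> a \<odot>\<^bsub>V\<^esub> x \<in> H"
proof -
  interpret submodule H real_ring V by fact
  show "H \<subseteq> carrier V" "\<zero>\<^bsub>V\<^esub> \<in> H" "\<And>x y. \<lbrakk>x \<in> H; y \<in> H\<rbrakk> \<Longrightarrow> x \<oplus>\<^bsub>V\<^esub> y \<in> H"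
    "\<And>a x. x \<in> H \<Longrightarrow> a \<odot>\<^bsub>V\<^esub> x \<in> H"
    using subset one_closed m_closed smult_closed by auto
qed

lemma banach_space_imp_normed_space: "banach_space V \<Longrightarrow> normed_space V"
  unfolding banach_space_def normed_space_def banach_space_axioms_def normed_space_axioms_def
  by blast

declare normed_space.add_mem [simp] normed_space.zero_mem [simp] normed_space.smult_mem [simp]
  normed_space.smult_1 [simp] normed_space.smult_0 [simp] normed_space.smult_zero [simp]
  normed_space.norm_zero [simp] normed_space.norm_nonneg [simp] normed_space.smult_times [simp]
  normed_space.minus_cancel [simp]

lemma normed_space_real_space [simp]: "normed_space real_space"
  by (intro normed_space.intro module_realI normed_space_axioms.intro)
    (auto simp: algebra_simps abs_mult)

lemma normed_space_subspace:
  assumes V: "normed_space V" and H: "submodule H real_ring V"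
  shows "normed_space (V\<lparr>carrier := H\<rparr>)"
proof -
  interpret V: normed_space V by fact
  note D = submodule_realD[OF H]
  show ?thesis
    by (intro normed_space.intro submodule.submodule_is_module[OF H] normed_space_axioms.intro)
      (use D(1) V.norm_eq_zero V.norm_smult V.norm_triangle V.module_axioms in \<open>auto simp: subset_iff\<close>)
qed


section \<open>Bounded operators\<close>

lemma bounded_ops_mem: "T \<in> bounded_ops V W \<Longrightarrow> x \<in> carrier V \<Longrightarrow> T x \<in> carrier W"
  by (auto simp: bounded_ops_def)

lemma bounded_ops_add:
  "T \<in> bounded_ops V W \<Longrightarrow> x \<in> carrier V \<Longrightarrow> y \<in> carrier V \<Longrightarrow>
   T (x \<oplus>\<^bsub>V\<^esub> y) = T x \<oplus>\<^bsub>W\<^esub> T y"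
  by (auto simp: bounded_ops_def)

lemma bounded_ops_smult:
  "T \<in> bounded_ops V W \<Longrightarrow> x \<in> carrier V \<Longrightarrow> T (a \<odot>\<^bsub>V\<^esub> x) = a \<odot>\<^bsub>W\<^esub> T x"
  by (auto simp: bounded_ops_def)

lemma bounded_ops_zero:
  assumes "normed_space V" "normed_space W" "T \<in> bounded_ops V W"
  shows "T \<zero>\<^bsub>V\<^esub> = \<zero>\<^bsub>W\<^esub>"
  using assms bounded_ops_smult[of T V W "\<zero>\<^bsub>V\<^esub>" 0]
  by (simp add: bounded_ops_mem[OF assms(3)])

lemma bounded_ops_diff:
  assumes "normed_space V" "T \<in> bounded_ops V W" "x \<in> carrier V" "y \<in> carrier V"
  shows "T (x \<oplus>\<^bsub>V\<^esub> (-1) \<odot>\<^bsub>V\<^esub> y) = T x \<oplus>\<^bsub>W\<^esub> (-1) \<odot>\<^bsub>W\<^esub> T y"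
  using assms by (simp add: bounded_ops_add[OF assms(2)] bounded_ops_smult[OF assms(2)])

lemma bounded_ops_ext: "T \<in> bounded_ops V W \<Longrightarrow> T \<in> extensional (carrier V)"
  by (simp add: bounded_ops_def PiE_iff)

lemma bounded_opsI:
  assumes "T \<in> extensional (carrier V)"
    and "\<And>x. x \<in> carrier V \<Longrightarrow> T x \<in> carrier W"
    and "\<And>x y. \<lbrakk>x \<in> carrier V; y \<in> carrier V\<rbrakk> \<Longrightarrow> T (x \<oplus>\<^bsub>V\<^esub> y) = T x \<oplus>\<^bsub>W\<^esub> T y"
    and "\<And>a x. x \<in> carrier V \<Longrightarrow> T (a \<odot>\<^bsub>V\<^esub> x) = a \<odot>\<^bsub>W\<^esub> T x"
    and "\<And>x. x \<in> carrier V \<Longrightarrow> vnorm W (T x) \<le> C * vnorm V x"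
  shows "T \<in> bounded_ops V W"
proof -
  have "\<exists>C. \<forall>x\<in>carrier V. vnorm W (T x) \<le> C * vnorm V x"
    using assms(5) by (intro exI[of _ C]) simp
  then show ?thesis
    using assms(1-4) by (simp add: bounded_ops_def PiE_iff)
qed

lemma bounded_ops_restrictI:
  assumes "normed_space V"
    and "\<And>x. x \<in> carrier V \<Longrightarrow> T x \<in> carrier W"
    and "\<And>x y. \<lbrakk>x \<in> carrier V; y \<in> carrier V\<rbrakk> \<Longrightarrow> T (x \<oplus>\<^bsub>V\<^esub> y) = T x \<oplus>\<^bsub>W\<^esub> T y"
    and "\<And>a x. x \<in> carrier V \<Longrightarrow> T (a \<odot>\<^bsub>V\<^esub> x) = a \<odot>\<^bsub>W\<^esub> T x"
    and "\<And>x. x \<in> carrier V \<Longrightarrow> vnorm W (T x) \<le> C * vnorm V x"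
  shows "(\<lambda>x\<in>carrier V. T x) \<in> bounded_ops V W"
  by (rule bounded_opsI[where C = C]) (use assms in auto)

lemma opnorm_bound:
  assumes V: "normed_space V" and W: "normed_space W" and T: "T \<in> bounded_ops V W"
    and x: "x \<in> carrier V"
  shows "vnorm W (T x) \<le> opnorm V W T * vnorm V x"
proof (cases "vnorm V x = 0")
  case True
  then have "x = \<zero>\<^bsub>V\<^esub>"
    using normed_space.norm_eq_zero[OF V x] by simp
  then show ?thesis
    using bounded_ops_zero[OF V W T] V W by simp
next
  case False
  then have pos: "vnorm V x > 0"
    using V x by (simp add: order_less_le)
  obtain C where C: "\<And>y. y \<in> carrier V \<Longrightarrow> vnorm W (T y) \<le> C * vnorm V y"
    using T unfolding bounded_ops_def by blast
  have "vnorm W (T y) / vnorm V y \<le> \<bar>C\<bar>" if y: "y \<in> carrier V" for y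
  proof (cases "vnorm V y = 0")
    case False
    then have "vnorm V y > 0"
      using V y by (simp add: order_less_le)
    moreover have "C * vnorm V y \<le> \<bar>C\<bar> * vnorm V y"
      using V y by (intro mult_right_mono) auto
    ultimately show ?thesis
      using order_trans[OF C[OF y]] by (simp only: divide_le_eq if_True)
  qed simp
  then have "bdd_above ((\<lambda>y. vnorm W (T y) / vnorm V y) ` carrier V)"
    by (auto intro!: bdd_aboveI2)
  then have "vnorm W (T x) / vnorm V x \<le> opnorm V W T"
    unfolding opnorm_def using x by (rule cSUP_upper2) simp
  then show ?thesis
    using pos by (simp add: divide_le_eq)
qed

lemma opnorm_le:
  assumes V: "normed_space V" and W: "normed_space W" and c: "0 \<le> c"
    and bound: "\<And>x. x \<in> carrier V \<Longrightarrow> vnorm W (T x) \<le> c * vnorm V x"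
  shows "opnorm V W T \<le> c"
  unfolding opnorm_def
proof (rule cSUP_least)
  show "carrier V \<noteq> {}"
    using normed_space.zero_mem[OF V] by blast
next
  fix x assume x: "x \<in> carrier V"
  show "vnorm W (T x) / vnorm V x \<le> c"
  proof (cases "vnorm V x = 0")
    case False
    then have "vnorm V x > 0"
      using V x by (simp add: order_less_le)
    then show ?thesis
      using bound[OF x] by (simp add: divide_le_eq)
  qed (use c in simp)
qed

lemma opnorm_nonneg:
  assumes V: "normed_space V" and W: "normed_space W" and T: "T \<in> bounded_ops V W"
  shows "0 \<le> opnorm V W T"
proof (cases "\<exists>x\<in>carrier V. vnorm V x \<noteq> 0")
  case True
  then obtain x where x: "x \<in> carrier V" "vnorm V x \<noteq> 0" by blast
  then have "vnorm V x > 0"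
    using V by (simp add: order_less_le)
  moreover have "0 \<le> opnorm V W T * vnorm V x"
    using opnorm_bound[OF V W T x(1)] normed_space.norm_nonneg[OF W] T x(1)
    by (meson bounded_ops_mem order_trans)
  ultimately show ?thesis
    by (simp add: zero_le_mult_iff)
next
  case False
  then have "opnorm V W T = (SUP x\<in>carrier V. 0)"
    unfolding opnorm_def by (intro SUP_cong) auto
  also have "\<dots> = 0"
    using normed_space.zero_mem[OF V] by (intro cSUP_const) blast
  finally show ?thesis by simp
qed

lemma compose_bounded_ops:
  assumes U: "normed_space U" and V: "normed_space V" and W: "normed_space W"
    and S: "S \<in> bounded_ops U V" and T: "T \<in> bounded_ops V W"
  shows "compose (carrier U) T S \<in> bounded_ops U W"
proof (rule bounded_opsI)
  fix x assume x: "x \<in> carrier U"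
  have "vnorm W (T (S x)) \<le> opnorm V W T * vnorm V (S x)"
    by (rule opnorm_bound) (use assms x in \<open>auto simp: bounded_ops_mem[OF S]\<close>)
  also have "\<dots> \<le> opnorm V W T * (opnorm U V S * vnorm U x)"
    by (intro mult_left_mono opnorm_bound opnorm_nonneg) (use assms x in \<open>auto simp: bounded_ops_mem[OF S]\<close>)
  finally show "vnorm W (compose (carrier U) T S x) \<le> (opnorm V W T * opnorm U V S) * vnorm U x"
    using x by (simp add: compose_eq)
qed (use U V in \<open>auto simp: compose_def bounded_ops_mem[OF S] bounded_ops_mem[OF T]
    bounded_ops_add[OF S] bounded_ops_add[OF T] bounded_ops_smult[OF S] bounded_ops_smult[OF T]\<close>)

lemma op_space_simps [simp]:
  "carrier (op_space V W) = bounded_ops V W"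
  "zero (op_space V W) = (\<lambda>x\<in>carrier V. \<zero>\<^bsub>W\<^esub>)"
  "add (op_space V W) S T = (\<lambda>x\<in>carrier V. S x \<oplus>\<^bsub>W\<^esub> T x)"
  "smult (op_space V W) a T = (\<lambda>x\<in>carrier V. a \<odot>\<^bsub>W\<^esub> T x)"
  "vnorm (op_space V W) = opnorm V W"
  by (simp_all add: op_space_def)

lemma add_bounded_ops:
  assumes V: "normed_space V" and W: "normed_space W"
    and S: "S \<in> bounded_ops V W" and T: "T \<in> bounded_ops V W"
  shows "(\<lambda>x\<in>carrier V. S x \<oplus>\<^bsub>W\<^esub> T x) \<in> bounded_ops V W"
proof (rule bounded_ops_restrictI[OF V])
  interpret W: normed_space W by fact
  note [simp] = bounded_ops_mem[OF S] bounded_ops_mem[OF T]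
  fix x assume x: "x \<in> carrier V"
  show "vnorm W (S x \<oplus>\<^bsub>W\<^esub> T x) \<le> (opnorm V W S + opnorm V W T) * vnorm V x"
    using W.norm_triangle[of "S x" "T x"] opnorm_bound[OF V W S x] opnorm_bound[OF V W T x] S T x
    by (simp add: algebra_simps)
  show "S (a \<odot>\<^bsub>V\<^esub> x) \<oplus>\<^bsub>W\<^esub> T (a \<odot>\<^bsub>V\<^esub> x) = a \<odot>\<^bsub>W\<^esub> (S x \<oplus>\<^bsub>W\<^esub> T x)" for a
    using x by (simp add: bounded_ops_smult[OF S] bounded_ops_smult[OF T] W.smult_vadd)
  show "S (x \<oplus>\<^bsub>V\<^esub> y) \<oplus>\<^bsub>W\<^esub> T (x \<oplus>\<^bsub>V\<^esub> y) = (S x \<oplus>\<^bsub>W\<^esub> T x) \<oplus>\<^bsub>W\<^esub> (S y \<oplus>\<^bsub>W\<^esub> T y)"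
    if "y \<in> carrier V" for y
    using x that by (simp add: bounded_ops_add[OF S] bounded_ops_add[OF T] W.M.a_ac)
  show "S x \<oplus>\<^bsub>W\<^esub> T x \<in> carrier W"
    using x by simp
qed

lemma smult_bounded_ops:
  assumes V: "normed_space V" and W: "normed_space W" and T: "T \<in> bounded_ops V W"
  shows "(\<lambda>x\<in>carrier V. a \<odot>\<^bsub>W\<^esub> T x) \<in> bounded_ops V W"
proof (rule bounded_ops_restrictI[OF V])
  interpret W: normed_space W by fact
  note [simp] = bounded_ops_mem[OF T]
  fix x assume x: "x \<in> carrier V"
  show "vnorm W (a \<odot>\<^bsub>W\<^esub> T x) \<le> (\<bar>a\<bar> * opnorm V W T) * vnorm V x"
    using mult_left_mono[OF opnorm_bound[OF V W T x], of "\<bar>a\<bar>"] T x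
    by (simp add: W.norm_smult algebra_simps)
  show "a \<odot>\<^bsub>W\<^esub> T (b \<odot>\<^bsub>V\<^esub> x) = b \<odot>\<^bsub>W\<^esub> (a \<odot>\<^bsub>W\<^esub> T x)" for b
    using x W by (simp add: bounded_ops_smult[OF T] mult.commute)
  show "a \<odot>\<^bsub>W\<^esub> T (x \<oplus>\<^bsub>V\<^esub> y) = a \<odot>\<^bsub>W\<^esub> T x \<oplus>\<^bsub>W\<^esub> a \<odot>\<^bsub>W\<^esub> T y"
    if "y \<in> carrier V" for y
    using x that by (simp add: bounded_ops_add[OF T] W.smult_vadd)
  show "a \<odot>\<^bsub>W\<^esub> T x \<in> carrier W"
    using x by simp
qed

lemma zero_bounded_ops:
  assumes V: "normed_space V" and W: "normed_space W"
  shows "(\<lambda>x\<in>carrier V. \<zero>\<^bsub>W\<^esub>) \<in> bounded_ops V W"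
proof -
  interpret W: normed_space W by fact
  show ?thesis
    by (rule bounded_ops_restrictI[OF V, where C = 0]) (use assms in auto)
qed

lemma id_bounded_ops:
  "normed_space V \<Longrightarrow> (\<lambda>x\<in>carrier V. x) \<in> bounded_ops V V"
  by (rule bounded_ops_restrictI[where C = 1]) auto

lemma normed_space_op_space [simp]:
  assumes V: "normed_space V" and W: "normed_space W"
  shows "normed_space (op_space V W)"
proof (intro normed_space.intro module_realI normed_space_axioms.intro)
  interpret V: normed_space V by fact
  interpret W: normed_space W by fact
  note ext = extensionalityI[of _ "carrier V"] bounded_ops_ext
  fix S T R assume "S \<in> carrier (op_space V W)" and "T \<in> carrier (op_space V W)"
    and "R \<in> carrier (op_space V W)"
  then have S: "S \<in> bounded_ops V W" and T: "T \<in> bounded_ops V W" and R: "R \<in> bounded_ops V W"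
    by auto
  note [simp] = bounded_ops_mem[OF S] bounded_ops_mem[OF T] bounded_ops_mem[OF R]
  let ?O = "op_space V W"
  show "S \<oplus>\<^bsub>?O\<^esub> T \<in> carrier ?O" "a \<odot>\<^bsub>?O\<^esub> S \<in> carrier ?O" for a
    using S T add_bounded_ops[OF V W] smult_bounded_ops[OF V W] by auto
  show "(S \<oplus>\<^bsub>?O\<^esub> T) \<oplus>\<^bsub>?O\<^esub> R = S \<oplus>\<^bsub>?O\<^esub> (T \<oplus>\<^bsub>?O\<^esub> R)" "S \<oplus>\<^bsub>?O\<^esub> T = T \<oplus>\<^bsub>?O\<^esub> S"
    by (auto intro!: ext(1) simp: W.M.a_ac)
  show "\<zero>\<^bsub>?O\<^esub> \<oplus>\<^bsub>?O\<^esub> S = S" "1 \<odot>\<^bsub>?O\<^esub> S = S"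
    using S W by (auto intro!: ext(1) dest: ext(2))
  show "(- 1) \<odot>\<^bsub>?O\<^esub> S \<oplus>\<^bsub>?O\<^esub> S = \<zero>\<^bsub>?O\<^esub>"
    using S W.minus_cancel by (auto intro!: ext(1) simp: W.M.a_comm)
  show "(a + b) \<odot>\<^bsub>?O\<^esub> S = a \<odot>\<^bsub>?O\<^esub> S \<oplus>\<^bsub>?O\<^esub> b \<odot>\<^bsub>?O\<^esub> S" for a b
    using S by (auto intro!: ext(1) simp: W.smult_plus)
  show "a \<odot>\<^bsub>?O\<^esub> (S \<oplus>\<^bsub>?O\<^esub> T) = a \<odot>\<^bsub>?O\<^esub> S \<oplus>\<^bsub>?O\<^esub> a \<odot>\<^bsub>?O\<^esub> T" for a
    using S T by (auto intro!: ext(1) simp: W.smult_vadd)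
  show "(a * b) \<odot>\<^bsub>?O\<^esub> S = a \<odot>\<^bsub>?O\<^esub> (b \<odot>\<^bsub>?O\<^esub> S)" for a b
    using S W by (auto intro!: ext(1))
  show "(vnorm ?O S = 0) = (S = \<zero>\<^bsub>?O\<^esub>)"
  proof
    assume 0: "vnorm ?O S = 0"
    have "S x = \<zero>\<^bsub>W\<^esub>" if "x \<in> carrier V" for x
    proof -
      have "vnorm W (S x) \<le> 0"
        using opnorm_bound[OF V W S that] 0 by simp
      then show ?thesis
        using W.norm_eq_zero[of "S x"] W.norm_nonneg[of "S x"] S that by simp
    qed
    then show "S = \<zero>\<^bsub>?O\<^esub>"
      using S by (auto intro!: ext(1) dest: ext(2))
  next
    assume 0: "S = \<zero>\<^bsub>?O\<^esub>"
    have "opnorm V W S \<le> 0"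
      by (rule opnorm_le[OF V W]) (use 0 W in auto)
    then show "vnorm ?O S = 0"
      using opnorm_nonneg[OF V W S] by simp
  qed
  have le: "opnorm V W (a \<odot>\<^bsub>?O\<^esub> S) \<le> \<bar>a\<bar> * opnorm V W S" if "S \<in> bounded_ops V W" for a S
  proof (rule opnorm_le[OF V W])
    fix x assume x: "x \<in> carrier V"
    note [simp] = bounded_ops_mem[OF that]
    show "vnorm W ((a \<odot>\<^bsub>?O\<^esub> S) x) \<le> (\<bar>a\<bar> * opnorm V W S) * vnorm V x"
      using mult_left_mono[OF opnorm_bound[OF V W that x], of "\<bar>a\<bar>"] that x
      by (simp add: W.norm_smult algebra_simps)
  qed (use opnorm_nonneg[OF V W that] in simp)
  show "vnorm ?O (a \<odot>\<^bsub>?O\<^esub> S) = \<bar>a\<bar> * vnorm ?O S" for a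
  proof (cases "a = 0")
    case True
    then show ?thesis
      using le[OF S, of 0] opnorm_nonneg[OF V W smult_bounded_ops[OF V W S], of 0] by simp
  next
    case False
    have "(1 / a) \<odot>\<^bsub>?O\<^esub> (a \<odot>\<^bsub>?O\<^esub> S) = S"
      using S False W by (auto intro!: ext(1) dest: ext(2))
    then have "opnorm V W S \<le> \<bar>1 / a\<bar> * opnorm V W (a \<odot>\<^bsub>?O\<^esub> S)"
      using le[OF smult_bounded_ops[OF V W S], of "1 / a" a] by simp
    then have "\<bar>a\<bar> * opnorm V W S \<le> opnorm V W (a \<odot>\<^bsub>?O\<^esub> S)"
      using False by (simp add: field_simps)
    then show ?thesis
      using le[OF S, of a] by simp
  qed
  have "opnorm V W (S \<oplus>\<^bsub>?O\<^esub> T) \<le> opnorm V W S + opnorm V W T"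
  proof (rule opnorm_le[OF V W])
    fix x assume x: "x \<in> carrier V"
    show "vnorm W ((S \<oplus>\<^bsub>?O\<^esub> T) x) \<le> (opnorm V W S + opnorm V W T) * vnorm V x"
      using W.norm_triangle[of "S x" "T x"] opnorm_bound[OF V W S x] opnorm_bound[OF V W T x]
        S T x
      by (simp add: algebra_simps)
  qed (use opnorm_nonneg[OF V W S] opnorm_nonneg[OF V W T] in simp)
  then show "vnorm ?O (S \<oplus>\<^bsub>?O\<^esub> T) \<le> vnorm ?O S + vnorm ?O T"
    by simp
qed (use zero_bounded_ops[OF V W] in simp)

section \<open>The Hahn-Banach theorem for cones\<close>

text \<open>
  Homogeneity is demanded for positive scalars only, because that is what an infimum over a cone
  inherits directly; the value at zero is then a separate condition.
\<close>

definition sublinear_on :: "'a nspace \<Rightarrow> ('a \<Rightarrow> real) \<Rightarrow> bool" where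
  "sublinear_on V p \<longleftrightarrow>
     (\<forall>x\<in>carrier V. \<forall>y\<in>carrier V. p (x \<oplus>\<^bsub>V\<^esub> y) \<le> p x + p y) \<and>
     (\<forall>x\<in>carrier V. \<forall>t>0. p (t \<odot>\<^bsub>V\<^esub> x) = t * p x) \<and> p \<zero>\<^bsub>V\<^esub> = 0"

lemma sublinear_onD:
  assumes "sublinear_on V p"
  shows "x \<in> carrier V \<Longrightarrow> y \<in> carrier V \<Longrightarrow> p (x \<oplus>\<^bsub>V\<^esub> y) \<le> p x + p y"
    and "x \<in> carrier V \<Longrightarrow> 0 < t \<Longrightarrow> p (t \<odot>\<^bsub>V\<^esub> x) = t * p x"
    and "p \<zero>\<^bsub>V\<^esub> = 0"
  using assms by (auto simp: sublinear_on_def)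

text \<open>
  For a cone of pairs \<open>(k, s)\<close> with \<open>s \<le> p k\<close> this is the largest sublinear functional below \<open>p\<close>
  whose value at each \<open>- k\<close> is at most \<open>- s\<close>. Any linear functional below it
  therefore satisfies \<open>s \<le> f k\<close>.
\<close>

definition cone_inf :: "'a nspace \<Rightarrow> ('a \<times> real) set \<Rightarrow> ('a \<Rightarrow> real) \<Rightarrow> 'a \<Rightarrow> real" where
  "cone_inf V K p v = (INF (k, s)\<in>K. p (v \<oplus>\<^bsub>V\<^esub> k) - s)"

definition convex_cone :: "'a nspace \<Rightarrow> ('a \<times> real) set \<Rightarrow> bool" where
  "convex_cone V K \<longleftrightarrow> K \<subseteq> carrier V \<times> UNIV \<and> (\<zero>\<^bsub>V\<^esub>, 0) \<in> K \<and>
     (\<forall>(k, s)\<in>K. \<forall>(l, t)\<in>K. (k \<oplus>\<^bsub>V\<^esub> l, s + t) \<in> K) \<and>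
     (\<forall>(k, s)\<in>K. \<forall>t>0. (t \<odot>\<^bsub>V\<^esub> k, t * s) \<in> K)"

lemma convex_coneD:
  assumes "convex_cone V K"
  shows "(k, s) \<in> K \<Longrightarrow> k \<in> carrier V" and "(\<zero>\<^bsub>V\<^esub>, 0) \<in> K"
    and "(k, s) \<in> K \<Longrightarrow> (l, t) \<in> K \<Longrightarrow> (k \<oplus>\<^bsub>V\<^esub> l, s + t) \<in> K"
    and "(k, s) \<in> K \<Longrightarrow> 0 < a \<Longrightarrow> (a \<odot>\<^bsub>V\<^esub> k, a * s) \<in> K"
  using assms unfolding convex_cone_def by blast+

lemma sublinear_cone_inf:
  assumes V: "normed_space V" and p: "sublinear_on V p" and K: "convex_cone V K"
    and le: "\<And>k s. (k, s) \<in> K \<Longrightarrow> s \<le> p k"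
  shows "sublinear_on V (cone_inf V K p)"
    and "\<And>v. v \<in> carrier V \<Longrightarrow> cone_inf V K p v \<le> p v"
    and "\<And>k s. (k, s) \<in> K \<Longrightarrow> cone_inf V K p ((-1) \<odot>\<^bsub>V\<^esub> k) \<le> - s"
proof -
  interpret V: normed_space V by fact
  note pD = sublinear_onD[OF p] and KD = convex_coneD[OF K]
  let ?q = "cone_inf V K p"
  have bdd: "bdd_below ((\<lambda>(k, s). p (v \<oplus>\<^bsub>V\<^esub> k) - s) ` K)" if v: "v \<in> carrier V" for v
  proof (rule bdd_belowI2[where m = "- p ((-1) \<odot>\<^bsub>V\<^esub> v)"])
    fix c assume "c \<in> K"
    then obtain k s where c: "c = (k, s)" "(k, s) \<in> K" by (cases c) auto
    have k: "k \<in> carrier V"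
      using KD(1) c by blast
    have "(v \<oplus>\<^bsub>V\<^esub> k) \<oplus>\<^bsub>V\<^esub> (-1) \<odot>\<^bsub>V\<^esub> v = k \<oplus>\<^bsub>V\<^esub> (v \<oplus>\<^bsub>V\<^esub> (-1) \<odot>\<^bsub>V\<^esub> v)"
      using v k V by (simp add: V.M.a_ac)
    then have "p k \<le> p (v \<oplus>\<^bsub>V\<^esub> k) + p ((-1) \<odot>\<^bsub>V\<^esub> v)"
      using pD(1)[of "v \<oplus>\<^bsub>V\<^esub> k" "(-1) \<odot>\<^bsub>V\<^esub> v"] v k V by simp
    then show "- p ((-1) \<odot>\<^bsub>V\<^esub> v) \<le> (case c of (k, s) \<Rightarrow> p (v \<oplus>\<^bsub>V\<^esub> k) - s)"
      using le[OF c(2)] c(1) by simp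
  qed
  have lower: "?q v \<le> p (v \<oplus>\<^bsub>V\<^esub> k) - s" if "v \<in> carrier V" "(k, s) \<in> K" for v k s
    unfolding cone_inf_def using cINF_lower[OF bdd[OF that(1)] that(2)] by simp
  have greatest: "c \<le> ?q v" if "\<And>k s. (k, s) \<in> K \<Longrightarrow> c \<le> p (v \<oplus>\<^bsub>V\<^esub> k) - s" for c v
    unfolding cone_inf_def using that KD(2) by (intro cINF_greatest) auto
  show le_p: "?q v \<le> p v" if "v \<in> carrier V" for v
    using lower[OF that KD(2)] that by simp
  show "?q ((-1) \<odot>\<^bsub>V\<^esub> k) \<le> - s" if ks: "(k, s) \<in> K" for k s
  proof -
    have "(-1) \<odot>\<^bsub>V\<^esub> k \<oplus>\<^bsub>V\<^esub> k = \<zero>\<^bsub>V\<^esub>"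
      using KD(1)[OF ks] V by (simp add: V.M.a_comm)
    then show ?thesis
      using lower[OF _ ks, of "(-1) \<odot>\<^bsub>V\<^esub> k"] KD(1)[OF ks] V pD(3) by simp
  qed
  have add: "?q (x \<oplus>\<^bsub>V\<^esub> y) \<le> ?q x + ?q y" if x: "x \<in> carrier V" and y: "y \<in> carrier V" for x y
  proof -
    have "?q (x \<oplus>\<^bsub>V\<^esub> y) - ?q x \<le> ?q y"
    proof (rule greatest)
      fix l t assume l: "(l, t) \<in> K"
      have "?q (x \<oplus>\<^bsub>V\<^esub> y) - (p (y \<oplus>\<^bsub>V\<^esub> l) - t) \<le> ?q x"
      proof (rule greatest)
        fix k s assume k: "(k, s) \<in> K"
        have kl: "k \<in> carrier V" "l \<in> carrier V"
          using k l KD(1) by auto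
        have "?q (x \<oplus>\<^bsub>V\<^esub> y) \<le> p ((x \<oplus>\<^bsub>V\<^esub> y) \<oplus>\<^bsub>V\<^esub> (k \<oplus>\<^bsub>V\<^esub> l)) - (s + t)"
          by (rule lower) (use x y KD(3)[OF k l] in auto)
        also have "(x \<oplus>\<^bsub>V\<^esub> y) \<oplus>\<^bsub>V\<^esub> (k \<oplus>\<^bsub>V\<^esub> l) = (x \<oplus>\<^bsub>V\<^esub> k) \<oplus>\<^bsub>V\<^esub> (y \<oplus>\<^bsub>V\<^esub> l)"
          using x y kl by (simp add: V.M.a_ac)
        finally show "?q (x \<oplus>\<^bsub>V\<^esub> y) - (p (y \<oplus>\<^bsub>V\<^esub> l) - t) \<le> p (x \<oplus>\<^bsub>V\<^esub> k) - s"
          using pD(1)[of "x \<oplus>\<^bsub>V\<^esub> k" "y \<oplus>\<^bsub>V\<^esub> l"] x y kl by simp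
      qed
      then show "?q (x \<oplus>\<^bsub>V\<^esub> y) - ?q x \<le> p (y \<oplus>\<^bsub>V\<^esub> l) - t"
        by simp
    qed
    then show ?thesis by simp
  qed
  have scale_le: "?q (t \<odot>\<^bsub>V\<^esub> x) \<le> t * ?q x" if x: "x \<in> carrier V" and t: "t > 0" for x t
  proof -
    have "?q (t \<odot>\<^bsub>V\<^esub> x) / t \<le> ?q x"
    proof (rule greatest)
      fix k s assume k: "(k, s) \<in> K"
      have "?q (t \<odot>\<^bsub>V\<^esub> x) \<le> p (t \<odot>\<^bsub>V\<^esub> x \<oplus>\<^bsub>V\<^esub> t \<odot>\<^bsub>V\<^esub> k) - t * s"
        by (rule lower) (use x V KD(4)[OF k t] in auto)
      also have "t \<odot>\<^bsub>V\<^esub> x \<oplus>\<^bsub>V\<^esub> t \<odot>\<^bsub>V\<^esub> k = t \<odot>\<^bsub>V\<^esub> (x \<oplus>\<^bsub>V\<^esub> k)"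
        using x KD(1)[OF k] by (simp add: V.smult_vadd)
      also have "p (t \<odot>\<^bsub>V\<^esub> (x \<oplus>\<^bsub>V\<^esub> k)) = t * p (x \<oplus>\<^bsub>V\<^esub> k)"
        by (rule pD(2)) (use x t KD(1)[OF k] in auto)
      finally show "?q (t \<odot>\<^bsub>V\<^esub> x) / t \<le> p (x \<oplus>\<^bsub>V\<^esub> k) - s"
        using t by (simp add: field_simps)
    qed
    then show ?thesis
      using t by (simp add: field_simps)
  qed
  have scale: "?q (t \<odot>\<^bsub>V\<^esub> x) = t * ?q x" if x: "x \<in> carrier V" and t: "t > 0" for x t
  proof (rule antisym)
    have "(1 / t) \<odot>\<^bsub>V\<^esub> (t \<odot>\<^bsub>V\<^esub> x) = x"
      using x t V by simp
    then have "?q x \<le> (1 / t) * ?q (t \<odot>\<^bsub>V\<^esub> x)"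
      using scale_le[of "t \<odot>\<^bsub>V\<^esub> x" "1 / t"] x t V by simp
    then show "t * ?q x \<le> ?q (t \<odot>\<^bsub>V\<^esub> x)"
      using t by (simp add: field_simps)
  qed (rule scale_le[OF x t])
  have "?q \<zero>\<^bsub>V\<^esub> = 0"
  proof (rule antisym)
    show "?q \<zero>\<^bsub>V\<^esub> \<le> 0"
      using le_p[of "\<zero>\<^bsub>V\<^esub>"] pD(3) by simp
    show "0 \<le> ?q \<zero>\<^bsub>V\<^esub>"
      by (rule greatest) (use le KD(1) in fastforce)
  qed
  then show "sublinear_on V ?q"
    using add scale by (simp add: sublinear_on_def)
qed

lemma convex_cone_ray:
  assumes V: "normed_space V" and w: "w \<in> carrier V"
  shows "convex_cone V {(t \<odot>\<^bsub>V\<^esub> w, t * c) | t. t \<ge> 0}"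
proof -
  interpret V: normed_space V by fact
  define K where "K = {(t \<odot>\<^bsub>V\<^esub> w, t * c) | t. t \<ge> 0}"
  have "convex_cone V K"
    unfolding convex_cone_def
  proof (intro conjI)
    show "K \<subseteq> carrier V \<times> UNIV"
      using w V by (auto simp: K_def)
    show "(\<zero>\<^bsub>V\<^esub>, 0) \<in> K"
      using w V by (auto simp: K_def intro!: exI[of _ 0])
    show "\<forall>(k, s)\<in>K. \<forall>(l, t)\<in>K. (k \<oplus>\<^bsub>V\<^esub> l, s + t) \<in> K"
    proof clarify
      fix k s l t assume "(k, s) \<in> K" "(l, t) \<in> K"
      then obtain a b where "a \<ge> 0" "b \<ge> 0" "k = a \<odot>\<^bsub>V\<^esub> w" "s = a * c"
        "l = b \<odot>\<^bsub>V\<^esub> w" "t = b * c"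
        by (auto simp: K_def)
      then show "(k \<oplus>\<^bsub>V\<^esub> l, s + t) \<in> K"
        using w by (auto simp: K_def V.smult_plus algebra_simps intro!: exI[of _ "a + b"])
    qed
    show "\<forall>(k, s)\<in>K. \<forall>t>0. (t \<odot>\<^bsub>V\<^esub> k, t * s) \<in> K"
    proof clarify
      fix k s and t :: real assume "(k, s) \<in> K" "t > 0"
      then obtain a where "a \<ge> 0" "k = a \<odot>\<^bsub>V\<^esub> w" "s = a * c"
        by (auto simp: K_def)
      with \<open>t > 0\<close> show "(t \<odot>\<^bsub>V\<^esub> k, t * s) \<in> K"
        using w V by (auto simp: K_def intro!: exI[of _ "t * a"])
    qed
  qed
  then show ?thesis
    by (simp add: K_def)
qed

definition linear_functional_on :: "'a nspace \<Rightarrow> ('a \<Rightarrow> real) \<Rightarrow> bool" where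
  "linear_functional_on V f \<longleftrightarrow>
     (\<forall>x\<in>carrier V. \<forall>y\<in>carrier V. f (x \<oplus>\<^bsub>V\<^esub> y) = f x + f y) \<and>
     (\<forall>a. \<forall>x\<in>carrier V. f (a \<odot>\<^bsub>V\<^esub> x) = a * f x)"

text \<open>
  If \<open>q\<close> is minimal, it coincides with its \<open>cone_inf\<close> along the ray spanned by \<open>(w, q w)\<close>, and this
  forces \<open>q (- w) \<le> - q w\<close>; an odd sublinear functional is linear.
\<close>

lemma minimal_sublinear_imp_linear:
  assumes V: "normed_space V" and q: "sublinear_on V q"
    and minimal: "\<And>r. sublinear_on V r \<Longrightarrow> (\<And>x. x \<in> carrier V \<Longrightarrow> r x \<le> q x) \<Longrightarrow>
      (\<And>x. x \<in> carrier V \<Longrightarrow> r x = q x)"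
  shows "linear_functional_on V q"
proof -
  interpret V: normed_space V by fact
  note qD = sublinear_onD[OF q]
  have neg: "q ((-1) \<odot>\<^bsub>V\<^esub> w) = - q w" if w: "w \<in> carrier V" for w
  proof -
    define K where "K = {(t \<odot>\<^bsub>V\<^esub> w, t * q w) | t. t \<ge> 0}"
    have "convex_cone V K"
      unfolding K_def by (rule convex_cone_ray[OF V w])
    moreover have "s \<le> q k" if ks: "(k, s) \<in> K" for k s
    proof -
      obtain a where "a \<ge> 0" "k = a \<odot>\<^bsub>V\<^esub> w" "s = a * q w"
        using ks by (auto simp: K_def)
      then show ?thesis
        using qD(2)[OF w, of a] qD(3) w V by (cases "a = 0") auto
    qed
    ultimately have c: "sublinear_on V (cone_inf V K q)"
      "\<And>v. v \<in> carrier V \<Longrightarrow> cone_inf V K q v \<le> q v"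
      "\<And>k s. (k, s) \<in> K \<Longrightarrow> cone_inf V K q ((-1) \<odot>\<^bsub>V\<^esub> k) \<le> - s"
      using sublinear_cone_inf[OF V q] by blast+
    have "(w, q w) \<in> K"
      using w V by (auto simp: K_def intro!: exI[of _ 1])
    then have "q ((-1) \<odot>\<^bsub>V\<^esub> w) \<le> - q w"
      using minimal[OF c(1,2)] c(3) w V by (metis normed_space.smult_mem)
    moreover have "0 \<le> q w + q ((-1) \<odot>\<^bsub>V\<^esub> w)"
      using qD(1)[of w "(-1) \<odot>\<^bsub>V\<^esub> w"] qD(3) w V by simp
    ultimately show ?thesis by simp
  qed
  have add: "q (x \<oplus>\<^bsub>V\<^esub> y) = q x + q y" if x: "x \<in> carrier V" and y: "y \<in> carrier V" for x y
  proof (rule antisym[OF qD(1)[OF x y]])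
    have "(x \<oplus>\<^bsub>V\<^esub> y) \<oplus>\<^bsub>V\<^esub> (-1) \<odot>\<^bsub>V\<^esub> y = x"
      using x y V by (simp add: V.M.a_assoc)
    then have "q x \<le> q (x \<oplus>\<^bsub>V\<^esub> y) + q ((-1) \<odot>\<^bsub>V\<^esub> y)"
      using qD(1)[of "x \<oplus>\<^bsub>V\<^esub> y" "(-1) \<odot>\<^bsub>V\<^esub> y"] x y V by simp
    then show "q x + q y \<le> q (x \<oplus>\<^bsub>V\<^esub> y)"
      using neg[OF y] by simp
  qed
  have "q (a \<odot>\<^bsub>V\<^esub> x) = a * q x" if x: "x \<in> carrier V" for a x
  proof -
    consider "a > 0" | "a = 0" | "a < 0" by linarith
    then show ?thesis
    proof cases
      case 3
      then have "q ((-1) \<odot>\<^bsub>V\<^esub> ((-a) \<odot>\<^bsub>V\<^esub> x)) = a * q x"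
        using neg[of "(-a) \<odot>\<^bsub>V\<^esub> x"] qD(2)[OF x, of "-a"] x V by simp
      then show ?thesis
        using x V by simp
    qed (use qD(2,3) x V in auto)
  qed
  then show ?thesis
    using add by (simp add: linear_functional_on_def)
qed

text \<open>
  Zorn's lemma gives a minimal sublinear functional below \<open>p\<close>: along a chain the pointwise infimum
  is again sublinear, and it is finite because \<open>- p (- x) \<le> q x\<close> for every sublinear \<open>q \<le> p\<close>.
\<close>

lemma exists_linear_below_sublinear:
  assumes V: "normed_space V" and p: "sublinear_on V p"
  obtains f where "linear_functional_on V f" "\<And>x. x \<in> carrier V \<Longrightarrow> f x \<le> p x"
proof -
  interpret V: normed_space V by fact
  define A where "A = {q \<in> extensional (carrier V). sublinear_on V q \<and> (\<forall>x\<in>carrier V. q x \<le> p x)}"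
  define below where "below = (\<lambda>q r. \<forall>x\<in>carrier V. r x \<le> (q x :: real))"
  have sub_ext: "sublinear_on V (\<lambda>x\<in>carrier V. q x)" if "sublinear_on V q" for q
    using that V unfolding sublinear_on_def by simp
  have po: "partial_order_on A (relation_of below A)"
    unfolding partial_order_on_def preorder_on_def
  proof (intro conjI)
    show "relation_of below A \<subseteq> A \<times> A" "refl_on A (relation_of below A)"
      by (auto simp: relation_of_def refl_on_def below_def)
    show "trans (relation_of below A)"
      by (auto simp: relation_of_def trans_def below_def intro: order_trans)
    show "antisym (relation_of below A)"
    proof (rule antisymI)
      fix q r assume "(q, r) \<in> relation_of below A" "(r, q) \<in> relation_of below A"
      then show "q = r"
        by (intro extensionalityI[of _ "carrier V"])
          (auto simp: relation_of_def below_def A_def intro: antisym)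
    qed
  qed
  have "\<exists>u\<in>A. \<forall>q\<in>C. below q u" if C: "C \<in> Chains (relation_of below A)" for C
  proof (cases "C = {}")
    case True
    have "(\<lambda>x\<in>carrier V. p x) \<in> A"
      using sub_ext[OF p] by (simp add: A_def)
    then show ?thesis
      using True by blast
  next
    case False
    have CA: "C \<subseteq> A"
      using C by (auto simp: Chains_def relation_of_def)
    have sub: "sublinear_on V q" and qp: "\<And>x. x \<in> carrier V \<Longrightarrow> q x \<le> p x" if "q \<in> C" for q
      using that CA by (auto simp: A_def)
    have total: "below q r \<or> below r q" if "q \<in> C" "r \<in> C" for q r
      using C that by (auto simp: Chains_def relation_of_def)
    define u where "u = (\<lambda>x\<in>carrier V. INF q\<in>C. q x)"
    have bdd: "bdd_below ((\<lambda>q. q x) ` C)" if x: "x \<in> carrier V" for x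
    proof (rule bdd_belowI2[where m = "- p ((-1) \<odot>\<^bsub>V\<^esub> x)"])
      fix q assume q: "q \<in> C"
      have "0 \<le> q x + q ((-1) \<odot>\<^bsub>V\<^esub> x)"
        using sublinear_onD(1)[OF sub[OF q], of x "(-1) \<odot>\<^bsub>V\<^esub> x"] sublinear_onD(3)[OF sub[OF q]] x V
        by simp
      then show "- p ((-1) \<odot>\<^bsub>V\<^esub> x) \<le> q x"
        using qp[OF q, of "(-1) \<odot>\<^bsub>V\<^esub> x"] x V by simp
    qed
    have lower: "u x \<le> q x" if "x \<in> carrier V" "q \<in> C" for x q
      using cINF_lower[OF bdd[OF that(1)] that(2)] that(1) by (simp add: u_def)
    have greatest: "c \<le> u x" if "x \<in> carrier V" "\<And>q. q \<in> C \<Longrightarrow> c \<le> q x" for x c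
      using that False by (auto simp: u_def intro: cINF_greatest)
    have "sublinear_on V u"
      unfolding sublinear_on_def
    proof (intro conjI ballI allI impI)
      fix x y assume x: "x \<in> carrier V" and y: "y \<in> carrier V"
      have "u (x \<oplus>\<^bsub>V\<^esub> y) - u x \<le> u y"
      proof (rule greatest[OF y])
        fix r assume r: "r \<in> C"
        have "u (x \<oplus>\<^bsub>V\<^esub> y) - r y \<le> u x"
        proof (rule greatest[OF x])
          fix q assume q: "q \<in> C"
          \<comment> \<open>Subadditivity of the infimum needs one member of the chain that is below both \<open>q\<close> and \<open>r\<close>.\<close>
          have "\<exists>m\<in>C. m x \<le> q x \<and> m y \<le> r y"
            using total[OF q r] q r x y by (auto simp: below_def)
          then obtain m where m: "m \<in> C" "m x \<le> q x" "m y \<le> r y" by blast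
          then show "u (x \<oplus>\<^bsub>V\<^esub> y) - r y \<le> q x"
            using lower[OF _ m(1), of "x \<oplus>\<^bsub>V\<^esub> y"] sublinear_onD(1)[OF sub[OF m(1)] x y] x y by simp
        qed
        then show "u (x \<oplus>\<^bsub>V\<^esub> y) - u x \<le> r y" by simp
      qed
      then show "u (x \<oplus>\<^bsub>V\<^esub> y) \<le> u x + u y" by simp
    next
      fix x t assume x: "x \<in> carrier V" and t: "(0::real) < t"
      have tx: "t \<odot>\<^bsub>V\<^esub> x \<in> carrier V"
        using x V by simp
      have qt: "q (t \<odot>\<^bsub>V\<^esub> x) = t * q x" if "q \<in> C" for q
        using sublinear_onD(2)[OF sub[OF that] x t] .
      show "u (t \<odot>\<^bsub>V\<^esub> x) = t * u x"
      proof (rule antisym)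
        have "u (t \<odot>\<^bsub>V\<^esub> x) / t \<le> u x"
          by (rule greatest[OF x]) (use lower[OF tx] qt t in \<open>simp add: field_simps\<close>)
        then show "u (t \<odot>\<^bsub>V\<^esub> x) \<le> t * u x"
          using t by (simp add: field_simps)
        show "t * u x \<le> u (t \<odot>\<^bsub>V\<^esub> x)"
        proof (rule greatest[OF tx])
          fix q assume q: "q \<in> C"
          show "t * u x \<le> q (t \<odot>\<^bsub>V\<^esub> x)"
            unfolding qt[OF q] using lower[OF x q] t by simp
        qed
      qed
    next
      have "u \<zero>\<^bsub>V\<^esub> = (INF q\<in>C. 0)"
        using sublinear_onD(3)[OF sub] by (auto simp: u_def intro!: INF_cong)
      then show "u \<zero>\<^bsub>V\<^esub> = 0"
        using False by simp
    qed
    moreover have "u x \<le> p x" if "x \<in> carrier V" for x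
      using False lower[OF that] qp[OF _ that] by (metis all_not_in_conv order_trans)
    ultimately have "u \<in> A"
      by (simp add: A_def u_def)
    then show ?thesis
      using lower by (auto simp: below_def)
  qed
  then obtain m where m: "m \<in> A" and max: "\<forall>a\<in>A. below m a \<longrightarrow> a = m"
    using predicate_Zorn[OF po] by blast
  have "linear_functional_on V m"
  proof (rule minimal_sublinear_imp_linear[OF V])
    fix r x assume r: "sublinear_on V r" "\<And>x. x \<in> carrier V \<Longrightarrow> r x \<le> m x" and x: "x \<in> carrier V"
    have "(\<lambda>x\<in>carrier V. r x) \<in> A"
      using sub_ext[OF r(1)] r(2) m by (force simp: A_def)
    then have "(\<lambda>x\<in>carrier V. r x) = m"
      using max r(2) by (auto simp: below_def)
    then show "r x = m x"
      using x by (metis restrict_apply')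
  qed (use m in \<open>simp add: A_def\<close>)
  then show thesis
    using that m by (auto simp: A_def)
qed

text \<open>
  Both uses of the Hahn-Banach theorem below are of this form: the ray through \<open>(x, vnorm V x)\<close> gives
  a functional that attains the norm of \<open>x\<close>, and the cone over a convex set at distance at least
  \<open>e\<close> from the origin gives a functional that is at least \<open>e\<close> on that set.
\<close>

theorem hahn_banach_cone:
  assumes V: "normed_space V" and p: "sublinear_on V p" and K: "convex_cone V K"
    and le: "\<And>k s. (k, s) \<in> K \<Longrightarrow> s \<le> p k"
  obtains f where "linear_functional_on V f" "\<And>x. x \<in> carrier V \<Longrightarrow> f x \<le> p x"
    "\<And>k s. (k, s) \<in> K \<Longrightarrow> s \<le> f k"
proof -
  have c: "sublinear_on V (cone_inf V K p)"
    "\<And>v. v \<in> carrier V \<Longrightarrow> cone_inf V K p v \<le> p v"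
    "\<And>k s. (k, s) \<in> K \<Longrightarrow> cone_inf V K p ((-1) \<odot>\<^bsub>V\<^esub> k) \<le> - s"
    using sublinear_cone_inf[OF V p K] le by blast+
  obtain f where f: "linear_functional_on V f" "\<And>x. x \<in> carrier V \<Longrightarrow> f x \<le> cone_inf V K p x"
    using exists_linear_below_sublinear[OF V c(1)] by blast
  have "s \<le> f k" if ks: "(k, s) \<in> K" for k s
  proof -
    have k: "k \<in> carrier V"
      using convex_coneD(1)[OF K ks] .
    have "f ((-1) \<odot>\<^bsub>V\<^esub> k) \<le> - s"
      using f(2)[of "(-1) \<odot>\<^bsub>V\<^esub> k"] c(3)[OF ks] k V by simp
    then show ?thesis
      using f(1) k by (simp add: linear_functional_on_def)
  qed
  then show thesis
    using that[OF f(1)] f(2) c(2) order_trans by blast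
qed

lemma sublinear_norm: "normed_space V \<Longrightarrow> sublinear_on V (vnorm V)"
  by (simp add: sublinear_on_def normed_space.norm_triangle normed_space.norm_smult)

lemma linear_functional_below_norm:
  assumes V: "normed_space V" and f: "linear_functional_on V f"
    and le: "\<And>x. x \<in> carrier V \<Longrightarrow> f x \<le> vnorm V x"
  shows "x \<in> carrier V \<Longrightarrow> \<bar>f x\<bar> \<le> vnorm V x"
    and "(\<lambda>x\<in>carrier V. f x) \<in> bounded_ops V real_space"
proof -
  show abs: "\<bar>f x\<bar> \<le> vnorm V x" if x: "x \<in> carrier V" for x
    using le[OF x] le[of "(-1) \<odot>\<^bsub>V\<^esub> x"] f x V
    by (simp add: linear_functional_on_def normed_space.norm_smult)
  show "(\<lambda>x\<in>carrier V. f x) \<in> bounded_ops V real_space"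
    by (rule bounded_ops_restrictI[OF V, where C = 1]) (use f abs in \<open>auto simp: linear_functional_on_def\<close>)
qed

lemma norming_functional:
  assumes V: "normed_space V" and x: "x \<in> carrier V"
  obtains f where "f \<in> bounded_ops V real_space" "opnorm V real_space f \<le> 1" "f x = vnorm V x"
proof -
  let ?K = "{(t \<odot>\<^bsub>V\<^esub> x, t * vnorm V x) | t. t \<ge> 0}"
  have "s \<le> vnorm V k" if "(k, s) \<in> ?K" for k s
    using that x V by (auto simp: normed_space.norm_smult)
  then obtain f where f: "linear_functional_on V f" "\<And>y. y \<in> carrier V \<Longrightarrow> f y \<le> vnorm V y"
    and fx: "\<And>k s. (k, s) \<in> ?K \<Longrightarrow> s \<le> f k"
    using hahn_banach_cone[OF V sublinear_norm[OF V] convex_cone_ray[OF V x]] by blast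
  have "(x, vnorm V x) \<in> ?K"
    using x V by (auto intro!: exI[of _ 1])
  then have "vnorm V x \<le> f x"
    using fx by blast
  then have "f x = vnorm V x"
    using f(2)[OF x] by simp
  moreover have "opnorm V real_space (\<lambda>y\<in>carrier V. f y) \<le> 1"
    by (rule opnorm_le[OF V]) (use linear_functional_below_norm(1)[OF V f] in auto)
  ultimately show thesis
    using that linear_functional_below_norm(2)[OF V f] x by simp
qed

lemma norm_le_if_functionals_le:
  assumes V: "normed_space V" and x: "x \<in> carrier V"
    and le: "\<And>f. f \<in> bounded_ops V real_space \<Longrightarrow> \<bar>f x\<bar> \<le> c * opnorm V real_space f" and c: "0 \<le> c"
  shows "vnorm V x \<le> c"
proof -
  obtain f where f: "f \<in> bounded_ops V real_space" "opnorm V real_space f \<le> 1" "f x = vnorm V x"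
    using norming_functional[OF V x] .
  have "vnorm V x \<le> c * opnorm V real_space f"
    using le[OF f(1)] f(3) by simp
  also have "\<dots> \<le> c"
    using mult_left_mono[OF f(2) c] by simp
  finally show ?thesis .
qed

section \<open>Weak approximation by convex sets\<close>

text \<open>
  Finitely many points of \<open>W\<close> at once are one point of the \<open>I\<close>-fold \<open>\<ell>\<^sup>1\<close>-sum of \<open>W\<close>.
\<close>

definition power_space :: "'i set \<Rightarrow> 'a nspace \<Rightarrow> ('i \<Rightarrow> 'a) nspace" where
  "power_space I W = \<lparr>carrier = I \<rightarrow>\<^sub>E carrier W, mult = undefined, one = undefined,
     zero = (\<lambda>i\<in>I. \<zero>\<^bsub>W\<^esub>), add = (\<lambda>v w. \<lambda>i\<in>I. v i \<oplus>\<^bsub>W\<^esub> w i),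
     smult = (\<lambda>a v. \<lambda>i\<in>I. a \<odot>\<^bsub>W\<^esub> v i), vnorm = (\<lambda>v. \<Sum>i\<in>I. vnorm W (v i))\<rparr>"

lemma power_space_simps [simp]:
  "carrier (power_space I W) = I \<rightarrow>\<^sub>E carrier W"
  "zero (power_space I W) = (\<lambda>i\<in>I. \<zero>\<^bsub>W\<^esub>)"
  "add (power_space I W) v w = (\<lambda>i\<in>I. v i \<oplus>\<^bsub>W\<^esub> w i)"
  "smult (power_space I W) a v = (\<lambda>i\<in>I. a \<odot>\<^bsub>W\<^esub> v i)"
  "vnorm (power_space I W) v = (\<Sum>i\<in>I. vnorm W (v i))"
  by (simp_all add: power_space_def)

lemma normed_space_power_space:
  assumes W: "normed_space W" and I: "finite I"
  shows "normed_space (power_space I W)"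
proof (intro normed_space.intro module_realI normed_space_axioms.intro)
  interpret W: normed_space W by fact
  note ext = extensionalityI[of _ I]
  let ?P = "power_space I W"
  fix u v w assume u: "u \<in> carrier ?P" and v: "v \<in> carrier ?P" and w: "w \<in> carrier ?P"
  have m [simp]: "u i \<in> carrier W" "v i \<in> carrier W" "w i \<in> carrier W" if "i \<in> I" for i
    using u v w that by (auto simp: PiE_iff)
  have e [simp]: "u \<in> extensional I"
    using u by (simp add: PiE_iff)
  show "u \<oplus>\<^bsub>?P\<^esub> v \<in> carrier ?P" "a \<odot>\<^bsub>?P\<^esub> u \<in> carrier ?P" for a
    using W by auto
  show "(u \<oplus>\<^bsub>?P\<^esub> v) \<oplus>\<^bsub>?P\<^esub> w = u \<oplus>\<^bsub>?P\<^esub> (v \<oplus>\<^bsub>?P\<^esub> w)" "u \<oplus>\<^bsub>?P\<^esub> v = v \<oplus>\<^bsub>?P\<^esub> u"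
    by (auto intro!: ext simp: W.M.a_ac)
  show "\<zero>\<^bsub>?P\<^esub> \<oplus>\<^bsub>?P\<^esub> u = u" "1 \<odot>\<^bsub>?P\<^esub> u = u"
    using W by (auto intro!: ext)
  show "(- 1) \<odot>\<^bsub>?P\<^esub> u \<oplus>\<^bsub>?P\<^esub> u = \<zero>\<^bsub>?P\<^esub>"
    using W.minus_cancel by (auto intro!: ext simp: W.M.a_comm)
  show "(a + b) \<odot>\<^bsub>?P\<^esub> u = a \<odot>\<^bsub>?P\<^esub> u \<oplus>\<^bsub>?P\<^esub> b \<odot>\<^bsub>?P\<^esub> u" for a b
    by (auto intro!: ext simp: W.smult_plus)
  show "a \<odot>\<^bsub>?P\<^esub> (u \<oplus>\<^bsub>?P\<^esub> v) = a \<odot>\<^bsub>?P\<^esub> u \<oplus>\<^bsub>?P\<^esub> a \<odot>\<^bsub>?P\<^esub> v" for a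
    by (auto intro!: ext simp: W.smult_vadd)
  show "(a * b) \<odot>\<^bsub>?P\<^esub> u = a \<odot>\<^bsub>?P\<^esub> (b \<odot>\<^bsub>?P\<^esub> u)" for a b
    using W by (auto intro!: ext)
  have "vnorm ?P u = 0 \<longleftrightarrow> (\<forall>i\<in>I. u i = \<zero>\<^bsub>W\<^esub>)"
    using W I W.norm_eq_zero by (simp add: sum_nonneg_eq_0_iff)
  also have "\<dots> \<longleftrightarrow> u = \<zero>\<^bsub>?P\<^esub>"
    by (auto intro!: ext)
  finally show "vnorm ?P u = 0 \<longleftrightarrow> u = \<zero>\<^bsub>?P\<^esub>" .
  show "vnorm ?P (a \<odot>\<^bsub>?P\<^esub> u) = \<bar>a\<bar> * vnorm ?P u" for a
    by (simp add: W.norm_smult sum_distrib_left)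
  show "vnorm ?P (u \<oplus>\<^bsub>?P\<^esub> v) \<le> vnorm ?P u + vnorm ?P v"
    by (simp add: sum.distrib[symmetric]) (intro sum_mono, simp add: W.norm_triangle)
qed (use normed_space.zero_mem[OF W] in auto)

text \<open>
  The dual of a finite \<open>\<ell>\<^sup>1\<close>-sum of copies of \<open>W\<close> consists of the families of functionals on \<open>W\<close>.
\<close>

lemma linear_functional_power_space:
  assumes W: "normed_space W" and I: "finite I" and f: "linear_functional_on (power_space I W) f"
    and le: "\<And>v. v \<in> carrier (power_space I W) \<Longrightarrow> f v \<le> vnorm (power_space I W) v"
  obtains \<phi> where "\<And>i. i \<in> I \<Longrightarrow> \<phi> i \<in> bounded_ops W real_space"
    "\<And>v. v \<in> carrier (power_space I W) \<Longrightarrow> f v = (\<Sum>i\<in>I. \<phi> i (v i))"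
proof
  interpret W: normed_space W by fact
  let ?P = "power_space I W"
  have P: "normed_space ?P"
    by (rule normed_space_power_space[OF W I])
  \<comment> \<open>The \<open>i\<close>-th coordinate of the functional is its restriction to the \<open>i\<close>-th copy of \<open>W\<close>.\<close>
  define single where "single i x = (\<lambda>j\<in>I. if j = i then x else \<zero>\<^bsub>W\<^esub>)" for i :: 'b and x
  define \<phi> where "\<phi> i = (\<lambda>x\<in>carrier W. f (single i x))" for i
  have single: "single i x \<in> carrier ?P" if "x \<in> carrier W" for i x
    using that by (auto simp: single_def)
  show "\<phi> i \<in> bounded_ops W real_space" if i: "i \<in> I" for i
    unfolding \<phi>_def
  proof (rule bounded_ops_restrictI[OF W, where C = 1])
    fix x assume x: "x \<in> carrier W"
    have "\<bar>f (single i x)\<bar> \<le> (\<Sum>j\<in>I. vnorm W (single i x j))"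
      using linear_functional_below_norm(1)[OF P f le single[OF x]] by simp
    also have "\<dots> = (\<Sum>j\<in>I. if j = i then vnorm W x else 0)"
      by (intro sum.cong) (use W in \<open>auto simp: single_def\<close>)
    finally show "vnorm real_space (f (single i x)) \<le> 1 * vnorm W x"
      using I i by simp
    have "single i (a \<odot>\<^bsub>W\<^esub> x) = a \<odot>\<^bsub>?P\<^esub> single i x" for a
      using W by (auto simp: single_def fun_eq_iff)
    then show "f (single i (a \<odot>\<^bsub>W\<^esub> x)) = a \<odot>\<^bsub>real_space\<^esub> f (single i x)" for a
      using f single[OF x] by (simp add: linear_functional_on_def)
    fix y assume y: "y \<in> carrier W"
    have "single i (x \<oplus>\<^bsub>W\<^esub> y) = single i x \<oplus>\<^bsub>?P\<^esub> single i y"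
      by (auto simp: single_def fun_eq_iff)
    then show "f (single i (x \<oplus>\<^bsub>W\<^esub> y)) = f (single i x) \<oplus>\<^bsub>real_space\<^esub> f (single i y)"
      using f single[OF x] single[OF y] by (simp add: linear_functional_on_def)
  qed auto
  show "f v = (\<Sum>i\<in>I. \<phi> i (v i))" if v: "v \<in> carrier ?P" for v
  proof -
    have vi: "v i \<in> carrier W" if "i \<in> I" for i
      using v that by (auto simp: PiE_iff)
    define cut where "cut J = (\<lambda>j\<in>I. if j \<in> J then v j else \<zero>\<^bsub>W\<^esub>)" for J
    have cut: "cut J \<in> carrier ?P" for J
      using vi by (auto simp: cut_def)
    have "finite J \<Longrightarrow> J \<subseteq> I \<Longrightarrow> f (cut J) = (\<Sum>i\<in>J. \<phi> i (v i))" for J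
    proof (induction J rule: finite_induct)
      case empty
      have "cut {} = 0 \<odot>\<^bsub>?P\<^esub> v"
        using vi W by (auto simp: cut_def fun_eq_iff)
      moreover have "f (0 \<odot>\<^bsub>?P\<^esub> v) = 0 * f v"
        using f v unfolding linear_functional_on_def by blast
      ultimately show ?case
        by (simp only: sum.empty mult_zero_left)
    next
      case (insert i J)
      have "cut (insert i J) = single i (v i) \<oplus>\<^bsub>?P\<^esub> cut J"
        using insert vi W by (auto simp: cut_def single_def fun_eq_iff)
      then have "f (cut (insert i J)) = f (single i (v i)) + f (cut J)"
        using f single[OF vi, of i i] cut[of J] insert.prems unfolding linear_functional_on_def by auto
      then show ?case
        using insert vi by (simp add: \<phi>_def)
    qed
    moreover have "cut I = v"
      by (rule extensionalityI[of _ I]) (use v in \<open>auto simp: cut_def PiE_iff\<close>)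
    ultimately show ?thesis
      using I by force
  qed
qed

text \<open>
  Mazur's theorem for finitely many points. If no \<open>b\<close> came close to \<open>w\<close> in norm, all differences
  \<open>b - w\<close> would have \<open>\<ell>\<^sup>1\<close>-norm at least \<open>e\<close>. These differences form a convex set, so a linear
  functional below the norm would be at least \<open>e\<close> on all of them, against weak approximation. The
  members of \<open>B\<close> are constrained only on \<open>I\<close>, which lets \<open>B\<close> be a set of operators and \<open>I\<close> a set
  of points at which they are evaluated.
\<close>

theorem weak_approximation_imp_norm_approximation:
  fixes B :: "('i \<Rightarrow> 'a) set"
  assumes W: "normed_space W" and I: "finite I"
    and B: "\<And>b i. b \<in> B \<Longrightarrow> i \<in> I \<Longrightarrow> b i \<in> carrier W"
    and convex: "\<And>b c t. \<lbrakk>b \<in> B; c \<in> B; 0 \<le> t; t \<le> 1\<rbrakk> \<Longrightarrow>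
      \<exists>d\<in>B. \<forall>i\<in>I. d i = t \<odot>\<^bsub>W\<^esub> b i \<oplus>\<^bsub>W\<^esub> (1 - t) \<odot>\<^bsub>W\<^esub> c i"
    and w: "\<And>i. i \<in> I \<Longrightarrow> w i \<in> carrier W"
    and weak: "\<And>\<phi> e. \<lbrakk>\<And>i. i \<in> I \<Longrightarrow> \<phi> i \<in> bounded_ops W real_space; 0 < e\<rbrakk> \<Longrightarrow>
      \<exists>b\<in>B. \<bar>(\<Sum>i\<in>I. \<phi> i (b i)) - (\<Sum>i\<in>I. \<phi> i (w i))\<bar> < e"
    and e: "0 < e"
  shows "\<exists>b\<in>B. \<forall>i\<in>I. vnorm W (b i \<oplus>\<^bsub>W\<^esub> (-1) \<odot>\<^bsub>W\<^esub> w i) < e"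
proof (rule ccontr)
  assume contra: "\<not> ?thesis"
  interpret W: normed_space W by fact
  let ?P = "power_space I W"
  have P: "normed_space ?P"
    by (rule normed_space_power_space[OF W I])
  define diff where "diff b = (\<lambda>i\<in>I. b i \<oplus>\<^bsub>W\<^esub> (-1) \<odot>\<^bsub>W\<^esub> w i)" for b
  have diff: "diff b \<in> carrier ?P" if "b \<in> B" for b
    using B[OF that] w W by (auto simp: diff_def)
  have far: "e \<le> vnorm ?P (diff b)" if b: "b \<in> B" for b
  proof -
    obtain i where i: "i \<in> I" "e \<le> vnorm W (b i \<oplus>\<^bsub>W\<^esub> (-1) \<odot>\<^bsub>W\<^esub> w i)"
      using contra b by force
    have "vnorm W (diff b i) \<le> (\<Sum>i\<in>I. vnorm W (diff b i))"
      by (rule member_le_sum) (use i I B[OF b] w W in \<open>auto simp: diff_def\<close>)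
    then show ?thesis
      using i by (simp add: diff_def)
  qed
  \<comment> \<open>The cone over the set of differences, each of them marked with the value \<open>e\<close>.\<close>
  define K where "K = {(t \<odot>\<^bsub>?P\<^esub> diff b, t * e) | t b. t \<ge> 0 \<and> b \<in> B}"
  have K_cases: thesis if "(k, s) \<in> K"
    "\<And>t b. \<lbrakk>0 \<le> t; b \<in> B; k = t \<odot>\<^bsub>?P\<^esub> diff b; s = t * e\<rbrakk> \<Longrightarrow> thesis" for k s thesis
    using that unfolding K_def by blast
  have K_I: "(t \<odot>\<^bsub>?P\<^esub> diff b, t * e) \<in> K" if "0 \<le> t" "b \<in> B" for t b
    using that unfolding K_def by blast
  obtain b0 where b0: "b0 \<in> B"
    using weak[of "\<lambda>_. \<lambda>x\<in>carrier W. 0" 1] zero_bounded_ops[OF W normed_space_real_space] by auto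
  have cone: "convex_cone ?P K"
    unfolding convex_cone_def
  proof (intro conjI)
    show "K \<subseteq> carrier ?P \<times> UNIV"
      using diff normed_space.smult_mem[OF P] unfolding K_def by blast
    show "(\<zero>\<^bsub>?P\<^esub>, 0) \<in> K"
      using K_I[of 0 b0] b0 normed_space.smult_0[OF P diff[OF b0]] by simp
    show "\<forall>(k, s)\<in>K. \<forall>(l, t)\<in>K. (k \<oplus>\<^bsub>?P\<^esub> l, s + t) \<in> K"
    proof clarify
      fix k s l t assume ks: "(k, s) \<in> K" and lt: "(l, t) \<in> K"
      from ks obtain a b where a: "a \<ge> 0" "b \<in> B" "k = a \<odot>\<^bsub>?P\<^esub> diff b" "s = a * e"
        by (rule K_cases)
      from lt obtain a' c where a': "a' \<ge> 0" "c \<in> B" "l = a' \<odot>\<^bsub>?P\<^esub> diff c" "t = a' * e"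
        by (rule K_cases)
      have "\<exists>d\<in>B. \<forall>i\<in>I. (a + a') \<odot>\<^bsub>W\<^esub> (d i \<oplus>\<^bsub>W\<^esub> (-1) \<odot>\<^bsub>W\<^esub> w i) =
        a \<odot>\<^bsub>W\<^esub> (b i \<oplus>\<^bsub>W\<^esub> (-1) \<odot>\<^bsub>W\<^esub> w i) \<oplus>\<^bsub>W\<^esub> a' \<odot>\<^bsub>W\<^esub> (c i \<oplus>\<^bsub>W\<^esub> (-1) \<odot>\<^bsub>W\<^esub> w i)"
      proof (cases "a + a' = 0")
        case True
        then have "a = 0" "a' = 0"
          using a(1) a'(1) by auto
        then show ?thesis
          using a(2) a'(2) B w W by (intro bexI[of _ b]) auto
      next
        case False
        then have pos: "a + a' > 0"
          using a(1) a'(1) by simp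
        obtain d where d: "d \<in> B" "\<And>i. i \<in> I \<Longrightarrow>
            d i = (a / (a + a')) \<odot>\<^bsub>W\<^esub> b i \<oplus>\<^bsub>W\<^esub> (1 - a / (a + a')) \<odot>\<^bsub>W\<^esub> c i"
          using convex[OF a(2) a'(2), of "a / (a + a')"] pos a(1) a'(1) by auto
        have "1 - a / (a + a') = a' / (a + a')"
          using pos by (simp add: field_simps)
        then have d': "(a + a') \<odot>\<^bsub>W\<^esub> d i = a \<odot>\<^bsub>W\<^esub> b i \<oplus>\<^bsub>W\<^esub> a' \<odot>\<^bsub>W\<^esub> c i" if "i \<in> I" for i
          using that d(2) B[OF a(2)] B[OF a'(2)] pos W by (simp add: W.smult_vadd)
        have "(a + a') \<odot>\<^bsub>W\<^esub> (d i \<oplus>\<^bsub>W\<^esub> (-1) \<odot>\<^bsub>W\<^esub> w i) =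
          a \<odot>\<^bsub>W\<^esub> (b i \<oplus>\<^bsub>W\<^esub> (-1) \<odot>\<^bsub>W\<^esub> w i) \<oplus>\<^bsub>W\<^esub> a' \<odot>\<^bsub>W\<^esub> (c i \<oplus>\<^bsub>W\<^esub> (-1) \<odot>\<^bsub>W\<^esub> w i)"
          if i: "i \<in> I" for i
        proof -
          have m: "b i \<in> carrier W" "c i \<in> carrier W" "d i \<in> carrier W" "w i \<in> carrier W"
            using i B a(2) a'(2) d(1) w by auto
          have "(a + a') \<odot>\<^bsub>W\<^esub> (d i \<oplus>\<^bsub>W\<^esub> (-1) \<odot>\<^bsub>W\<^esub> w i) =
            (a \<odot>\<^bsub>W\<^esub> b i \<oplus>\<^bsub>W\<^esub> a' \<odot>\<^bsub>W\<^esub> c i) \<oplus>\<^bsub>W\<^esub> ((- a) \<odot>\<^bsub>W\<^esub> w i \<oplus>\<^bsub>W\<^esub> (- a') \<odot>\<^bsub>W\<^esub> w i)"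
            using m W W.smult_plus[OF m(4), of "- a" "- a'"] d'[OF i] by (simp add: W.smult_vadd)
          also have "\<dots> = (a \<odot>\<^bsub>W\<^esub> b i \<oplus>\<^bsub>W\<^esub> (- a) \<odot>\<^bsub>W\<^esub> w i) \<oplus>\<^bsub>W\<^esub> (a' \<odot>\<^bsub>W\<^esub> c i \<oplus>\<^bsub>W\<^esub> (- a') \<odot>\<^bsub>W\<^esub> w i)"
            using m W by (simp add: W.M.a_ac)
          finally show ?thesis
            using m W by (simp add: W.smult_vadd)
        qed
        then show ?thesis
          using d(1) by blast
      qed
      then obtain d where d: "d \<in> B" "\<And>i. i \<in> I \<Longrightarrow> (a + a') \<odot>\<^bsub>W\<^esub> (d i \<oplus>\<^bsub>W\<^esub> (-1) \<odot>\<^bsub>W\<^esub> w i) =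
        a \<odot>\<^bsub>W\<^esub> (b i \<oplus>\<^bsub>W\<^esub> (-1) \<odot>\<^bsub>W\<^esub> w i) \<oplus>\<^bsub>W\<^esub> a' \<odot>\<^bsub>W\<^esub> (c i \<oplus>\<^bsub>W\<^esub> (-1) \<odot>\<^bsub>W\<^esub> w i)"
        by blast
      then have "k \<oplus>\<^bsub>?P\<^esub> l = (a + a') \<odot>\<^bsub>?P\<^esub> diff d"
        using a(3) a'(3) by (auto simp: diff_def intro!: restrict_ext)
      then show "(k \<oplus>\<^bsub>?P\<^esub> l, s + t) \<in> K"
        using K_I[of "a + a'" d] a a' d(1) by (simp add: distrib_right)
    qed
    show "\<forall>(k, s)\<in>K. \<forall>t>0. (t \<odot>\<^bsub>?P\<^esub> k, t * s) \<in> K"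
    proof clarify
      fix k s and t :: real assume ks: "(k, s) \<in> K" and t: "t > 0"
      from ks obtain a b where a: "a \<ge> 0" "b \<in> B" "k = a \<odot>\<^bsub>?P\<^esub> diff b" "s = a * e"
        by (rule K_cases)
      then show "(t \<odot>\<^bsub>?P\<^esub> k, t * s) \<in> K"
        using K_I[of "t * a" b] t normed_space.smult_times[OF P diff[OF a(2)], of t a]
        by (simp del: power_space_simps add: mult.assoc)
    qed
  qed
  have "s \<le> vnorm ?P k" if ks: "(k, s) \<in> K" for k s
  proof -
    from ks obtain a b where a: "a \<ge> 0" "b \<in> B" "k = a \<odot>\<^bsub>?P\<^esub> diff b" "s = a * e"
      by (rule K_cases)
    then show ?thesis
      using normed_space.norm_smult[OF P diff[OF a(2)], of a] mult_left_mono[OF far[OF a(2)] a(1)]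
      by (simp del: power_space_simps)
  qed
  then obtain f where f: "linear_functional_on ?P f" "\<And>v. v \<in> carrier ?P \<Longrightarrow> f v \<le> vnorm ?P v"
    and fK: "\<And>k s. (k, s) \<in> K \<Longrightarrow> s \<le> f k"
    using hahn_banach_cone[OF P sublinear_norm[OF P] cone] by blast
  obtain \<phi> where \<phi>: "\<And>i. i \<in> I \<Longrightarrow> \<phi> i \<in> bounded_ops W real_space"
    and f_eq: "\<And>v. v \<in> carrier ?P \<Longrightarrow> f v = (\<Sum>i\<in>I. \<phi> i (v i))"
    using linear_functional_power_space[OF W I f] by blast
  obtain b where b: "b \<in> B" "\<bar>(\<Sum>i\<in>I. \<phi> i (b i)) - (\<Sum>i\<in>I. \<phi> i (w i))\<bar> < e"
    using weak[where \<phi> = \<phi>, OF _ e] \<phi> by blast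
  have "(diff b, e) \<in> K"
    using K_I[of 1 b] b(1) normed_space.smult_1[OF P diff[OF b(1)]] by (simp del: power_space_simps)
  then have "e \<le> (\<Sum>i\<in>I. \<phi> i (diff b i))"
    using fK f_eq[OF diff[OF b(1)]] by fastforce
  also have "\<dots> = (\<Sum>i\<in>I. \<phi> i (b i) - \<phi> i (w i))"
    using bounded_ops_diff[OF W \<phi>] B[OF b(1)] w by (intro sum.cong) (auto simp: diff_def)
  finally show False
    using b(2) by (simp add: sum_subtractf)
qed

section \<open>Approximation of the identity in the compact-open topology\<close>

lemma vdist_bounded_ops_le:
  assumes V: "normed_space V" and W: "normed_space W" and T: "T \<in> bounded_ops V W"
    and x: "x \<in> carrier V" and y: "y \<in> carrier V"
  shows "vdist W (T x) (T y) \<le> opnorm V W T * vdist V x y"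
proof -
  have "vdist W (T x) (T y) = vnorm W (T (x \<oplus>\<^bsub>V\<^esub> (-1) \<odot>\<^bsub>V\<^esub> y))"
    using x y by (simp add: normed_space.vdist_eq[OF W] bounded_ops_mem[OF T] bounded_ops_diff[OF V T])
  also have "\<dots> \<le> opnorm V W T * vnorm V (x \<oplus>\<^bsub>V\<^esub> (-1) \<odot>\<^bsub>V\<^esub> y)"
    by (rule opnorm_bound[OF V W T]) (use V x y in simp)
  finally show ?thesis
    using x y by (simp add: normed_space.vdist_eq[OF V])
qed

text \<open>
  The topology is generated by conditions of closeness to arbitrary operators \<open>T\<close>. Such a condition
  on a compact \<open>K\<close> that holds at the identity holds with a uniform margin, as \<open>x \<mapsto> vdist V x (T x)\<close>
  is continuous; hence it holds for all operators close enough to the identity on \<open>K\<close>.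
\<close>

lemma tau_c_nbhd_id:
  fixes V :: "'a nspace"
  assumes V: "normed_space V" and U: "openin (tau_c V V) U" and id: "(\<lambda>x\<in>carrier V. x) \<in> U"
  obtains K e where "compactin (vtopology V) K" "0 < e"
    "\<And>S. S \<in> bounded_ops V V \<Longrightarrow> (\<And>x. x \<in> K \<Longrightarrow> vdist V (S x) x < e) \<Longrightarrow> S \<in> U"
proof -
  interpret V: normed_space V by fact
  define Q where "Q U \<longleftrightarrow> (\<exists>K e. compactin (vtopology V) K \<and> 0 < e \<and>
    (\<forall>S\<in>bounded_ops V V. (\<forall>x\<in>K. vdist V (S x) x < e) \<longrightarrow> S \<in> U))" for U
  define P where "P U \<longleftrightarrow> ((\<lambda>x\<in>carrier V. x) \<in> U \<longrightarrow> Q U)" for U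
  have "generate_topology_on {{S \<in> bounded_ops V V. \<forall>x\<in>K. vdist V (S x) (T x) < e} | T K e.
        T \<in> bounded_ops V V \<and> compactin (vtopology V) K \<and> e > 0} U"
    using U unfolding tau_c_def openin_topology_generated_by_iff .
  then have "P U"
  proof (induction U rule: generate_topology_on.induct)
    case Empty
    show ?case by (simp add: P_def)
  next
    case (Int A B)
    show ?case
      unfolding P_def
    proof
      assume id: "(\<lambda>x\<in>carrier V. x) \<in> A \<inter> B"
      obtain K e where K: "compactin (vtopology V) K" "0 < e"
        "\<forall>S\<in>bounded_ops V V. (\<forall>x\<in>K. vdist V (S x) x < e) \<longrightarrow> S \<in> A"
        using Int id unfolding P_def Q_def by blast
      obtain L d where L: "compactin (vtopology V) L" "0 < d"
        "\<forall>S\<in>bounded_ops V V. (\<forall>x\<in>L. vdist V (S x) x < d) \<longrightarrow> S \<in> B"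
        using Int id unfolding P_def Q_def by blast
      show "Q (A \<inter> B)"
        unfolding Q_def
        by (intro exI[of _ "K \<union> L"] exI[of _ "min e d"]) (use K L in \<open>simp add: compactin_Un\<close>)
    qed
  next
    case (UN \<A>)
    show ?case
      unfolding P_def
    proof
      assume "(\<lambda>x\<in>carrier V. x) \<in> \<Union>\<A>"
      then obtain A where A: "A \<in> \<A>" "(\<lambda>x\<in>carrier V. x) \<in> A" by blast
      then have "P A"
        using UN by blast
      with A show "Q (\<Union>\<A>)"
        unfolding P_def Q_def by blast
    qed
  next
    case (Basis A)
    then obtain T K e where A: "A = {S \<in> bounded_ops V V. \<forall>x\<in>K. vdist V (S x) (T x) < e}"
      and T: "T \<in> bounded_ops V V" and K: "compactin (vtopology V) K" and e: "e > 0"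
      by blast
    have KV: "K \<subseteq> carrier V"
      using compactin_subset_topspace[OF K] by simp
    show ?case
      unfolding P_def
    proof
      assume id: "(\<lambda>x\<in>carrier V. x) \<in> A"
      \<comment> \<open>An increasing open cover of \<open>K\<close>; a finite subcover provides the margin.\<close>
      define G where "G n = {x \<in> carrier V. vdist V x (T x) < e - 1 / real (Suc n)}" for n
      have "openin (vtopology V) (G n)" for n
        unfolding V.metric.openin_mtopology
      proof (intro conjI allI impI)
        fix x assume x: "x \<in> G n"
        define r where "r = (e - 1 / real (Suc n) - vdist V x (T x)) / (1 + opnorm V V T)"
        have pos: "0 < 1 + opnorm V V T"
          using opnorm_nonneg[OF V V T] by simp
        have "r > 0"
          using x pos by (simp add: r_def G_def)
        moreover have "V.metric.mball x r \<subseteq> G n"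
        proof
          fix y assume "y \<in> V.metric.mball x r"
          then have xy: "x \<in> carrier V" "y \<in> carrier V" "vdist V x y < r"
            by auto
          note m = bounded_ops_mem[OF T xy(1)] bounded_ops_mem[OF T xy(2)]
          have "vdist V y (T y) \<le> vdist V y x + (vdist V x (T x) + vdist V (T x) (T y))"
            using V.metric.triangle[of y x "T y"] V.metric.triangle[of x "T x" "T y"] xy m by simp
          also have "\<dots> \<le> vdist V x (T x) + (1 + opnorm V V T) * vdist V x y"
            using vdist_bounded_ops_le[OF V V T xy(1,2)]
            by (simp add: V.metric.commute[of y x] distrib_right)
          also have "\<dots> < vdist V x (T x) + (1 + opnorm V V T) * r"
            using xy(3) pos by simp
          also have "\<dots> = e - 1 / real (Suc n)"
            using pos by (simp add: r_def)
          finally show "y \<in> G n"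
            using xy(2) by (simp add: G_def)
        qed
        ultimately show "\<exists>r>0. V.metric.mball x r \<subseteq> G n"
          by blast
      qed (auto simp: G_def)
      moreover have "K \<subseteq> \<Union>(range G)"
      proof
        fix x assume x: "x \<in> K"
        have "vdist V ((\<lambda>x\<in>carrier V. x) x) (T x) < e"
          using id x unfolding A by blast
        then have "0 < e - vdist V x (T x)"
          using x KV by (simp add: subsetD)
        then obtain n where "1 / real (Suc n) < e - vdist V x (T x)"
          using nat_approx_posE by blast
        then have "x \<in> G n"
          using x KV by (auto simp: G_def)
        then show "x \<in> \<Union>(range G)" by blast
      qed
      ultimately have "\<exists>\<F>. finite \<F> \<and> \<F> \<subseteq> range G \<and> K \<subseteq> \<Union>\<F>"
        by (intro K[unfolded compactin_def, THEN conjunct2, rule_format] conjI) auto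
      then obtain \<F> where \<F>: "finite \<F>" "\<F> \<subseteq> range G" "K \<subseteq> \<Union>\<F>"
        by (elim exE conjE)
      then obtain N where N: "finite N" "\<F> = G ` N"
        by (metis finite_subset_image)
      define n where "n = Max (insert 0 N)"
      have margin: "vdist V x (T x) < e - 1 / real (Suc n)" if x: "x \<in> K" for x
      proof -
        obtain k where k: "k \<in> N" "x \<in> G k"
          using subsetD[OF \<F>(3) x] unfolding N(2) by (elim UN_E)
        then have "k \<le> n"
          using N(1) by (simp add: n_def)
        then have "1 / real (Suc n) \<le> 1 / real (Suc k)"
          by (simp add: frac_le)
        then show ?thesis
          using k(2) by (simp add: G_def)
      qed
      have "S \<in> A" if S: "S \<in> bounded_ops V V" "\<forall>x\<in>K. vdist V (S x) x < 1 / real (Suc n)" for S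
      proof -
        have "vdist V (S x) (T x) < e" if x: "x \<in> K" for x
        proof -
          have "x \<in> carrier V" "S x \<in> carrier V" "T x \<in> carrier V"
            using x KV bounded_ops_mem[OF S(1)] bounded_ops_mem[OF T] by auto
          then have "vdist V (S x) (T x) \<le> vdist V (S x) x + vdist V x (T x)"
            using V.metric.triangle[of "S x" x "T x"] by simp
          then show ?thesis
            using margin[OF x] S(2) x by force
        qed
        then show ?thesis
          using S(1) by (simp add: A)
      qed
      then show "Q A"
        unfolding Q_def
        using K by (intro exI[of _ K] exI[of _ "1 / real (Suc n)"]) auto
    qed
  qed
  then show thesis
    using that id unfolding P_def Q_def by blast
qed

text \<open>
  The operators in \<open>B\<close> share the Lipschitz constant \<open>l\<close>, so closeness to the identity on a
  sufficiently fine finite net of a compact set implies closeness on the whole set.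
\<close>

lemma id_in_tau_c_closure_iff:
  assumes V: "normed_space V" and B: "B \<subseteq> bounded_ops V V" and l: "0 \<le> l"
    and bound: "\<And>S x. S \<in> B \<Longrightarrow> x \<in> carrier V \<Longrightarrow> vnorm V (S x) \<le> l * vnorm V x"
  shows "(\<lambda>x\<in>carrier V. x) \<in> tau_c V V closure_of B \<longleftrightarrow>
    (\<forall>F e. finite F \<and> F \<subseteq> carrier V \<and> 0 < e \<longrightarrow>
      (\<exists>S\<in>B. \<forall>x\<in>F. vnorm V (S x \<oplus>\<^bsub>V\<^esub> (-1) \<odot>\<^bsub>V\<^esub> x) < e))" (is "?l \<longleftrightarrow> ?r")
proof -
  interpret V: normed_space V by fact
  have dist: "vnorm V (S x \<oplus>\<^bsub>V\<^esub> (-1) \<odot>\<^bsub>V\<^esub> x) = vdist V (S x) x" if "S \<in> B" "x \<in> carrier V" for S x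
    using that B bounded_ops_mem by (metis V.vdist_eq subsetD)
  have basic: "openin (tau_c V V) {S \<in> bounded_ops V V. \<forall>x\<in>K. vdist V (S x) (T x) < e}"
    if "T \<in> bounded_ops V V" "compactin (vtopology V) K" "e > 0" for T K e
    unfolding tau_c_def by (rule topology_generated_by_Basis) (use that in blast)
  note idb = id_bounded_ops[OF V]
  show ?thesis
  proof
    assume ?l
    show ?r
    proof clarify
      fix F and e :: real assume F: "finite F" "F \<subseteq> carrier V" and e: "0 < e"
      let ?U = "{S \<in> bounded_ops V V. \<forall>x\<in>F. vdist V (S x) ((\<lambda>x\<in>carrier V. x) x) < e}"
      have "openin (tau_c V V) ?U"
        by (rule basic[OF idb]) (use F e finite_imp_compactin[of F "vtopology V"] in auto)
      moreover have "(\<lambda>x\<in>carrier V. x) \<in> ?U"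
        using idb F e by auto
      ultimately have "\<exists>S. S \<in> B \<and> S \<in> ?U"
        by (intro \<open>?l\<close>[unfolded in_closure_of, THEN conjunct2, rule_format] conjI)
      then obtain S where "S \<in> B" "S \<in> ?U" by (elim exE conjE)
      then show "\<exists>S\<in>B. \<forall>x\<in>F. vnorm V (S x \<oplus>\<^bsub>V\<^esub> (-1) \<odot>\<^bsub>V\<^esub> x) < e"
        using dist F by (intro bexI[of _ S]) (auto simp: subset_iff)
    qed
  next
    assume r: ?r
    have "(\<lambda>x\<in>carrier V. x) \<in> topspace (tau_c V V)"
      using openin_subset[OF basic[OF idb, of "{}" 1]] idb by auto
    moreover have "\<exists>S. S \<in> B \<and> S \<in> U"
      if U: "openin (tau_c V V) U" "(\<lambda>x\<in>carrier V. x) \<in> U" for U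
    proof -
      obtain K e where K: "compactin (vtopology V) K" and e: "0 < e"
        and KU: "\<And>S. S \<in> bounded_ops V V \<Longrightarrow> (\<And>x. x \<in> K \<Longrightarrow> vdist V (S x) x < e) \<Longrightarrow> S \<in> U"
        using tau_c_nbhd_id[OF V U] by metis
      \<comment> \<open>Passing from a net point to a point at distance \<open>d\<close> costs at most \<open>(l + 1) * d = e / 2\<close>.\<close>
      define d where "d = e / (2 * (l + 1))"
      have d: "0 < d"
        using e l by (simp add: d_def)
      have "V.metric.mtotally_bounded K"
        by (rule V.metric.compactin_imp_mtotally_bounded[OF K])
      then have "\<exists>F. finite F \<and> F \<subseteq> K \<and> K \<subseteq> (\<Union>x\<in>F. V.metric.mball x d)"
        unfolding V.metric.mtotally_bounded_def using d by (elim allE impE)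
      then obtain F where F: "finite F" "F \<subseteq> K" "K \<subseteq> (\<Union>x\<in>F. V.metric.mball x d)"
        by (elim exE conjE)
      have KV: "K \<subseteq> carrier V"
        using compactin_subset_topspace[OF K] by simp
      obtain S where S: "S \<in> B" "\<forall>x\<in>F. vnorm V (S x \<oplus>\<^bsub>V\<^esub> (-1) \<odot>\<^bsub>V\<^esub> x) < e / 2"
        using r[rule_format, of F "e / 2"] F KV e by auto
      have Sb: "S \<in> bounded_ops V V"
        using S(1) B by blast
      have "vdist V (S y) y < e" if y: "y \<in> K" for y
      proof -
        obtain x where x: "x \<in> F" "vdist V x y < d"
          using F(3) y by auto
        have c: "x \<in> carrier V" "y \<in> carrier V" "S x \<in> carrier V" "S y \<in> carrier V"
          using x y F(2) KV bounded_ops_mem[OF Sb] by auto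
        have "vdist V (S y) (S x) = vnorm V (S (y \<oplus>\<^bsub>V\<^esub> (-1) \<odot>\<^bsub>V\<^esub> x))"
          using c by (simp add: V.vdist_eq bounded_ops_diff[OF V Sb])
        also have "\<dots> \<le> l * vdist V y x"
          using bound[OF S(1)] c V by (simp add: V.vdist_eq)
        finally have 1: "vdist V (S y) (S x) \<le> l * vdist V x y"
          by (simp add: V.metric.commute)
        have "vdist V (S y) y \<le> vdist V (S y) (S x) + (vdist V (S x) x + vdist V x y)"
          using V.metric.triangle[of "S y" "S x" y] V.metric.triangle[of "S x" x y] c by simp
        also have "\<dots> < (l + 1) * vdist V x y + e / 2"
          using 1 S(2) x(1) dist[OF S(1) c(1)] by (auto simp: distrib_right)
        also have "\<dots> \<le> (l + 1) * d + e / 2"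
          using x(2) l by (simp add: mult_left_mono)
        also have "\<dots> = e"
          using l by (simp add: d_def field_simps)
        finally show ?thesis .
      qed
      then show ?thesis
        using KU[OF Sb] S(1) by blast
    qed
    ultimately show ?l
      unfolding in_closure_of by blast
  qed
qed

section \<open>Adjoints and isometric isomorphisms\<close>

lemma carrier_dual: "carrier (dual V) = bounded_ops V real_space"
  by simp

lemma dual_add: "f \<in> bounded_ops V real_space \<Longrightarrow> x \<in> carrier V \<Longrightarrow> y \<in> carrier V \<Longrightarrow>
    f (x \<oplus>\<^bsub>V\<^esub> y) = f x + f y"
  using bounded_ops_add[of f V real_space] by simp

lemma dual_smult: "f \<in> bounded_ops V real_space \<Longrightarrow> x \<in> carrier V \<Longrightarrow> f (a \<odot>\<^bsub>V\<^esub> x) = a * f x"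
  using bounded_ops_smult[of f V real_space] by simp

lemma dual_bound:
  "normed_space V \<Longrightarrow> f \<in> bounded_ops V real_space \<Longrightarrow> x \<in> carrier V \<Longrightarrow>
    \<bar>f x\<bar> \<le> opnorm V real_space f * vnorm V x"
  using opnorm_bound[of V real_space f x] by simp

lemma dual_opnorm_nonneg:
  "normed_space V \<Longrightarrow> f \<in> bounded_ops V real_space \<Longrightarrow> 0 \<le> opnorm V real_space f"
  using opnorm_nonneg[of V real_space f] by simp

lemma compose_dual:
  assumes "normed_space V" "normed_space W" "T \<in> bounded_ops V W" "g \<in> bounded_ops W real_space"
  shows "compose (carrier V) g T \<in> bounded_ops V real_space"
  using compose_bounded_ops[OF assms(1,2) normed_space_real_space assms(3,4)] .

lemma opnorm_compose_dual_le:
  assumes "normed_space V" "normed_space W" "T \<in> bounded_ops V W" "g \<in> bounded_ops W real_space"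
  shows "opnorm V real_space (compose (carrier V) g T) \<le> opnorm V W T * opnorm W real_space g"
proof (rule opnorm_le)
  fix x assume x: "x \<in> carrier V"
  have "\<bar>g (T x)\<bar> \<le> opnorm W real_space g * vnorm W (T x)"
    by (rule dual_bound) (use assms x bounded_ops_mem in auto)
  also have "\<dots> \<le> opnorm W real_space g * (opnorm V W T * vnorm V x)"
    by (intro mult_left_mono opnorm_bound dual_opnorm_nonneg) (use assms x in auto)
  finally show "vnorm real_space (compose (carrier V) g T x)
      \<le> (opnorm V W T * opnorm W real_space g) * vnorm V x"
    using x by (simp add: compose_eq algebra_simps)
qed (use assms opnorm_nonneg[OF assms(1-3)] dual_opnorm_nonneg[OF assms(2,4)] in auto)

lemma adjoint_apply:
  "g \<in> bounded_ops W real_space \<Longrightarrow> adjoint V W T g = compose (carrier V) g T"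
  by (simp add: adjoint_def)

lemma adjoint_bounded_ops:
  assumes V: "normed_space V" and W: "normed_space W" and T: "T \<in> bounded_ops V W"
  shows "adjoint V W T \<in> bounded_ops (dual W) (dual V)"
  unfolding adjoint_def
proof (rule bounded_ops_restrictI)
  fix g assume g: "g \<in> carrier (dual W)"
  show "compose (carrier V) g T \<in> carrier (dual V)"
    using compose_dual[OF V W T] g by simp
  show "vnorm (dual V) (compose (carrier V) g T) \<le> opnorm V W T * vnorm (dual W) g"
    using opnorm_compose_dual_le[OF V W T] g by simp
qed (use V W bounded_ops_mem[OF T] in \<open>auto simp: compose_def fun_eq_iff\<close>)

lemma canon_bounded_ops:
  assumes V: "normed_space V"
  shows "canon V \<in> bounded_ops V (bidual V)"
  unfolding canon_def
proof (rule bounded_ops_restrictI[OF V])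
  fix x assume x: "x \<in> carrier V"
  have le: "\<bar>f x\<bar> \<le> vnorm V x * opnorm V real_space f" if "f \<in> bounded_ops V real_space" for f
    using dual_bound[OF V that x] by (simp add: mult.commute)
  show "(\<lambda>f\<in>carrier (dual V). f x) \<in> carrier (bidual V)"
    unfolding carrier_dual[of "dual V"]
    by (rule bounded_ops_restrictI[where C = "vnorm V x"]) (use V x le in auto)
  have "opnorm (dual V) real_space (\<lambda>f\<in>carrier (dual V). f x) \<le> vnorm V x"
    by (rule opnorm_le) (use V x le in auto)
  then show "vnorm (bidual V) (\<lambda>f\<in>carrier (dual V). f x) \<le> 1 * vnorm V x"
    by simp
qed (use V in \<open>auto simp: dual_add dual_smult fun_eq_iff\<close>)

lemma canon_apply:
  "x \<in> carrier V \<Longrightarrow> f \<in> bounded_ops V real_space \<Longrightarrow> canon V x f = f x"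
  by (simp add: canon_def)

lemma isometric_isoD:
  assumes "isometric_iso V W i"
  shows "i \<in> bounded_ops V W" and "x \<in> carrier V \<Longrightarrow> i x \<in> carrier W"
    and "x \<in> carrier V \<Longrightarrow> inv_into (carrier V) i (i x) = x"
    and "y \<in> carrier W \<Longrightarrow> i (inv_into (carrier V) i y) = y"
    and "y \<in> carrier W \<Longrightarrow> inv_into (carrier V) i y \<in> carrier V"
    and "x \<in> carrier V \<Longrightarrow> vnorm W (i x) = vnorm V x"
  using assms unfolding isometric_iso_def bij_betw_def
  by (auto intro: inv_into_into f_inv_into_f)

lemma isometric_iso_inverse:
  assumes V: "normed_space V" and W: "normed_space W" and i: "isometric_iso V W i"
  shows "isometric_iso W V (\<lambda>y\<in>carrier W. inv_into (carrier V) i y)"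
proof -
  note iD = isometric_isoD[OF i]
  have eqI: "inv_into (carrier V) i y = x" if "x \<in> carrier V" "i x = y" for x y
    using iD(3) that by blast
  have bij: "bij_betw (\<lambda>y\<in>carrier W. inv_into (carrier V) i y) (carrier W) (carrier V)"
    using i bij_betw_inv_into[of i "carrier V" "carrier W"]
    by (auto simp: isometric_iso_def cong: bij_betw_cong)
  have norm: "vnorm V (inv_into (carrier V) i y) = vnorm W y" if "y \<in> carrier W" for y
    using iD(4-6) that by metis
  have "(\<lambda>y\<in>carrier W. inv_into (carrier V) i y) \<in> bounded_ops W V"
  proof (rule bounded_ops_restrictI[OF W, where C = 1])
    fix y assume y: "y \<in> carrier W"
    show "inv_into (carrier V) i (a \<odot>\<^bsub>W\<^esub> y) = a \<odot>\<^bsub>V\<^esub> inv_into (carrier V) i y" for a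
      using V y iD(4,5) by (intro eqI) (auto simp: bounded_ops_smult[OF iD(1)])
    show "inv_into (carrier V) i (y \<oplus>\<^bsub>W\<^esub> z) = inv_into (carrier V) i y \<oplus>\<^bsub>V\<^esub> inv_into (carrier V) i z"
      if "z \<in> carrier W" for z
      using V y that iD(4,5) by (intro eqI) (auto simp: bounded_ops_add[OF iD(1)])
  qed (use norm iD(5) in auto)
  then show ?thesis
    using bij norm by (simp add: isometric_iso_def)
qed

lemma isometric_iso_compose:
  assumes U: "normed_space U" and V: "normed_space V" and W: "normed_space W"
    and i: "isometric_iso U V i" and j: "isometric_iso V W j"
  shows "isometric_iso U W (compose (carrier U) j i)"
  unfolding isometric_iso_def
proof (intro conjI ballI)
  show "compose (carrier U) j i \<in> bounded_ops U W"
    by (rule compose_bounded_ops[OF U V W isometric_isoD(1)[OF i] isometric_isoD(1)[OF j]])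
  show "bij_betw (compose (carrier U) j i) (carrier U) (carrier W)"
    using i j by (auto simp: isometric_iso_def intro: bij_betw_compose)
qed (use isometric_isoD[OF i] isometric_isoD[OF j] in \<open>simp add: compose_eq\<close>)

text \<open>
  Applied twice it shows that isometric spaces have isometric biduals, through which the conditions
  on biduals pass from a space to its copies in the universe.
\<close>

lemma isometric_iso_adjoint:
  assumes V: "normed_space V" and W: "normed_space W" and i: "isometric_iso V W i"
  shows "isometric_iso (dual W) (dual V) (adjoint V W i)"
  unfolding isometric_iso_def
proof (intro conjI ballI)
  note iD = isometric_isoD[OF i]
  let ?k = "\<lambda>y\<in>carrier W. inv_into (carrier V) i y"
  have k: "?k \<in> bounded_ops W V"
    using isometric_isoD(1)[OF isometric_iso_inverse[OF V W i]] .
  show "adjoint V W i \<in> bounded_ops (dual W) (dual V)"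
    by (rule adjoint_bounded_ops[OF V W iD(1)])
  show "bij_betw (adjoint V W i) (carrier (dual W)) (carrier (dual V))"
  proof (rule bij_betwI)
    show "adjoint V W i \<in> carrier (dual W) \<rightarrow> carrier (dual V)"
      using bounded_ops_mem[OF adjoint_bounded_ops[OF V W iD(1)]] by auto
    show "adjoint W V ?k \<in> carrier (dual V) \<rightarrow> carrier (dual W)"
      using bounded_ops_mem[OF adjoint_bounded_ops[OF W V k]] by auto
    show "adjoint W V ?k (adjoint V W i g) = g" if g: "g \<in> carrier (dual W)" for g
      by (rule extensionalityI[of _ "carrier W"])
        (use g compose_dual[OF V W iD(1)] iD(4,5) bounded_ops_ext[of g W real_space]
          in \<open>auto simp: adjoint_apply compose_eq\<close>)
    show "adjoint V W i (adjoint W V ?k f) = f" if f: "f \<in> carrier (dual V)" for f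
      by (rule extensionalityI[of _ "carrier V"])
        (use f compose_dual[OF W V k] iD(2,3) bounded_ops_ext[of f V real_space]
          in \<open>auto simp: adjoint_apply compose_eq\<close>)
  qed
  fix g assume g: "g \<in> carrier (dual W)"
  have "opnorm V real_space (compose (carrier V) g i) = (SUP x\<in>carrier V. \<bar>g (i x)\<bar> / vnorm W (i x))"
    unfolding opnorm_def by (intro SUP_cong) (use iD(6) in \<open>auto simp: compose_eq\<close>)
  also have "\<dots> = (SUP y\<in>i ` carrier V. \<bar>g y\<bar> / vnorm W y)"
    by (simp add: image_image)
  also have "i ` carrier V = carrier W"
    using i by (simp add: isometric_iso_def bij_betw_def)
  finally show "vnorm (dual V) (adjoint V W i g) = vnorm (dual W) g"
    using g by (simp add: adjoint_apply) (simp add: opnorm_def)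
qed

lemma fits_isometric_iso:
  assumes "fits TYPE('u) V" and "isometric_iso V W i"
  shows "fits TYPE('u) W"
proof -
  obtain g :: "'a \<Rightarrow> 'u" where g: "inj_on g (carrier V)"
    using assms(1) by (auto simp: fits_def)
  have "inj_on (inv_into (carrier V) i) (carrier W)"
    using isometric_isoD(4)[OF assms(2)] by (intro inj_on_inverseI)
  moreover have "inv_into (carrier V) i ` carrier W \<subseteq> carrier V"
    using isometric_isoD(5)[OF assms(2)] by auto
  ultimately have "inj_on (g \<circ> inv_into (carrier V) i) (carrier W)"
    using g by (meson comp_inj_on inj_on_subset)
  then show ?thesis
    unfolding fits_def by blast
qed

section \<open>Operators of an ideal on spaces outside the universe\<close>

lemma operator_idealD:
  assumes A: "operator_ideal A"
  shows "banach_space V \<Longrightarrow> banach_space W \<Longrightarrow> submodule (A V W) real_ring (op_space V W)"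
    and "banach_space V \<Longrightarrow> banach_space W \<Longrightarrow> f \<in> bounded_ops V real_space \<Longrightarrow> y \<in> carrier W \<Longrightarrow>
      (\<lambda>x\<in>carrier V. f x \<odot>\<^bsub>W\<^esub> y) \<in> A V W"
    and "banach_space U \<Longrightarrow> banach_space V \<Longrightarrow> banach_space W \<Longrightarrow> banach_space Y \<Longrightarrow>
      S \<in> bounded_ops U V \<Longrightarrow> T \<in> A V W \<Longrightarrow> R \<in> bounded_ops W Y \<Longrightarrow>
      compose (carrier U) R (compose (carrier U) T S) \<in> A U Y"
  using A unfolding operator_ideal_def carrier_dual by blast+

lemma ideal_opsI:
  assumes "T \<in> bounded_ops V W" "banach_space V'" "banach_space W'"
    "isometric_iso V V' i" "isometric_iso W W' j"
    "(\<lambda>x\<in>carrier V'. j (T (inv_into (carrier V) i x))) \<in> A V' W'"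
  shows "T \<in> ideal_ops A V W"
  using assms unfolding ideal_ops_def by blast

lemma ideal_opsE:
  assumes "T \<in> ideal_ops A V W"
  obtains V' W' i j where "banach_space V'" "banach_space W'"
    "isometric_iso V V' i" "isometric_iso W W' j"
    "(\<lambda>x\<in>carrier V'. j (T (inv_into (carrier V) i x))) \<in> A V' W'"
  using assms unfolding ideal_ops_def by blast

lemma ideal_ops_bounded: "T \<in> ideal_ops A V W \<Longrightarrow> T \<in> bounded_ops V W"
  by (simp add: ideal_ops_def)

text \<open>
  Membership in \<open>ideal_ops\<close> provides some copies of the two spaces. This lemma moves the operator to
  prescribed copies: the isometries between the copies are bounded operators of the universe, so the
  ideal property absorbs them together with \<open>S\<close> and \<open>R\<close>.
\<close>

lemma ideal_ops_compose_copy: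
  assumes A: "operator_ideal A"
    and U: "normed_space U" and V: "normed_space V" and W: "normed_space W" and Y: "normed_space Y"
    and T: "T \<in> ideal_ops A V W" and S: "S \<in> bounded_ops U V" and R: "R \<in> bounded_ops W Y"
    and U': "banach_space U'" "isometric_iso U U' a" and Y': "banach_space Y'" "isometric_iso Y Y' b"
  shows "(\<lambda>x\<in>carrier U'. b (R (T (S (inv_into (carrier U) a x))))) \<in> A U' Y'"
proof -
  obtain V' W' i j where V': "banach_space V'" "isometric_iso V V' i"
    and W': "banach_space W'" "isometric_iso W W' j"
    and T': "(\<lambda>x\<in>carrier V'. j (T (inv_into (carrier V) i x))) \<in> A V' W'" (is "?T' \<in> _")
    using T by (rule ideal_opsE)
  note n = U V W Y U'(1)[THEN banach_space_imp_normed_space] V'(1)[THEN banach_space_imp_normed_space]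
    W'(1)[THEN banach_space_imp_normed_space] Y'(1)[THEN banach_space_imp_normed_space]
  note aD = isometric_isoD[OF U'(2)] and iD = isometric_isoD[OF V'(2)]
    and jD = isometric_isoD[OF W'(2)] and bD = isometric_isoD[OF Y'(2)]
  let ?S' = "compose (carrier U') i (compose (carrier U') S (\<lambda>x\<in>carrier U'. inv_into (carrier U) a x))"
  let ?R' = "compose (carrier W') b (compose (carrier W') R (\<lambda>y\<in>carrier W'. inv_into (carrier W) j y))"
  have Tb: "T \<in> bounded_ops V W"
    using T by (rule ideal_ops_bounded)
  have "?S' \<in> bounded_ops U' V'"
    using n S iD(1) isometric_isoD(1)[OF isometric_iso_inverse[OF U n(5) U'(2)]]
    by (blast intro: compose_bounded_ops)
  moreover have "?R' \<in> bounded_ops W' Y'"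
    using n R bD(1) isometric_isoD(1)[OF isometric_iso_inverse[OF W n(7) W'(2)]]
    by (blast intro: compose_bounded_ops)
  ultimately have "compose (carrier U') ?R' (compose (carrier U') ?T' ?S') \<in> A U' Y'"
    using operator_idealD(3)[OF A U'(1) V'(1) W'(1) Y'(1)] T' by blast
  moreover have "compose (carrier U') ?R' (compose (carrier U') ?T' ?S') =
    (\<lambda>x\<in>carrier U'. b (R (T (S (inv_into (carrier U) a x)))))"
    by (rule extensionalityI[of _ "carrier U'"])
      (auto simp: compose_eq aD iD jD bounded_ops_mem[OF S] bounded_ops_mem[OF Tb])
  ultimately show ?thesis by simp
qed

lemma ideal_ops_compose:
  fixes A :: "'u ideal" and U' Y' :: "'u nspace"
  assumes A: "operator_ideal A"
    and U: "normed_space U" and V: "normed_space V" and W: "normed_space W" and Y: "normed_space Y"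
    and T: "T \<in> ideal_ops A V W" and S: "S \<in> bounded_ops U V" and R: "R \<in> bounded_ops W Y"
    and U': "banach_space U'" "isometric_iso U U' a" and Y': "banach_space Y'" "isometric_iso Y Y' b"
  shows "(\<lambda>x\<in>carrier U. R (T (S x))) \<in> ideal_ops A U Y"
proof (rule ideal_opsI[OF _ U'(1) Y'(1) U'(2) Y'(2)])
  note Tb = ideal_ops_bounded[OF T]
  have "compose (carrier U) R (compose (carrier U) T S) \<in> bounded_ops U Y"
    by (intro compose_bounded_ops[OF U W Y] compose_bounded_ops[OF U V W] S Tb R)
  then show "(\<lambda>x\<in>carrier U. R (T (S x))) \<in> bounded_ops U Y"
    by (simp add: compose_def cong: restrict_cong)
  have "(\<lambda>x\<in>carrier U'. b ((\<lambda>x\<in>carrier U. R (T (S x))) (inv_into (carrier U) a x))) =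
    (\<lambda>x\<in>carrier U'. b (R (T (S (inv_into (carrier U) a x)))))"
    by (intro restrict_ext) (simp add: isometric_isoD(5)[OF U'(2)])
  then show "(\<lambda>x\<in>carrier U'. b ((\<lambda>x\<in>carrier U. R (T (S x))) (inv_into (carrier U) a x))) \<in> A U' Y'"
    using ideal_ops_compose_copy[OF assms] by simp
qed

lemma ideal_ops_copy:
  assumes A: "operator_ideal A" and V: "normed_space V" and W: "normed_space W"
    and T: "T \<in> ideal_ops A V W"
    and V': "banach_space V'" "isometric_iso V V' i" and W': "banach_space W'" "isometric_iso W W' j"
  shows "(\<lambda>x\<in>carrier V'. j (T (inv_into (carrier V) i x))) \<in> A V' W'"
proof -
  have "(\<lambda>x\<in>carrier V'. j ((\<lambda>y\<in>carrier W. y) (T ((\<lambda>x\<in>carrier V. x) (inv_into (carrier V) i x))))) \<in> A V' W'"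
    by (rule ideal_ops_compose_copy[OF A V V W W T id_bounded_ops[OF V] id_bounded_ops[OF W] V' W'])
  moreover have "(\<lambda>x\<in>carrier V'. j ((\<lambda>y\<in>carrier W. y) (T ((\<lambda>x\<in>carrier V. x) (inv_into (carrier V) i x)))))
    = (\<lambda>x\<in>carrier V'. j (T (inv_into (carrier V) i x)))"
    by (intro restrict_ext)
      (simp add: isometric_isoD[OF V'(2)] bounded_ops_mem[OF ideal_ops_bounded[OF T]])
  ultimately show ?thesis by simp
qed

lemma ideal_ops_lincomb:
  fixes A :: "'u ideal"
  assumes A: "operator_ideal A" and V: "normed_space V" and W: "normed_space W"
    and S: "S \<in> ideal_ops A V W" and T: "T \<in> ideal_ops A V W"
  shows "(\<lambda>x\<in>carrier V. a \<odot>\<^bsub>W\<^esub> S x \<oplus>\<^bsub>W\<^esub> b \<odot>\<^bsub>W\<^esub> T x) \<in> ideal_ops A V W" (is "?L \<in> _")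
proof -
  obtain V' W' :: "'u nspace" and i j where V': "banach_space V'" "isometric_iso V V' i"
    and W': "banach_space W'" "isometric_iso W W' j"
    using S by (rule ideal_opsE) blast
  note iD = isometric_isoD[OF V'(2)] and jD = isometric_isoD[OF W'(2)]
  note Sb = ideal_ops_bounded[OF S] and Tb = ideal_ops_bounded[OF T]
  note subm = submodule_realD[OF operator_idealD(1)[OF A V'(1) W'(1)]]
  show ?thesis
  proof (rule ideal_opsI[OF _ V'(1) W'(1) V'(2) W'(2)])
    have "(\<lambda>x\<in>carrier V. (\<lambda>x\<in>carrier V. a \<odot>\<^bsub>W\<^esub> S x) x \<oplus>\<^bsub>W\<^esub> (\<lambda>x\<in>carrier V. b \<odot>\<^bsub>W\<^esub> T x) x) \<in> bounded_ops V W"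
      by (intro add_bounded_ops smult_bounded_ops V W Sb Tb)
    then show "?L \<in> bounded_ops V W"
      by (simp cong: restrict_cong)
    let ?S = "\<lambda>x\<in>carrier V'. j (S (inv_into (carrier V) i x))"
    let ?T = "\<lambda>x\<in>carrier V'. j (T (inv_into (carrier V) i x))"
    let ?O = "op_space V' W'"
    have "a \<odot>\<^bsub>?O\<^esub> ?S \<oplus>\<^bsub>?O\<^esub> b \<odot>\<^bsub>?O\<^esub> ?T \<in> A V' W'"
      by (intro subm ideal_ops_copy[OF A V W _ V' W'] S T)
    moreover have "a \<odot>\<^bsub>?O\<^esub> ?S \<oplus>\<^bsub>?O\<^esub> b \<odot>\<^bsub>?O\<^esub> ?T = (\<lambda>x\<in>carrier V'. j (?L (inv_into (carrier V) i x)))"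
      by (rule extensionalityI[of _ "carrier V'"])
        (use W in \<open>auto simp: iD bounded_ops_mem[OF Sb] bounded_ops_mem[OF Tb]
          bounded_ops_add[OF jD(1)] bounded_ops_smult[OF jD(1)]\<close>)
    ultimately show "(\<lambda>x\<in>carrier V'. j (?L (inv_into (carrier V) i x))) \<in> A V' W'"
      by simp
  qed
qed

lemma ideal_ops_rank_one:
  fixes A :: "'u ideal" and V' W' :: "'u nspace"
  assumes A: "operator_ideal A" and V: "normed_space V" and W: "normed_space W"
    and V': "banach_space V'" "isometric_iso V V' i" and W': "banach_space W'" "isometric_iso W W' j"
    and f: "f \<in> bounded_ops V real_space" and y: "y \<in> carrier W"
  shows "(\<lambda>x\<in>carrier V. f x \<odot>\<^bsub>W\<^esub> y) \<in> ideal_ops A V W"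
proof (rule ideal_opsI[OF _ V'(1) W'(1) V'(2) W'(2)])
  note iD = isometric_isoD[OF V'(2)] and jD = isometric_isoD[OF W'(2)]
  have V'n: "normed_space V'"
    by (rule banach_space_imp_normed_space[OF V'(1)])
  show "(\<lambda>x\<in>carrier V. f x \<odot>\<^bsub>W\<^esub> y) \<in> bounded_ops V W"
  proof (rule bounded_ops_restrictI[OF V])
    fix x assume x: "x \<in> carrier V"
    show "vnorm W (f x \<odot>\<^bsub>W\<^esub> y) \<le> (opnorm V real_space f * vnorm W y) * vnorm V x"
      using mult_right_mono[OF dual_bound[OF V f x], of "vnorm W y"] W y
      by (simp add: normed_space.norm_smult algebra_simps)
  qed (use W y in \<open>auto simp: dual_add[OF f] dual_smult[OF f] normed_space.smult_plus\<close>)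
  have "compose (carrier V') f (\<lambda>x\<in>carrier V'. inv_into (carrier V) i x) \<in> bounded_ops V' real_space"
    by (rule compose_dual[OF V'n V isometric_isoD(1)[OF isometric_iso_inverse[OF V V'n V'(2)]] f])
  then have "(\<lambda>x\<in>carrier V'. compose (carrier V') f (\<lambda>x\<in>carrier V'. inv_into (carrier V) i x) x
      \<odot>\<^bsub>W'\<^esub> j y) \<in> A V' W'"
    by (rule operator_idealD(2)[OF A V'(1) W'(1)]) (rule jD(2)[OF y])
  moreover have "(\<lambda>x\<in>carrier V'. compose (carrier V') f (\<lambda>x\<in>carrier V'. inv_into (carrier V) i x) x
      \<odot>\<^bsub>W'\<^esub> j y) = (\<lambda>x\<in>carrier V'. j ((\<lambda>x\<in>carrier V. f x \<odot>\<^bsub>W\<^esub> y) (inv_into (carrier V) i x)))"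
    by (intro restrict_ext) (simp add: compose_eq iD(5) bounded_ops_smult[OF jD(1) y])
  ultimately show "(\<lambda>x\<in>carrier V'. j ((\<lambda>x\<in>carrier V. f x \<odot>\<^bsub>W\<^esub> y) (inv_into (carrier V) i x))) \<in> A V' W'"
    by simp
qed

text \<open>
  The hypothesis \<open>into\<close> speaks about spaces in the universe. For other spaces it is applied to a copy
  \<open>V\<close> of \<open>Z\<close>, and the operator obtained from \<open>bidual V\<close> to \<open>V\<close> is carried back along the isometries
  \<open>bidual Z \<rightarrow> bidual V\<close> and \<open>V \<rightarrow> Z\<close>.
\<close>

lemma biadjoint_factor:
  fixes A :: "'u ideal" and Z :: "'a nspace"
  assumes A: "operator_ideal A" and Z: "normed_space Z" and large: "fits TYPE('u) (bidual Z)"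
    and into: "\<And>Z T. \<lbrakk>banach_space Z; fits TYPE('u) (bidual Z); T \<in> A Z Z\<rbrakk>
               \<Longrightarrow> biadjoint_into_space A Z T"
    and T: "T \<in> ideal_ops A Z Z"
  obtains U where "U \<in> ideal_ops A (bidual Z) Z"
    "\<And>\<phi> f. \<lbrakk>\<phi> \<in> bounded_ops (dual Z) real_space; f \<in> bounded_ops Z real_space\<rbrakk> \<Longrightarrow>
      f (U \<phi>) = \<phi> (compose (carrier Z) f T)"
proof -
  obtain V :: "'u nspace" and i where V: "banach_space V" "isometric_iso Z V i"
    using T by (rule ideal_opsE) blast
  have Vn: "normed_space V"
    by (rule banach_space_imp_normed_space[OF V(1)])
  note iD = isometric_isoD[OF V(2)] and Tb = ideal_ops_bounded[OF T]
  define k where "k = (\<lambda>y\<in>carrier V. inv_into (carrier Z) i y)"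
  have k: "k \<in> bounded_ops V Z"
    unfolding k_def by (rule isometric_isoD(1)[OF isometric_iso_inverse[OF Z Vn V(2)]])
  define I where "I = biadjoint Z V i"
  have I: "isometric_iso (bidual Z) (bidual V) I"
    unfolding I_def
    by (intro isometric_iso_adjoint isometric_iso_adjoint V(2)) (use Z Vn in simp_all)
  note ID = isometric_isoD[OF I]
  define T' where "T' = (\<lambda>x\<in>carrier V. i (T (inv_into (carrier Z) i x)))"
  have "T' \<in> A V V"
    unfolding T'_def by (rule ideal_ops_copy[OF A Z Z T V V])
  then have bis: "biadjoint_into_space A V T'"
    by (rule into[OF V(1) fits_isometric_iso[OF large I]])
  define U' where "U' = (\<lambda>\<phi>\<in>carrier (bidual V). inv_into (carrier V) (canon V) (biadjoint V V T' \<phi>))"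
  have U': "U' \<in> ideal_ops A (bidual V) V"
    using bis unfolding biadjoint_into_space_def U'_def by blast
  have adj: "adjoint V V T' g \<in> bounded_ops V real_space" if "g \<in> bounded_ops V real_space" for g
  proof -
    have "T' \<in> bounded_ops V V"
      using submodule_realD(1)[OF operator_idealD(1)[OF A V(1) V(1)]] \<open>T' \<in> A V V\<close> by auto
    then show ?thesis
      using compose_dual[OF Vn Vn _ that] that by (simp add: adjoint_apply)
  qed
  have U'_eq: "g (U' \<psi>) = \<psi> (compose (carrier V) g T')"
    if \<psi>: "\<psi> \<in> bounded_ops (dual V) real_space" and g: "g \<in> bounded_ops V real_space" for \<psi> g
  proof -
    have "biadjoint V V T' \<psi> \<in> canon V ` carrier V"
      using bis \<psi> unfolding biadjoint_into_space_def by auto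
    then have "U' \<psi> \<in> carrier V" "canon V (U' \<psi>) = biadjoint V V T' \<psi>"
      using \<psi> by (auto simp: U'_def f_inv_into_f inv_into_into)
    then have "g (U' \<psi>) = biadjoint V V T' \<psi> g"
      using canon_apply g by metis
    also have "\<dots> = \<psi> (compose (carrier V) g T')"
      using \<psi> g by (simp add: adjoint_apply compose_eq)
    finally show ?thesis .
  qed
  obtain V'' :: "'u nspace" and i'' where V'': "banach_space V''" "isometric_iso (bidual V) V'' i''"
    using U' by (rule ideal_opsE) blast
  have copy: "isometric_iso (bidual Z) V'' (compose (carrier (bidual Z)) i'' I)"
    by (rule isometric_iso_compose[OF _ _ _ I V''(2)])
      (use Z Vn banach_space_imp_normed_space[OF V''(1)] in simp_all)
  define U where "U = (\<lambda>\<phi>\<in>carrier (bidual Z). k (U' (I \<phi>)))"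
  show thesis
  proof
    show "U \<in> ideal_ops A (bidual Z) Z"
      unfolding U_def
      by (rule ideal_ops_compose[OF A _ _ _ _ U' ID(1) k V''(1) copy V]) (use Z Vn in simp_all)
    fix \<phi> f assume \<phi>: "\<phi> \<in> bounded_ops (dual Z) real_space" and f: "f \<in> bounded_ops Z real_space"
    let ?g = "compose (carrier V) f k"
    have g: "?g \<in> bounded_ops V real_space"
      by (rule compose_dual[OF Vn Z k f])
    have I\<phi>: "I \<phi> \<in> bounded_ops (dual V) real_space"
      using ID(2)[of \<phi>] \<phi> by simp
    have "U' (I \<phi>) \<in> carrier V"
      using bounded_ops_mem[OF ideal_ops_bounded[OF U'], of "I \<phi>"] I\<phi> by simp
    then have "f (U \<phi>) = ?g (U' (I \<phi>))"
      using \<phi> by (simp add: U_def compose_eq)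
    also have "\<dots> = I \<phi> (compose (carrier V) ?g T')"
      by (rule U'_eq[OF I\<phi> g])
    also have "\<dots> = \<phi> (compose (carrier Z) (compose (carrier V) ?g T') i)"
      using adj[OF g] g \<phi> by (simp add: I_def adjoint_apply compose_eq)
    also have "compose (carrier Z) (compose (carrier V) ?g T') i = compose (carrier Z) f T"
      by (rule extensionalityI[of _ "carrier Z"])
        (auto simp: compose_eq iD T'_def k_def bounded_ops_mem[OF Tb])
    finally show "f (U \<phi>) = \<phi> (compose (carrier Z) f T)" .
  qed
qed

section \<open>The approximation properties in terms of finite sets\<close>

lemma ideal_ballD:
  assumes "T \<in> ideal_ball A l Z"
  shows "T \<in> ideal_ops A Z Z" "T \<in> bounded_ops Z Z" "opnorm Z Z T \<le> l"
  using assms by (auto simp: ideal_ball_def ideal_ops_bounded)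

lemma ideal_ball_bound:
  assumes Z: "normed_space Z" and T: "T \<in> ideal_ball A l Z" and x: "x \<in> carrier Z"
  shows "vnorm Z (T x) \<le> l * vnorm Z x"
proof -
  have "vnorm Z (T x) \<le> opnorm Z Z T * vnorm Z x"
    by (rule opnorm_bound[OF Z Z ideal_ballD(2)[OF T] x])
  also have "\<dots> \<le> l * vnorm Z x"
    using ideal_ballD(3)[OF T] Z x by (intro mult_right_mono) auto
  finally show ?thesis .
qed

lemma ideal_ball_convex:
  assumes A: "operator_ideal A" and Z: "normed_space Z" and l: "0 \<le> l"
    and S: "S \<in> ideal_ball A l Z" and T: "T \<in> ideal_ball A l Z" and t: "0 \<le> t" "t \<le> 1"
  shows "(\<lambda>x\<in>carrier Z. t \<odot>\<^bsub>Z\<^esub> S x \<oplus>\<^bsub>Z\<^esub> (1 - t) \<odot>\<^bsub>Z\<^esub> T x) \<in> ideal_ball A l Z"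
proof -
  interpret Z: normed_space Z by fact
  note m = bounded_ops_mem[OF ideal_ballD(2)[OF S]] bounded_ops_mem[OF ideal_ballD(2)[OF T]]
  have "opnorm Z Z (\<lambda>x\<in>carrier Z. t \<odot>\<^bsub>Z\<^esub> S x \<oplus>\<^bsub>Z\<^esub> (1 - t) \<odot>\<^bsub>Z\<^esub> T x) \<le> l"
  proof (rule opnorm_le[OF Z Z l])
    fix x assume x: "x \<in> carrier Z"
    have "vnorm Z (t \<odot>\<^bsub>Z\<^esub> S x \<oplus>\<^bsub>Z\<^esub> (1 - t) \<odot>\<^bsub>Z\<^esub> T x) \<le> t * vnorm Z (S x) + (1 - t) * vnorm Z (T x)"
      using Z.norm_triangle[of "t \<odot>\<^bsub>Z\<^esub> S x" "(1 - t) \<odot>\<^bsub>Z\<^esub> T x"] x t m Z by (simp add: Z.norm_smult)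
    also have "\<dots> \<le> t * (l * vnorm Z x) + (1 - t) * (l * vnorm Z x)"
      using ideal_ball_bound[OF Z S x] ideal_ball_bound[OF Z T x] t
      by (intro add_mono mult_left_mono) auto
    also have "\<dots> = l * vnorm Z x"
      by (simp add: algebra_simps)
    finally show "vnorm Z ((\<lambda>x\<in>carrier Z. t \<odot>\<^bsub>Z\<^esub> S x \<oplus>\<^bsub>Z\<^esub> (1 - t) \<odot>\<^bsub>Z\<^esub> T x) x) \<le> l * vnorm Z x"
      using x by simp
  qed
  then show ?thesis
    using ideal_ops_lincomb[OF A Z Z ideal_ballD(1)[OF S] ideal_ballD(1)[OF T]]
    by (simp add: ideal_ball_def)
qed

text \<open>
  This is \<open>T\<^sup>* f - f\<close>.
\<close>

definition defect :: "'a nspace \<Rightarrow> ('a \<Rightarrow> 'a) \<Rightarrow> ('a \<Rightarrow> real) \<Rightarrow> 'a \<Rightarrow> real" where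
  "defect Z T f = (\<lambda>x\<in>carrier Z. f (T x) - f x)"

lemma defect_apply: "x \<in> carrier Z \<Longrightarrow> defect Z T f x = f (T x) - f x"
  by (simp add: defect_def)

definition approx_on_points :: "'u ideal \<Rightarrow> real \<Rightarrow> 'a nspace \<Rightarrow> bool" where
  "approx_on_points A l Z \<longleftrightarrow> (\<forall>F e. finite F \<and> F \<subseteq> carrier Z \<and> 0 < e \<longrightarrow>
     (\<exists>T\<in>ideal_ball A l Z. \<forall>x\<in>F. vnorm Z (T x \<oplus>\<^bsub>Z\<^esub> (-1) \<odot>\<^bsub>Z\<^esub> x) < e))"

definition approx_on_functionals :: "'u ideal \<Rightarrow> real \<Rightarrow> 'a nspace \<Rightarrow> bool" where
  "approx_on_functionals A l Z \<longleftrightarrow>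
     (\<forall>F e. finite F \<and> F \<subseteq> bounded_ops Z real_space \<and> 0 < e \<longrightarrow>
       (\<exists>T\<in>ideal_ball A l Z. \<forall>f\<in>F. opnorm Z real_space (defect Z T f) < e))"

lemma has_BAP_iff:
  assumes Z: "normed_space Z"
  shows "has_BAP A Z \<longleftrightarrow> (\<exists>l\<ge>1. approx_on_points A l Z)"
proof -
  have "(\<lambda>x\<in>carrier Z. x) \<in> tau_c Z Z closure_of ideal_ball A l Z \<longleftrightarrow> approx_on_points A l Z"
    if "l \<ge> 1" for l
    unfolding approx_on_points_def
    by (rule id_in_tau_c_closure_iff[OF Z, where l = l])
      (use that ideal_ballD(2) ideal_ball_bound[OF Z] in auto)
  then show ?thesis
    unfolding has_BAP_def by blast
qed

lemma compose_minus_eq: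
  "compose (carrier Z) f T \<oplus>\<^bsub>dual Z\<^esub> (-1) \<odot>\<^bsub>dual Z\<^esub> f = defect Z T f"
  by (auto simp: compose_def defect_def)

text \<open>
  Through the isometry \<open>J\<close> an operator of the conjugate ball is the adjoint of an operator \<open>T\<close>, and
  the distance of its value from the argument \<open>y\<close> is the norm of the defect of \<open>T\<close> at \<open>J y\<close>.
\<close>

lemma has_BAP_conj_iff:
  assumes Z: "normed_space Z" and Y: "normed_space Y" and J: "isometric_iso Y (dual Z) J"
  shows "has_BAP_conj A Z Y J \<longleftrightarrow> (\<exists>l\<ge>1. approx_on_functionals A l Z)"
proof -
  note JD = isometric_isoD[OF J, unfolded carrier_dual]
  let ?K = "inv_into (carrier Y) J"
  have dZ: "normed_space (dual Z)"
    using Z by simp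
  have K: "(\<lambda>f\<in>carrier (dual Z). ?K f) \<in> bounded_ops (dual Z) Y"
    by (rule isometric_isoD(1)[OF isometric_iso_inverse[OF Y dZ J]])
  have dist: "vnorm Y (S y \<oplus>\<^bsub>Y\<^esub> (-1) \<odot>\<^bsub>Y\<^esub> y) = opnorm Z real_space (defect Z T (J y))"
    if "S y \<in> carrier Y" "y \<in> carrier Y" "J (S y) = adjoint Z Z T (J y)" for S T y
  proof -
    have "vnorm Y (S y \<oplus>\<^bsub>Y\<^esub> (-1) \<odot>\<^bsub>Y\<^esub> y) = vnorm (dual Z) (J (S y \<oplus>\<^bsub>Y\<^esub> (-1) \<odot>\<^bsub>Y\<^esub> y))"
      using JD(6) that Y by simp
    also have "J (S y \<oplus>\<^bsub>Y\<^esub> (-1) \<odot>\<^bsub>Y\<^esub> y) = J (S y) \<oplus>\<^bsub>dual Z\<^esub> (-1) \<odot>\<^bsub>dual Z\<^esub> J y"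
      by (rule bounded_ops_diff[OF Y JD(1)]) (use that in auto)
    also have "J (S y) = compose (carrier Z) (J y) T"
      using that(3) JD(2)[OF that(2)] by (simp add: adjoint_apply)
    finally show ?thesis
      by (simp only: compose_minus_eq op_space_simps(5))
  qed
  have "(\<lambda>y\<in>carrier Y. y) \<in> tau_c Y Y closure_of conj_ball A l Z Y J \<longleftrightarrow> approx_on_functionals A l Z"
    if l: "l \<ge> 1" for l
  proof -
    let ?C = "conj_ball A l Z Y J"
    have bound: "vnorm Y (S y) \<le> l * vnorm Y y" if S: "S \<in> ?C" and y: "y \<in> carrier Y" for S y
    proof -
      obtain T where T: "S \<in> bounded_ops Y Y" "T \<in> ideal_ball A l Z" "J (S y) = adjoint Z Z T (J y)"
        using S y by (auto simp: conj_ball_def)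
      have "vnorm Y (S y) = opnorm Z real_space (compose (carrier Z) (J y) T)"
        using JD(6)[of "S y"] JD(2)[OF y] bounded_ops_mem[OF T(1) y] T(3) by (simp add: adjoint_apply)
      also have "\<dots> \<le> opnorm Z Z T * opnorm Z real_space (J y)"
        by (rule opnorm_compose_dual_le[OF Z Z ideal_ballD(2)[OF T(2)] JD(2)[OF y]])
      also have "\<dots> \<le> l * opnorm Z real_space (J y)"
        by (intro mult_right_mono ideal_ballD(3)[OF T(2)] dual_opnorm_nonneg[OF Z JD(2)[OF y]])
      finally show ?thesis
        using JD(6)[OF y] by simp
    qed
    have "(\<lambda>y\<in>carrier Y. y) \<in> tau_c Y Y closure_of ?C \<longleftrightarrow>
      (\<forall>F e. finite F \<and> F \<subseteq> carrier Y \<and> 0 < e \<longrightarrow>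
        (\<exists>S\<in>?C. \<forall>y\<in>F. vnorm Y (S y \<oplus>\<^bsub>Y\<^esub> (-1) \<odot>\<^bsub>Y\<^esub> y) < e))"
      by (rule id_in_tau_c_closure_iff[OF Y, where l = l]) (use l bound in \<open>auto simp: conj_ball_def\<close>)
    also have "\<dots> \<longleftrightarrow> approx_on_functionals A l Z"
    proof
      assume L: "\<forall>F e. finite F \<and> F \<subseteq> carrier Y \<and> 0 < e \<longrightarrow>
        (\<exists>S\<in>?C. \<forall>y\<in>F. vnorm Y (S y \<oplus>\<^bsub>Y\<^esub> (-1) \<odot>\<^bsub>Y\<^esub> y) < e)"
      show "approx_on_functionals A l Z"
        unfolding approx_on_functionals_def
      proof (intro allI impI, elim conjE)
        fix F and e :: real assume F: "finite F" "F \<subseteq> bounded_ops Z real_space" and e: "0 < e"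
        have "finite (?K ` F)" "?K ` F \<subseteq> carrier Y"
          using F JD(5) by auto
        then obtain S where S: "S \<in> ?C" "\<forall>y\<in>?K ` F. vnorm Y (S y \<oplus>\<^bsub>Y\<^esub> (-1) \<odot>\<^bsub>Y\<^esub> y) < e"
          using L e by meson
        then obtain T where T: "S \<in> bounded_ops Y Y" "T \<in> ideal_ball A l Z"
          "\<And>y. y \<in> carrier Y \<Longrightarrow> J (S y) = adjoint Z Z T (J y)"
          by (auto simp: conj_ball_def)
        have "opnorm Z real_space (defect Z T f) < e" if f: "f \<in> F" for f
        proof -
          have c: "?K f \<in> carrier Y" "J (?K f) = f"
            using JD(4,5) F f by auto
          show ?thesis
            using S(2) f dist[where S = S and T = T and y = "?K f"] bounded_ops_mem[OF T(1) c(1)] c(1) T(3)[OF c(1)] c(2)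
            by auto
        qed
        then show "\<exists>T\<in>ideal_ball A l Z. \<forall>f\<in>F. opnorm Z real_space (defect Z T f) < e"
          using T(2) by blast
      qed
    next
      assume R: "approx_on_functionals A l Z"
      show "\<forall>F e. finite F \<and> F \<subseteq> carrier Y \<and> 0 < e \<longrightarrow>
        (\<exists>S\<in>?C. \<forall>y\<in>F. vnorm Y (S y \<oplus>\<^bsub>Y\<^esub> (-1) \<odot>\<^bsub>Y\<^esub> y) < e)"
      proof (intro allI impI, elim conjE)
        fix F and e :: real assume F: "finite F" "F \<subseteq> carrier Y" and e: "0 < e"
        have "finite (J ` F)" "J ` F \<subseteq> bounded_ops Z real_space"
          using F JD(2) by auto
        then obtain T where T: "T \<in> ideal_ball A l Z"
          "\<forall>f\<in>J ` F. opnorm Z real_space (defect Z T f) < e"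
          using R e unfolding approx_on_functionals_def by meson
        let ?S = "compose (carrier Y) (\<lambda>f\<in>carrier (dual Z). ?K f) (compose (carrier Y) (adjoint Z Z T) J)"
        have adj: "adjoint Z Z T \<in> bounded_ops (dual Z) (dual Z)"
          by (rule adjoint_bounded_ops[OF Z Z ideal_ballD(2)[OF T(1)]])
        have S: "?S \<in> bounded_ops Y Y"
          by (intro compose_bounded_ops[OF Y dZ Y _ K] compose_bounded_ops[OF Y dZ dZ JD(1) adj])
        have eq: "J (?S y) = adjoint Z Z T (J y)" if "y \<in> carrier Y" for y
        proof -
          have "adjoint Z Z T (J y) \<in> bounded_ops Z real_space"
            using bounded_ops_mem[OF adj, of "J y"] JD(2)[OF that] by simp
          then show ?thesis
            using that JD(4) by (simp add: compose_eq)
        qed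
        then have "?S \<in> ?C"
          using S T(1) unfolding conj_ball_def by blast
        moreover have "vnorm Y (?S y \<oplus>\<^bsub>Y\<^esub> (-1) \<odot>\<^bsub>Y\<^esub> y) < e" if "y \<in> F" for y
          using dist[where S = ?S and T = T and y = y] bounded_ops_mem[OF S, of y] eq[of y] that F T(2)
          by auto
        ultimately show "\<exists>S\<in>?C. \<forall>y\<in>F. vnorm Y (S y \<oplus>\<^bsub>Y\<^esub> (-1) \<odot>\<^bsub>Y\<^esub> y) < e"
          by blast
      qed
    qed
    finally show ?thesis .
  qed
  then show ?thesis
    unfolding has_BAP_conj_def by blast
qed

section \<open>From the dual space to the space\<close>

lemma defect_dual:
  assumes Z: "normed_space Z" and T: "T \<in> bounded_ops Z Z" and f: "f \<in> bounded_ops Z real_space"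
  shows "defect Z T f \<in> bounded_ops Z real_space"
proof -
  have "compose (carrier Z) f T \<oplus>\<^bsub>dual Z\<^esub> (-1) \<odot>\<^bsub>dual Z\<^esub> f \<in> carrier (dual Z)"
    using normed_space.add_mem normed_space.smult_mem compose_dual[OF Z Z T f] f Z
    by (metis carrier_dual normed_space_op_space normed_space_real_space)
  then show ?thesis
    by (simp only: compose_minus_eq carrier_dual)
qed

lemma mult_fraction_less:
  fixes d s :: real
  assumes "0 \<le> s" "0 < d"
  shows "d * (s / (1 + s)) < d"
  using assms mult_strict_left_mono[of "s / (1 + s)" 1 d] by simp

text \<open>
  From \<open>f (T x) - f x = (T\<^sup>* f - f) x\<close>, norm approximation on functionals is weak approximation on
  points.
\<close>

lemma approx_on_points_if_functionals:
  assumes A: "operator_ideal A" and Z: "normed_space Z" and l: "1 \<le> l"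
    and approx: "approx_on_functionals A l Z"
  shows "approx_on_points A l Z"
  unfolding approx_on_points_def
proof (intro allI impI, elim conjE)
  fix F and e :: real assume F: "finite F" "F \<subseteq> carrier Z" and e: "0 < e"
  show "\<exists>T\<in>ideal_ball A l Z. \<forall>x\<in>F. vnorm Z (T x \<oplus>\<^bsub>Z\<^esub> (-1) \<odot>\<^bsub>Z\<^esub> x) < e"
  proof (rule weak_approximation_imp_norm_approximation[OF Z F(1) _ _ _ _ e])
    fix T x assume T: "T \<in> ideal_ball A l Z" and "x \<in> F"
    then show "T x \<in> carrier Z"
      using F(2) bounded_ops_mem[OF ideal_ballD(2)[OF T], of x] by blast
  next
    fix S T t assume "S \<in> ideal_ball A l Z" "T \<in> ideal_ball A l Z" "0 \<le> t" "t \<le> (1::real)"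
    then have "(\<lambda>x\<in>carrier Z. t \<odot>\<^bsub>Z\<^esub> S x \<oplus>\<^bsub>Z\<^esub> (1 - t) \<odot>\<^bsub>Z\<^esub> T x) \<in> ideal_ball A l Z"
      using ideal_ball_convex[OF A Z] l by simp
    then show "\<exists>R\<in>ideal_ball A l Z. \<forall>x\<in>F. R x = t \<odot>\<^bsub>Z\<^esub> S x \<oplus>\<^bsub>Z\<^esub> (1 - t) \<odot>\<^bsub>Z\<^esub> T x"
      by (rule bexI[rotated]) (use F(2) in auto)
  next
    fix \<phi> :: "'b \<Rightarrow> 'b \<Rightarrow> real" and d :: real
    assume \<phi>: "\<And>x. x \<in> F \<Longrightarrow> \<phi> x \<in> bounded_ops Z real_space" and d: "0 < d"
    let ?s = "\<Sum>x\<in>F. vnorm Z x"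
    have s: "0 \<le> ?s"
      using F(2) Z by (intro sum_nonneg) auto
    have "finite (\<phi> ` F)" "\<phi> ` F \<subseteq> bounded_ops Z real_space" "0 < d / (1 + ?s)"
      using F \<phi> d s by auto
    then obtain T where T: "T \<in> ideal_ball A l Z"
      "\<forall>f\<in>\<phi> ` F. opnorm Z real_space (defect Z T f) < d / (1 + ?s)"
      using approx unfolding approx_on_functionals_def by meson
    have "\<bar>(\<Sum>x\<in>F. \<phi> x (T x)) - (\<Sum>x\<in>F. \<phi> x x)\<bar> \<le> (\<Sum>x\<in>F. \<bar>\<phi> x (T x) - \<phi> x x\<bar>)"
      by (simp add: sum_subtractf[symmetric])
    also have "\<dots> \<le> (\<Sum>x\<in>F. d / (1 + ?s) * vnorm Z x)"
    proof (rule sum_mono)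
      fix x assume x: "x \<in> F"
      have xc: "x \<in> carrier Z"
        using x F(2) by blast
      have "\<bar>\<phi> x (T x) - \<phi> x x\<bar> \<le> opnorm Z real_space (defect Z T (\<phi> x)) * vnorm Z x"
        using dual_bound[OF Z defect_dual[OF Z ideal_ballD(2)[OF T(1)] \<phi>[OF x]] xc] xc by (simp add: defect_apply)
      also have "\<dots> \<le> d / (1 + ?s) * vnorm Z x"
        using T(2) x xc Z by (intro mult_right_mono) (auto intro: less_imp_le)
      finally show "\<bar>\<phi> x (T x) - \<phi> x x\<bar> \<le> d / (1 + ?s) * vnorm Z x" .
    qed
    also have "\<dots> = d * (?s / (1 + ?s))"
      by (subst sum_distrib_left[symmetric]) simp
    also have "\<dots> < d"
      by (rule mult_fraction_less[OF s d])
    finally show "\<exists>T\<in>ideal_ball A l Z. \<bar>(\<Sum>x\<in>F. \<phi> x (T x)) - (\<Sum>x\<in>F. \<phi> x x)\<bar> < d"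
      using T(1) by blast
  qed (use F(2) in auto)
qed

text \<open>
  The pairs \<open>(g, z)\<close> in \<open>ps\<close> stand for the finite-rank operator \<open>P x = (\<Sum>(g, z). g x z)\<close> on \<open>Z\<close>. Its
  value is described through the functionals, which avoids finite sums in \<open>Z\<close>; here \<open>y = w - P w\<close>.
\<close>

lemma residual_point:
  assumes Z: "normed_space Z" and w: "w \<in> carrier Z"
  shows "set ps \<subseteq> bounded_ops Z real_space \<times> carrier Z \<Longrightarrow>
    \<exists>y\<in>carrier Z. \<forall>f\<in>bounded_ops Z real_space. f y = f w - (\<Sum>(g, z)\<leftarrow>ps. f z * g w)"
proof (induction ps)
  case (Cons p ps)
  obtain g z where p: "p = (g, z)" by (cases p)
  obtain y where y: "y \<in> carrier Z"
    "\<forall>f\<in>bounded_ops Z real_space. f y = f w - (\<Sum>(g, z)\<leftarrow>ps. f z * g w)"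
    using Cons by auto
  show ?case
    by (rule bexI[of _ "y \<oplus>\<^bsub>Z\<^esub> (- g w) \<odot>\<^bsub>Z\<^esub> z"])
      (use Cons.prems p y Z in \<open>auto simp: dual_add dual_smult\<close>)
qed (use w in auto)

text \<open>
  The dual counterpart: \<open>u = h - P\<^sup>* h\<close>.
\<close>

lemma residual_functional:
  assumes Z: "normed_space Z" and h: "h \<in> bounded_ops Z real_space"
  shows "set ps \<subseteq> bounded_ops Z real_space \<times> carrier Z \<Longrightarrow>
    \<exists>u\<in>bounded_ops Z real_space. \<forall>x\<in>carrier Z. u x = h x - (\<Sum>(g, z)\<leftarrow>ps. h z * g x)"
proof (induction ps)
  case (Cons p ps)
  obtain g z where p: "p = (g, z)" by (cases p)
  have g: "g \<in> bounded_ops Z real_space"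
    using Cons.prems p by simp
  obtain u where u: "u \<in> bounded_ops Z real_space"
    "\<forall>x\<in>carrier Z. u x = h x - (\<Sum>(g, z)\<leftarrow>ps. h z * g x)"
    using Cons by auto
  show ?case
  proof (rule bexI)
    show "(\<lambda>x\<in>carrier Z. u x \<oplus>\<^bsub>real_space\<^esub> (\<lambda>x\<in>carrier Z. (- h z) \<odot>\<^bsub>real_space\<^esub> g x) x) \<in> bounded_ops Z real_space"
      by (intro add_bounded_ops smult_bounded_ops Z normed_space_real_space u(1) g)
  qed (use p u in auto)
qed (use h in auto)

text \<open>
  A finite-rank operator \<open>P\<close> with \<open>P\<^sup>* f = f\<close> for finitely many given \<open>f\<close>. When a functional \<open>h\<close> with
  \<open>u = h - P\<^sup>* h \<noteq> 0\<close> is added to the list, pick \<open>w\<close> with \<open>u w = 1\<close> and add to \<open>P\<close> the operator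
  \<open>x \<mapsto> u x y\<close> with \<open>y = w - P w\<close>. The functionals fixed by \<open>P\<^sup>*\<close> vanish at \<open>y\<close> and stay fixed, and
  \<open>h y = u w = 1\<close>, so \<open>h\<close> becomes fixed.
\<close>

lemma finite_rank_fixing_functionals:
  assumes Z: "normed_space Z" and "finite B" "B \<subseteq> bounded_ops Z real_space"
  shows "\<exists>ps. set ps \<subseteq> bounded_ops Z real_space \<times> carrier Z \<and>
    (\<forall>f\<in>B. \<forall>x\<in>carrier Z. f x = (\<Sum>(g, z)\<leftarrow>ps. f z * g x))"
  using assms(2,3)
proof (induction B rule: finite_induct)
  case empty
  show ?case
    by (intro exI[of _ "[]"]) auto
next
  case (insert h B)
  then obtain ps where ps: "set ps \<subseteq> bounded_ops Z real_space \<times> carrier Z"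
    "\<forall>f\<in>B. \<forall>x\<in>carrier Z. f x = (\<Sum>(g, z)\<leftarrow>ps. f z * g x)"
    by auto
  have h: "h \<in> bounded_ops Z real_space"
    using insert.prems by blast
  obtain u where u: "u \<in> bounded_ops Z real_space"
    "\<forall>x\<in>carrier Z. u x = h x - (\<Sum>(g, z)\<leftarrow>ps. h z * g x)"
    using residual_functional[OF Z h ps(1)] by blast
  show ?case
  proof (cases "\<forall>x\<in>carrier Z. u x = 0")
    case True
    then show ?thesis
      using ps u(2) by (intro exI[of _ ps]) auto
  next
    case False
    then obtain w0 where w0: "w0 \<in> carrier Z" "u w0 \<noteq> 0" by blast
    define w where "w = (1 / u w0) \<odot>\<^bsub>Z\<^esub> w0"
    have w: "w \<in> carrier Z" "u w = 1"
      using w0 Z by (auto simp: w_def dual_smult[OF u(1)])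
    obtain y where y: "y \<in> carrier Z"
      "\<forall>f\<in>bounded_ops Z real_space. f y = f w - (\<Sum>(g, z)\<leftarrow>ps. f z * g w)"
      using residual_point[OF Z w(1) ps(1)] by blast
    have "h y = 1"
      using y(2) h u(2) w by simp
    moreover have "f y = 0" if f: "f \<in> B" for f
    proof -
      have "f y = f w - (\<Sum>(g, z)\<leftarrow>ps. f z * g w)"
        using y(2) insert.prems f by blast
      also have "(\<Sum>(g, z)\<leftarrow>ps. f z * g w) = f w"
        using ps(2) f w(1) by simp
      finally show ?thesis by simp
    qed
    ultimately show ?thesis
      using ps u y(1) by (intro exI[of _ "(u, y) # ps"]) auto
  qed
qed

text \<open>
  With \<open>P\<close> as above, \<open>R = S + (P - P S)\<close>. The added operator sends \<open>x\<close> to the sum of the points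
  \<open>(g - S\<^sup>* g) x z\<close>, so it is small when \<open>S\<^sup>*\<close> nearly fixes the functionals \<open>g\<close>, and
  \<open>R\<^sup>* f = S\<^sup>* f + (f - S\<^sup>* f) = f\<close> whenever \<open>P\<^sup>* f = f\<close>.
\<close>

lemma finite_rank_perturbation:
  fixes A :: "'u ideal"
  assumes A: "operator_ideal A" and Z: "normed_space Z" and S: "S \<in> ideal_ops A Z Z"
    and l: "\<And>x. x \<in> carrier Z \<Longrightarrow> vnorm Z (S x) \<le> l * vnorm Z x"
  shows "set ps \<subseteq> bounded_ops Z real_space \<times> carrier Z \<Longrightarrow>
    \<exists>R\<in>ideal_ops A Z Z.
      (\<forall>f\<in>bounded_ops Z real_space. \<forall>x\<in>carrier Z.
         f (R x) = f (S x) + (\<Sum>(g, z)\<leftarrow>ps. f z * (g x - g (S x)))) \<and>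
      (\<forall>x\<in>carrier Z. vnorm Z (R x) \<le>
         (l + (\<Sum>(g, z)\<leftarrow>ps. opnorm Z real_space (defect Z S g) * vnorm Z z)) * vnorm Z x)"
    (is "_ \<Longrightarrow> \<exists>R\<in>_. ?eq ps R \<and> ?le ps R")
proof (induction ps)
  case Nil
  show ?case
    by (rule bexI[OF _ S]) (use l in auto)
next
  case (Cons p ps)
  interpret Z: normed_space Z by fact
  obtain g z where p: "p = (g, z)" by (cases p)
  have g: "g \<in> bounded_ops Z real_space" and z: "z \<in> carrier Z"
    using Cons.prems p by auto
  have prems: "set ps \<subseteq> bounded_ops Z real_space \<times> carrier Z"
    using Cons.prems by simp
  obtain R where R: "R \<in> ideal_ops A Z Z"
    and R_eq: "?eq ps R" and R_le: "?le ps R"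
    using Cons.IH[OF prems] by (elim bexE conjE)
  note Sb = ideal_ops_bounded[OF S] and Rb = ideal_ops_bounded[OF R]
  obtain V W :: "'u nspace" and i j where V: "banach_space V" "isometric_iso Z V i"
    "banach_space W" "isometric_iso Z W j"
    using S by (rule ideal_opsE) blast
  define d where "d = defect Z S g"
  have d: "d \<in> bounded_ops Z real_space"
    unfolding d_def by (rule defect_dual[OF Z Sb g])
  define D where "D = (\<lambda>x\<in>carrier Z. d x \<odot>\<^bsub>Z\<^esub> z)"
  have D: "D \<in> ideal_ops A Z Z"
    unfolding D_def by (rule ideal_ops_rank_one[OF A Z Z V d z])
  define Q where "Q = (\<lambda>x\<in>carrier Z. 1 \<odot>\<^bsub>Z\<^esub> R x \<oplus>\<^bsub>Z\<^esub> (-1) \<odot>\<^bsub>Z\<^esub> D x)"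
  have Q: "Q \<in> ideal_ops A Z Z"
    unfolding Q_def by (rule ideal_ops_lincomb[OF A Z Z R D])
  have Q_x: "Q x = R x \<oplus>\<^bsub>Z\<^esub> (- d x) \<odot>\<^bsub>Z\<^esub> z" if "x \<in> carrier Z" for x
    using that z Z bounded_ops_mem[OF Rb] by (simp add: Q_def D_def)
  show ?case
  proof (rule bexI[OF _ Q], intro conjI ballI)
    fix f x assume f: "f \<in> bounded_ops Z real_space" and x: "x \<in> carrier Z"
    have "f (Q x) = f (R x) + (- d x) * f z"
      using x z Z bounded_ops_mem[OF Rb x] by (simp add: Q_x dual_add[OF f] dual_smult[OF f])
    then have "f (Q x) = f (R x) + f z * (g x - g (S x))"
      using x by (simp add: d_def defect_apply algebra_simps)
    then show "f (Q x) = f (S x) + (\<Sum>(g, z)\<leftarrow>p # ps. f z * (g x - g (S x)))"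
      using R_eq[rule_format, OF f x] by (simp add: p)
  next
    fix x assume x: "x \<in> carrier Z"
    have "vnorm Z (Q x) \<le> vnorm Z (R x) + \<bar>d x\<bar> * vnorm Z z"
      using Z.norm_triangle[of "R x" "(- d x) \<odot>\<^bsub>Z\<^esub> z"] x z Z bounded_ops_mem[OF Rb x]
      by (simp add: Q_x Z.norm_smult)
    also have "\<bar>d x\<bar> * vnorm Z z \<le> (opnorm Z real_space d * vnorm Z x) * vnorm Z z"
      using dual_bound[OF Z d x] z Z by (intro mult_right_mono) auto
    finally show "vnorm Z (Q x) \<le>
         (l + (\<Sum>(g, z)\<leftarrow>p # ps. opnorm Z real_space (defect Z S g) * vnorm Z z)) * vnorm Z x"
      using R_le[rule_format, OF x] by (simp add: p d_def[symmetric] distrib_left mult_ac)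
  qed
qed

lemma opnorm_adjoint_le:
  assumes V: "normed_space V" and W: "normed_space W" and T: "T \<in> bounded_ops V W"
  shows "opnorm (dual W) (dual V) (adjoint V W T) \<le> opnorm V W T"
  by (rule opnorm_le)
    (use assms opnorm_nonneg[OF assms] opnorm_compose_dual_le[OF assms] in \<open>auto simp: adjoint_apply\<close>)

lemma linspan_least: "submodule H real_ring V \<Longrightarrow> B \<subseteq> H \<Longrightarrow> linspan V B \<subseteq> H"
  unfolding linspan_def by blast

lemma linspan_superset: "B \<subseteq> linspan V B"
  unfolding linspan_def by blast

lemma linspan_subset_carrier: "normed_space V \<Longrightarrow> B \<subseteq> carrier V \<Longrightarrow> linspan V B \<subseteq> carrier V"
  by (rule linspan_least) (simp_all add: normed_space.submodule_realI)

context
  fixes A :: "'u ideal" and Z :: "'a nspace"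
  assumes A: "operator_ideal A" and Z: "normed_space Z" and large: "fits TYPE('u) (bidual Z)"
    and into: "\<And>Z T. \<lbrakk>banach_space Z; fits TYPE('u) (bidual Z); T \<in> A Z Z\<rbrakk>
               \<Longrightarrow> biadjoint_into_space A Z T"
begin

text \<open>
  The operator required by local reflexivity is \<open>R\<^sup>*\<^sup>*\<close> for the perturbed operator \<open>R\<close>; it does not
  depend on \<open>E\<close>, since it maps the whole bidual into \<open>Z\<close>.
\<close>

theorem approx_on_functionals_imp_reflexive:
  assumes l: "1 \<le> l" and approx: "approx_on_functionals A l Z"
  shows "strongly_ext_loc_reflexive Z"
  unfolding strongly_ext_loc_reflexive_def
proof (intro exI[of _ l] conjI l allI impI)
  fix E F and e :: real
  assume "fin_dim_subspace (bidual Z) E \<and> fin_dim_subspace (dual Z) F" and e: "0 < e"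
  then obtain B where E: "E \<subseteq> bounded_ops (dual Z) real_space"
    and B: "finite B" "B \<subseteq> bounded_ops Z real_space" and F: "F = linspan (dual Z) B"
    using linspan_subset_carrier[of "bidual Z"] Z
    unfolding fin_dim_subspace_def carrier_dual by auto
  have dZ: "normed_space (dual Z)" and bZ: "normed_space (bidual Z)"
    using Z by auto
  obtain ps where ps: "set ps \<subseteq> bounded_ops Z real_space \<times> carrier Z"
    and fixed: "\<forall>f\<in>B. \<forall>x\<in>carrier Z. f x = (\<Sum>(g, z)\<leftarrow>ps. f z * g x)"
    using finite_rank_fixing_functionals[OF Z B] by blast
  let ?s = "\<Sum>(g, z)\<leftarrow>ps. vnorm Z z"
  have s: "0 \<le> ?s"
    using ps Z by (intro sum_list_nonneg) auto
  \<comment> \<open>The total cost of the perturbation is below \<open>e\<close> if each defect is below \<open>e / (1 + ?s)\<close>;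
    the summand \<open>1\<close> covers the case \<open>?s = 0\<close>.\<close>
  have "finite (fst ` set ps)" "fst ` set ps \<subseteq> bounded_ops Z real_space" "0 < e / (1 + ?s)"
    using ps s e by auto
  then obtain S where S: "S \<in> ideal_ball A l Z"
    "\<forall>g\<in>fst ` set ps. opnorm Z real_space (defect Z S g) < e / (1 + ?s)"
    using approx unfolding approx_on_functionals_def by meson
  obtain R where R: "R \<in> ideal_ops A Z Z"
    and R_eq: "\<forall>f\<in>bounded_ops Z real_space. \<forall>x\<in>carrier Z.
         f (R x) = f (S x) + (\<Sum>(g, z)\<leftarrow>ps. f z * (g x - g (S x)))"
    and R_le: "\<forall>x\<in>carrier Z. vnorm Z (R x) \<le>
         (l + (\<Sum>(g, z)\<leftarrow>ps. opnorm Z real_space (defect Z S g) * vnorm Z z)) * vnorm Z x"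
    using finite_rank_perturbation[OF A Z ideal_ballD(1)[OF S(1)] ideal_ball_bound[OF Z S(1)] ps] by blast
  note Rb = ideal_ops_bounded[OF R]
  have "(\<Sum>(g, z)\<leftarrow>ps. opnorm Z real_space (defect Z S g) * vnorm Z z)
    \<le> (\<Sum>(g, z)\<leftarrow>ps. e / (1 + ?s) * vnorm Z z)"
  proof (rule sum_list_mono)
    fix p assume p: "p \<in> set ps"
    obtain g z where gz: "p = (g, z)" by (cases p)
    have "z \<in> carrier Z" "opnorm Z real_space (defect Z S g) < e / (1 + ?s)"
      using S(2) ps p gz by force+
    then show "(case p of (g, z) \<Rightarrow> opnorm Z real_space (defect Z S g) * vnorm Z z)
      \<le> (case p of (g, z) \<Rightarrow> e / (1 + ?s) * vnorm Z z)"
      using Z unfolding gz prod.case by (intro mult_right_mono) auto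
  qed
  also have "\<dots> = e / (1 + ?s) * ?s"
    unfolding split_def by (rule sum_list_const_mult)
  also have "\<dots> = e * (?s / (1 + ?s))"
    by simp
  also have "\<dots> \<le> e"
    using mult_fraction_less[OF s e] by simp
  finally have "vnorm Z (R x) \<le> (l + e) * vnorm Z x" if "x \<in> carrier Z" for x
    using R_le that Z by (meson add_left_mono mult_right_mono normed_space.norm_nonneg order_trans)
  then have R_norm: "opnorm Z Z R \<le> l + e"
    using l e by (intro opnorm_le[OF Z Z]) auto
  have F_fixed: "F \<subseteq> {f \<in> bounded_ops Z real_space. \<forall>x\<in>carrier Z. f x = (\<Sum>(g, z)\<leftarrow>ps. f z * g x)}"
    (is "_ \<subseteq> ?H")
    unfolding F
  proof (rule linspan_least)
    have zs: "z \<in> carrier Z" if "(g, z) \<in> set ps" for g z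
      using ps that by auto
    show "submodule ?H real_ring (dual Z)"
    proof (rule normed_space.submodule_realI[OF dZ])
      show "\<zero>\<^bsub>dual Z\<^esub> \<in> ?H"
      proof (intro CollectI conjI ballI)
        fix x assume x: "x \<in> carrier Z"
        have "(\<Sum>(g, z)\<leftarrow>ps. \<zero>\<^bsub>dual Z\<^esub> z * g x) = (\<Sum>(g, z)\<leftarrow>ps. 0)"
          using zs by (intro arg_cong[of _ _ sum_list] map_cong) auto
        also have "\<dots> = 0"
          by (simp add: split_def)
        finally show "\<zero>\<^bsub>dual Z\<^esub> x = (\<Sum>(g, z)\<leftarrow>ps. \<zero>\<^bsub>dual Z\<^esub> z * g x)"
          using x by simp
      qed (use normed_space.zero_mem[OF dZ] in simp)
      fix f f' assume f: "f \<in> ?H" and f': "f' \<in> ?H"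
      have "(\<Sum>(g, z)\<leftarrow>ps. (f \<oplus>\<^bsub>dual Z\<^esub> f') z * g x) = (\<Sum>(g, z)\<leftarrow>ps. f z * g x + f' z * g x)" for x
        using zs by (intro arg_cong[of _ _ sum_list] map_cong) (auto simp: distrib_right)
      then show "f \<oplus>\<^bsub>dual Z\<^esub> f' \<in> ?H"
        using f f' normed_space.add_mem[OF dZ, of f f'] by (auto simp: split_def sum_list_addf)
    next
      fix a f assume f: "f \<in> ?H"
      have "(\<Sum>(g, z)\<leftarrow>ps. (a \<odot>\<^bsub>dual Z\<^esub> f) z * g x) = (\<Sum>(g, z)\<leftarrow>ps. a * (f z * g x))" for x
        using zs by (intro arg_cong[of _ _ sum_list] map_cong) auto
      then show "a \<odot>\<^bsub>dual Z\<^esub> f \<in> ?H"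
        using f normed_space.smult_mem[OF dZ, of f a] by (auto simp: split_def sum_list_const_mult)
    qed auto
  qed (use B fixed in auto)
  have F_R: "compose (carrier Z) f R = f" if f: "f \<in> F" for f
  proof (rule extensionalityI[of _ "carrier Z"])
    have fH: "f \<in> bounded_ops Z real_space" "\<forall>x\<in>carrier Z. f x = (\<Sum>(g, z)\<leftarrow>ps. f z * g x)"
      using f F_fixed by auto
    show "f \<in> extensional (carrier Z)"
      using fH(1) by (rule bounded_ops_ext)
    fix x assume x: "x \<in> carrier Z"
    have Sx: "S x \<in> carrier Z"
      by (rule bounded_ops_mem[OF ideal_ballD(2)[OF S(1)] x])
    have "(\<Sum>(g, z)\<leftarrow>ps. f z * (g x - g (S x))) = f x - f (S x)"
      using fH(2)[rule_format, OF x] fH(2)[rule_format, OF Sx]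
      by (simp add: split_def right_diff_distrib sum_list_subtractf)
    then show "compose (carrier Z) f R x = f x"
      using R_eq[rule_format, OF fH(1) x] x by (simp add: compose_eq)
  qed simp
  obtain U where U: "U \<in> ideal_ops A (bidual Z) Z"
    and U_eq: "\<And>\<phi> f. \<lbrakk>\<phi> \<in> bounded_ops (dual Z) real_space; f \<in> bounded_ops Z real_space\<rbrakk> \<Longrightarrow>
      f (U \<phi>) = \<phi> (compose (carrier Z) f R)"
    using biadjoint_factor[OF A Z large into R] by blast
  let ?T = "biadjoint Z Z R"
  have adj: "adjoint Z Z R \<in> bounded_ops (dual Z) (dual Z)"
    by (rule adjoint_bounded_ops[OF Z Z Rb])
  have T: "?T \<in> bounded_ops (bidual Z) (bidual Z)"
    by (rule adjoint_bounded_ops[OF dZ dZ adj])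
  have T_apply: "?T \<phi> f = \<phi> (compose (carrier Z) f R)"
    if "\<phi> \<in> bounded_ops (dual Z) real_space" "f \<in> bounded_ops Z real_space" for \<phi> f
    using that by (simp add: adjoint_apply compose_eq)
  show "\<exists>T\<in>bounded_ops (bidual Z) (bidual Z).
       opnorm (bidual Z) (bidual Z) T \<le> l + e \<and>
       T ` E \<subseteq> canon Z ` carrier Z \<and>
       adjoint (bidual Z) (bidual Z) T ` (canon (dual Z) ` carrier (dual Z))
         \<subseteq> canon (dual Z) ` carrier (dual Z) \<and>
       (\<forall>\<phi>\<in>E. \<forall>f\<in>F. T \<phi> f = \<phi> f)"
  proof (intro bexI[OF _ T] conjI ballI)
    show "opnorm (bidual Z) (bidual Z) ?T \<le> l + e"
      using opnorm_adjoint_le[OF dZ dZ adj] opnorm_adjoint_le[OF Z Z Rb] R_norm by simp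
    show "?T ` E \<subseteq> canon Z ` carrier Z"
    proof
      fix \<psi> assume "\<psi> \<in> ?T ` E"
      then obtain \<phi> where \<phi>: "\<phi> \<in> bounded_ops (dual Z) real_space" "\<psi> = ?T \<phi>"
        using E by blast
      have U\<phi>: "U \<phi> \<in> carrier Z"
        using bounded_ops_mem[OF ideal_ops_bounded[OF U]] \<phi> by simp
      have "?T \<phi> = canon Z (U \<phi>)"
      proof (rule extensionalityI[of _ "bounded_ops Z real_space"])
        show "?T \<phi> \<in> extensional (bounded_ops Z real_space)"
          using bounded_ops_mem[OF T, of \<phi>] \<phi> bounded_ops_ext[of "?T \<phi>" "dual Z"] by simp
        show "canon Z (U \<phi>) \<in> extensional (bounded_ops Z real_space)"
          using U\<phi> by (simp add: canon_def)
      qed (use T_apply[OF \<phi>(1)] U_eq[OF \<phi>(1)] canon_apply[OF U\<phi>] in simp)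
      then show "\<psi> \<in> canon Z ` carrier Z"
        using U\<phi> \<phi> by blast
    qed
    show "adjoint (bidual Z) (bidual Z) ?T ` (canon (dual Z) ` carrier (dual Z))
         \<subseteq> canon (dual Z) ` carrier (dual Z)"
    proof clarify
      fix g assume g: "g \<in> carrier (dual Z)"
      let ?gR = "compose (carrier Z) g R"
      have gR: "?gR \<in> carrier (dual Z)"
        using compose_dual[OF Z Z Rb] g by simp
      have cg: "canon (dual Z) g \<in> bounded_ops (bidual Z) real_space"
        using bounded_ops_mem[OF canon_bounded_ops[OF dZ] g] by simp
      have "adjoint (bidual Z) (bidual Z) ?T (canon (dual Z) g) = canon (dual Z) ?gR"
      proof (rule extensionalityI[of _ "bounded_ops (dual Z) real_space"])
        show "adjoint (bidual Z) (bidual Z) ?T (canon (dual Z) g) \<in> extensional (bounded_ops (dual Z) real_space)"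
          using cg by (simp add: adjoint_apply)
        show "canon (dual Z) ?gR \<in> extensional (bounded_ops (dual Z) real_space)"
          using gR by (simp add: canon_def)
        fix \<phi> assume \<phi>: "\<phi> \<in> bounded_ops (dual Z) real_space"
        have "?T \<phi> \<in> bounded_ops (dual Z) real_space"
          using bounded_ops_mem[OF T, of \<phi>] \<phi> by simp
        then have "canon (dual Z) g (?T \<phi>) = \<phi> ?gR"
          using canon_apply[OF g] T_apply[OF \<phi>] g by simp
        then show "adjoint (bidual Z) (bidual Z) ?T (canon (dual Z) g) \<phi> = canon (dual Z) ?gR \<phi>"
          using \<phi> cg canon_apply[OF gR \<phi>] adjoint_apply[OF cg, of "bidual Z" ?T] by (simp add: compose_eq)
      qed
      then show "adjoint (bidual Z) (bidual Z) ?T (canon (dual Z) g) \<in> canon (dual Z) ` carrier (dual Z)"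
        using gR by blast
    qed
    fix \<phi> f assume "\<phi> \<in> E" "f \<in> F"
    then have "\<phi> \<in> bounded_ops (dual Z) real_space" "f \<in> bounded_ops Z real_space"
      using E F_fixed by auto
    then show "?T \<phi> f = \<phi> f"
      using T_apply F_R[OF \<open>f \<in> F\<close>] by simp
  qed
qed

section \<open>From the space to its dual\<close>

text \<open>
  The constant is \<open>k * (m + 1)\<close>, where \<open>k\<close> bounds the approximating operators \<open>R\<close> and \<open>m\<close> is the
  constant of local reflexivity, which is used with \<open>\<epsilon> = 1\<close>.
\<close>

theorem approx_on_points_imp_functionals:
  assumes k: "1 \<le> k" and approx: "approx_on_points A k Z"
    and refl: "strongly_ext_loc_reflexive Z"
  shows "\<exists>l\<ge>1. approx_on_functionals A l Z"
proof -
  have dZ: "normed_space (dual Z)" and bZ: "normed_space (bidual Z)"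
    using Z by auto
  obtain m where m: "1 \<le> m" and refl: "\<forall>E F. fin_dim_subspace (bidual Z) E \<and> fin_dim_subspace (dual Z) F \<longrightarrow>
        (\<forall>e>0. \<exists>T\<in>bounded_ops (bidual Z) (bidual Z).
           opnorm (bidual Z) (bidual Z) T \<le> m + e \<and>
           T ` E \<subseteq> canon Z ` carrier Z \<and>
           adjoint (bidual Z) (bidual Z) T ` (canon (dual Z) ` carrier (dual Z))
             \<subseteq> canon (dual Z) ` carrier (dual Z) \<and>
           (\<forall>\<phi>\<in>E. \<forall>f\<in>F. T \<phi> f = \<phi> f))"
    using refl unfolding strongly_ext_loc_reflexive_def by (elim exE conjE)
  define l where "l = k * (m + 1)"
  have l: "1 \<le> l"
    using mult_mono[of 1 k 1 "m + 1"] k m by (simp add: l_def)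
  have "approx_on_functionals A l Z"
    unfolding approx_on_functionals_def
  proof (intro allI impI, elim conjE)
    fix F and e :: real assume F: "finite F" "F \<subseteq> bounded_ops Z real_space" and e: "0 < e"
    let ?B = "(\<lambda>T (f :: 'a \<Rightarrow> real). compose (carrier Z) f T) ` ideal_ball A l Z"
    have "\<exists>b\<in>?B. \<forall>f\<in>F. vnorm (dual Z) (b f \<oplus>\<^bsub>dual Z\<^esub> (-1) \<odot>\<^bsub>dual Z\<^esub> f) < e"
    proof (rule weak_approximation_imp_norm_approximation[OF dZ F(1) _ _ _ _ e])
      fix b f assume b: "b \<in> ?B" and f: "f \<in> F"
      obtain T where T: "T \<in> ideal_ball A l Z" "b = (\<lambda>f. compose (carrier Z) f T)"
        using b by blast
      show "b f \<in> carrier (dual Z)"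
        using compose_dual[OF Z Z ideal_ballD(2)[OF T(1)] subsetD[OF F(2) f]] T(2) by simp
    next
      fix b c and t :: real assume b: "b \<in> ?B" and c: "c \<in> ?B" and t: "0 \<le> t" "t \<le> 1"
      obtain S T where S: "S \<in> ideal_ball A l Z" "b = (\<lambda>f. compose (carrier Z) f S)"
        and T: "T \<in> ideal_ball A l Z" "c = (\<lambda>f. compose (carrier Z) f T)"
        using b c by blast
      let ?R = "\<lambda>x\<in>carrier Z. t \<odot>\<^bsub>Z\<^esub> S x \<oplus>\<^bsub>Z\<^esub> (1 - t) \<odot>\<^bsub>Z\<^esub> T x"
      have "?R \<in> ideal_ball A l Z"
        using ideal_ball_convex[OF A Z _ S(1) T(1) t] l by simp
      moreover have "compose (carrier Z) f ?R = t \<odot>\<^bsub>dual Z\<^esub> b f \<oplus>\<^bsub>dual Z\<^esub> (1 - t) \<odot>\<^bsub>dual Z\<^esub> c f"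
        if f: "f \<in> F" for f
      proof -
        have fd: "f \<in> bounded_ops Z real_space"
          using f F(2) by blast
        show ?thesis
          by (rule extensionalityI[of _ "carrier Z"])
            (use Z bounded_ops_mem[OF ideal_ballD(2)[OF S(1)]] bounded_ops_mem[OF ideal_ballD(2)[OF T(1)]]
             in \<open>auto simp: S(2) T(2) compose_eq dual_add[OF fd] dual_smult[OF fd]\<close>)
      qed
      ultimately show "\<exists>d\<in>?B. \<forall>f\<in>F. d f = t \<odot>\<^bsub>dual Z\<^esub> b f \<oplus>\<^bsub>dual Z\<^esub> (1 - t) \<odot>\<^bsub>dual Z\<^esub> c f"
        by (intro bexI[of _ "\<lambda>f. compose (carrier Z) f ?R"]) auto
    next
      fix \<phi> :: "('a \<Rightarrow> real) \<Rightarrow> ('a \<Rightarrow> real) \<Rightarrow> real" and d :: real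
      assume \<phi>: "\<And>f. f \<in> F \<Longrightarrow> \<phi> f \<in> bounded_ops (dual Z) real_space" and d: "0 < d"
      have "fin_dim_subspace (bidual Z) (linspan (bidual Z) (\<phi> ` F)) \<and>
          fin_dim_subspace (dual Z) (linspan (dual Z) F)"
        unfolding fin_dim_subspace_def carrier_dual using F \<phi> by blast
      note refl_1 = refl[rule_format, OF this zero_less_one]
      obtain T where T: "T \<in> bounded_ops (bidual Z) (bidual Z)" "opnorm (bidual Z) (bidual Z) T \<le> m + 1"
        and T_E: "T ` linspan (bidual Z) (\<phi> ` F) \<subseteq> canon Z ` carrier Z"
        and T_dual: "adjoint (bidual Z) (bidual Z) T ` (canon (dual Z) ` carrier (dual Z))
             \<subseteq> canon (dual Z) ` carrier (dual Z)"
        and T_F: "\<forall>\<psi>\<in>linspan (bidual Z) (\<phi> ` F). \<forall>f\<in>linspan (dual Z) F. T \<psi> f = \<psi> f"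
        using refl_1 by (elim bexE conjE)
      have "\<exists>z. z \<in> carrier Z \<and> T (\<phi> f) = canon Z z" if "f \<in> F" for f
        using T_E linspan_superset[of "\<phi> ` F" "bidual Z"] that by blast
      then obtain z where z: "\<And>f. f \<in> F \<Longrightarrow> z f \<in> carrier Z" "\<And>f. f \<in> F \<Longrightarrow> T (\<phi> f) = canon Z (z f)"
        by metis
      \<comment> \<open>The restriction of \<open>T\<^sup>*\<close> to the dual space, called \<open>P\<close> below.\<close>
      have "\<exists>g'. g' \<in> bounded_ops Z real_space \<and> (\<forall>\<psi>\<in>bounded_ops (dual Z) real_space. T \<psi> g = \<psi> g')"
        if g: "g \<in> bounded_ops Z real_space" for g
      proof -
        have gd: "g \<in> carrier (dual Z)"
          using g by simp
        obtain g' where g': "g' \<in> carrier (dual Z)"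
          "adjoint (bidual Z) (bidual Z) T (canon (dual Z) g) = canon (dual Z) g'"
          using T_dual gd by blast
        have cg: "canon (dual Z) g \<in> bounded_ops (bidual Z) real_space"
          using bounded_ops_mem[OF canon_bounded_ops[OF dZ] gd] by simp
        have "T \<psi> g = \<psi> g'" if \<psi>: "\<psi> \<in> bounded_ops (dual Z) real_space" for \<psi>
        proof -
          have "T \<psi> \<in> bounded_ops (dual Z) real_space"
            using bounded_ops_mem[OF T(1), of \<psi>] \<psi> by simp
          then have "T \<psi> g = adjoint (bidual Z) (bidual Z) T (canon (dual Z) g) \<psi>"
            using canon_apply[OF gd] \<psi> adjoint_apply[OF cg, of "bidual Z" T] by (simp add: compose_eq)
          then show ?thesis
            using g'(2) canon_apply[OF g'(1) \<psi>] by simp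
        qed
        then show ?thesis
          using g'(1) by auto
      qed
      then obtain P where P: "\<And>g. g \<in> bounded_ops Z real_space \<Longrightarrow> P g \<in> bounded_ops Z real_space"
        "\<And>g \<psi>. g \<in> bounded_ops Z real_space \<Longrightarrow> \<psi> \<in> bounded_ops (dual Z) real_space \<Longrightarrow> T \<psi> g = \<psi> (P g)"
        by metis
      let ?s = "\<Sum>f\<in>F. opnorm Z real_space f"
      have s: "0 \<le> ?s"
        using F(2) dual_opnorm_nonneg[OF Z] by (intro sum_nonneg) auto
      have "finite (z ` F)" "z ` F \<subseteq> carrier Z" "0 < d / (1 + ?s)"
        using F z d s by auto
      then obtain R where R: "R \<in> ideal_ball A k Z"
        "\<forall>x\<in>z ` F. vnorm Z (R x \<oplus>\<^bsub>Z\<^esub> (-1) \<odot>\<^bsub>Z\<^esub> x) < d / (1 + ?s)"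
        using approx unfolding approx_on_points_def by meson
      note Rb = ideal_ballD(2)[OF R(1)]
      obtain U where U: "U \<in> ideal_ops A (bidual Z) Z"
        and U_eq: "\<And>\<psi> f. \<lbrakk>\<psi> \<in> bounded_ops (dual Z) real_space; f \<in> bounded_ops Z real_space\<rbrakk> \<Longrightarrow>
          f (U \<psi>) = \<psi> (compose (carrier Z) f R)"
        using biadjoint_factor[OF A Z large into ideal_ballD(1)[OF R(1)]] by blast
      note Ub = ideal_ops_bounded[OF U]
      obtain V W :: "'u nspace" and i j where V: "banach_space V" "isometric_iso Z V i"
        "banach_space W" "isometric_iso Z W j"
        using ideal_ballD(1)[OF R(1)] by (rule ideal_opsE) blast
      let ?TC = "compose (carrier Z) T (canon Z)"
      have TC: "?TC \<in> bounded_ops Z (bidual Z)"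
        by (rule compose_bounded_ops[OF Z bZ bZ canon_bounded_ops[OF Z] T(1)])
      \<comment> \<open>The identity on the left completes the three-fold product of the ideal property.\<close>
      define S where "S = (\<lambda>x\<in>carrier Z. (\<lambda>x\<in>carrier Z. x) (U (?TC x)))"
      have S_ideal: "S \<in> ideal_ops A Z Z"
        unfolding S_def by (rule ideal_ops_compose[OF A Z bZ Z Z U TC id_bounded_ops[OF Z] V])
      have cx: "canon Z x \<in> bounded_ops (dual Z) real_space" if "x \<in> carrier Z" for x
        using bounded_ops_mem[OF canon_bounded_ops[OF Z] that] by simp
      have Tcx: "T (canon Z x) \<in> bounded_ops (dual Z) real_space" if "x \<in> carrier Z" for x
        using bounded_ops_mem[OF T(1), of "canon Z x"] cx[OF that] by simp
      have S_x: "S x = U (T (canon Z x))" if "x \<in> carrier Z" for x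
        using that Tcx[OF that] bounded_ops_mem[OF Ub, of "T (canon Z x)"] by (simp add: S_def compose_eq)
      have fR: "compose (carrier Z) f R \<in> bounded_ops Z real_space" if "f \<in> bounded_ops Z real_space" for f
        by (rule compose_dual[OF Z Z Rb that])
      have U_norm: "vnorm Z (U \<psi>) \<le> k * opnorm (dual Z) real_space \<psi>"
        if \<psi>: "\<psi> \<in> bounded_ops (dual Z) real_space" for \<psi>
      proof (rule norm_le_if_functionals_le[OF Z])
        show "U \<psi> \<in> carrier Z"
          using bounded_ops_mem[OF Ub] \<psi> by simp
        show "0 \<le> k * opnorm (dual Z) real_space \<psi>"
          using k dual_opnorm_nonneg[OF dZ \<psi>] by simp
        fix f assume f: "f \<in> bounded_ops Z real_space"
        have "\<bar>f (U \<psi>)\<bar> \<le> opnorm (dual Z) real_space \<psi> * opnorm Z real_space (compose (carrier Z) f R)"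
          using dual_bound[OF dZ \<psi>, of "compose (carrier Z) f R"] fR[OF f] U_eq[OF \<psi> f] by simp
        also have "\<dots> \<le> opnorm (dual Z) real_space \<psi> * (k * opnorm Z real_space f)"
        proof (rule mult_left_mono)
          show "opnorm Z real_space (compose (carrier Z) f R) \<le> k * opnorm Z real_space f"
            using opnorm_compose_dual_le[OF Z Z Rb f] ideal_ballD(3)[OF R(1)] dual_opnorm_nonneg[OF Z f]
            by (meson mult_right_mono order_trans)
        qed (rule dual_opnorm_nonneg[OF dZ \<psi>])
        finally show "\<bar>f (U \<psi>)\<bar> \<le> k * opnorm (dual Z) real_space \<psi> * opnorm Z real_space f"
          by (simp add: algebra_simps)
      qed
      have "opnorm Z Z S \<le> l"
      proof (rule opnorm_le[OF Z Z])
        fix x assume x: "x \<in> carrier Z"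
        have "opnorm (dual Z) real_space (canon Z x) \<le> vnorm Z x"
          by (rule opnorm_le[OF dZ normed_space_real_space])
            (use Z x dual_bound[OF Z _ x] in \<open>auto simp: canon_apply mult.commute\<close>)
        then have "(m + 1) * opnorm (dual Z) real_space (canon Z x) \<le> (m + 1) * vnorm Z x"
          using m by (intro mult_left_mono) auto
        moreover have "opnorm (dual Z) real_space (T (canon Z x)) \<le>
            opnorm (bidual Z) (bidual Z) T * opnorm (dual Z) real_space (canon Z x)"
          using opnorm_bound[OF bZ bZ T(1), of "canon Z x"] cx[OF x] by simp
        moreover have "\<dots> \<le> (m + 1) * opnorm (dual Z) real_space (canon Z x)"
          using T(2) dual_opnorm_nonneg[OF dZ cx[OF x]] by (intro mult_right_mono)
        ultimately have "k * opnorm (dual Z) real_space (T (canon Z x)) \<le> k * ((m + 1) * vnorm Z x)"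
          using k by (intro mult_left_mono) auto
        then show "vnorm Z (S x) \<le> l * vnorm Z x"
          using U_norm[OF Tcx[OF x]] S_x[OF x] by (simp add: l_def mult.assoc)
      qed (use l in simp)
      then have S: "S \<in> ideal_ball A l Z"
        using S_ideal by (simp add: ideal_ball_def)
      have "\<bar>\<phi> f (compose (carrier Z) f S) - \<phi> f f\<bar> \<le> d / (1 + ?s) * opnorm Z real_space f"
        if f: "f \<in> F" for f
      proof -
        have fd: "f \<in> bounded_ops Z real_space"
          using f F(2) by blast
        have in_spans: "\<phi> f \<in> linspan (bidual Z) (\<phi> ` F)" "f \<in> linspan (dual Z) F"
          by (rule subsetD[OF linspan_superset imageI[OF f]], rule subsetD[OF linspan_superset f])
        \<comment> \<open>\<open>S\<^sup>* f = T\<^sup>* R\<^sup>* f\<close>\<close>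
        have "compose (carrier Z) f S = P (compose (carrier Z) f R)"
        proof (rule extensionalityI[of _ "carrier Z"])
          show "P (compose (carrier Z) f R) \<in> extensional (carrier Z)"
            by (rule bounded_ops_ext[OF P(1)[OF fR[OF fd]]])
          fix x assume x: "x \<in> carrier Z"
          have "f (S x) = canon Z x (P (compose (carrier Z) f R))"
            using S_x[OF x] U_eq[OF Tcx[OF x] fd] P(2)[OF fR[OF fd] cx[OF x]] by simp
          then show "compose (carrier Z) f S x = P (compose (carrier Z) f R) x"
            using x canon_apply[OF x P(1)[OF fR[OF fd]]] by (simp add: compose_eq)
        qed simp
        then have "\<phi> f (compose (carrier Z) f S) = T (\<phi> f) (compose (carrier Z) f R)"
          using P(2)[OF fR[OF fd] \<phi>[OF f]] by simp
        also have "\<dots> = f (R (z f))"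
          using z[OF f] canon_apply[OF z(1)[OF f]] fR[OF fd] by (simp add: compose_eq)
        finally have 1: "\<phi> f (compose (carrier Z) f S) = f (R (z f))" .
        have 2: "\<phi> f f = f (z f)"
          using T_F[rule_format, OF in_spans] z[OF f] canon_apply[OF z(1)[OF f]] fd by simp
        have Rz: "R (z f) \<in> carrier Z"
          by (rule bounded_ops_mem[OF Rb z(1)[OF f]])
        have "f (R (z f) \<oplus>\<^bsub>Z\<^esub> (-1) \<odot>\<^bsub>Z\<^esub> z f) = f (R (z f)) - f (z f)"
          using Rz z(1)[OF f] Z by (simp add: dual_add[OF fd] dual_smult[OF fd])
        then have "\<bar>f (R (z f)) - f (z f)\<bar> \<le> opnorm Z real_space f * vnorm Z (R (z f) \<oplus>\<^bsub>Z\<^esub> (-1) \<odot>\<^bsub>Z\<^esub> z f)"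
          using dual_bound[OF Z fd, of "R (z f) \<oplus>\<^bsub>Z\<^esub> (-1) \<odot>\<^bsub>Z\<^esub> z f"] Rz z(1)[OF f] Z by simp
        also have "\<dots> \<le> opnorm Z real_space f * (d / (1 + ?s))"
          using R(2) f dual_opnorm_nonneg[OF Z fd] by (intro mult_left_mono) (auto intro: less_imp_le)
        finally show ?thesis
          using 1 2 by (simp add: mult.commute)
      qed
      then have "(\<Sum>f\<in>F. \<bar>\<phi> f (compose (carrier Z) f S) - \<phi> f f\<bar>) \<le>
          (\<Sum>f\<in>F. d / (1 + ?s) * opnorm Z real_space f)"
        by (rule sum_mono)
      also have "\<dots> = d * (?s / (1 + ?s))"
        by (subst sum_distrib_left[symmetric]) simp
      also have "\<dots> < d"
        by (rule mult_fraction_less[OF s d])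
      finally have "\<bar>\<Sum>f\<in>F. \<phi> f (compose (carrier Z) f S) - \<phi> f f\<bar> < d"
        using sum_abs[of "\<lambda>f. \<phi> f (compose (carrier Z) f S) - \<phi> f f" F] by linarith
      then show "\<exists>b\<in>?B. \<bar>(\<Sum>f\<in>F. \<phi> f (b f)) - (\<Sum>f\<in>F. \<phi> f f)\<bar> < d"
        using S by (auto simp: sum_subtractf)
    qed (use F in auto)
    then show "\<exists>T\<in>ideal_ball A l Z. \<forall>f\<in>F. opnorm Z real_space (defect Z T f) < e"
      unfolding compose_minus_eq[symmetric] by auto
  qed
  then show ?thesis
    using l by blast
qed

theorem BAP_conj_iff_BAP_and_reflexive:
  assumes Y: "normed_space Y" and J: "isometric_iso Y (dual Z) J"
  shows "has_BAP_conj A Z Y J \<longleftrightarrow> has_BAP A Z \<and> strongly_ext_loc_reflexive Z"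
proof
  assume "has_BAP_conj A Z Y J"
  then obtain l where l: "1 \<le> l" "approx_on_functionals A l Z"
    unfolding has_BAP_conj_iff[OF Z Y J] by (elim exE conjE)
  show "has_BAP A Z \<and> strongly_ext_loc_reflexive Z"
  proof
    show "has_BAP A Z"
      unfolding has_BAP_iff[OF Z] using l approx_on_points_if_functionals[OF A Z l] by (intro exI conjI)
    show "strongly_ext_loc_reflexive Z"
      by (rule approx_on_functionals_imp_reflexive[OF l])
  qed
next
  assume r: "has_BAP A Z \<and> strongly_ext_loc_reflexive Z"
  then obtain k where k: "1 \<le> k" "approx_on_points A k Z"
    unfolding has_BAP_iff[OF Z] by (elim exE conjE)
  show "has_BAP_conj A Z Y J"
    unfolding has_BAP_conj_iff[OF Z Y J]
    by (rule approx_on_points_imp_functionals[OF k conjunct2[OF r]])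
qed

end

section \<open>Lipschitz functions as the dual of the Lipschitz-free space\<close>

lemma lip0_simps [simp]:
  "zero lip0 = (\<lambda>x. 0)" "add lip0 f g = (\<lambda>x. f x + g x)" "smult lip0 a f = (\<lambda>x. a * f x)"
  by (simp_all add: lip0_def)

lemma lip0_carrierI:
  assumes "f 0 = 0" "\<And>x y. \<bar>f x - f y\<bar> \<le> C * norm (x - y)" "0 \<le> C"
  shows "f \<in> carrier lip0"
  using assms by (auto simp: lip0_def lipschitz_on_def dist_norm intro!: exI[of _ C])

lemma lip0_at_0: "f \<in> carrier lip0 \<Longrightarrow> f 0 = 0"
  by (simp add: lip0_def)

lemma lip0_bound:
  assumes f: "f \<in> carrier lip0"
  shows "\<bar>f x - f y\<bar> \<le> vnorm lip0 f * norm (x - y)"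
proof (cases "x = y")
  case False
  obtain C where C: "C-lipschitz_on UNIV f"
    using f by (auto simp: lip0_def)
  have "\<bar>f x - f y\<bar> / norm (x - y) \<le> C" for x y
  proof (cases "x = y")
    case True
    then show ?thesis
      using lipschitz_on_nonneg[OF C] by simp
  next
    case False
    then show ?thesis
      using lipschitz_onD[OF C, of x y] by (simp add: dist_norm divide_le_eq)
  qed
  then have "bdd_above (range (\<lambda>(x, y). \<bar>f x - f y\<bar> / norm (x - y)))"
    by (intro bdd_aboveI2[where M = C]) auto
  then have "(case (x, y) of (x, y) \<Rightarrow> \<bar>f x - f y\<bar> / norm (x - y)) \<le> vnorm lip0 f"
    unfolding lip0_def nspace.simps by (intro cSUP_upper) auto
  then show ?thesis
    using False by (simp add: divide_le_eq)
qed simp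

lemma lip0_norm_le:
  assumes "0 \<le> C" "\<And>x y. \<bar>f x - f y\<bar> \<le> C * norm (x - y)"
  shows "vnorm lip0 f \<le> C"
  unfolding lip0_def nspace.simps
proof (rule cSUP_least)
  fix p :: "'a \<times> 'a"
  obtain x y where p: "p = (x, y)" by (cases p)
  show "(case p of (x, y) \<Rightarrow> \<bar>f x - f y\<bar> / norm (x - y)) \<le> C"
    using assms(1) assms(2)[of x y] by (cases "x = y") (auto simp: p divide_le_eq)
qed simp

text \<open>
  Any pair of distinct points shows it; the zero space, which has none, only contributes the value
  \<open>0 / 0 = 0\<close> to the supremum.
\<close>

lemma lip0_norm_nonneg: "0 \<le> vnorm lip0 f" if "f \<in> carrier lip0"
proof -
  have "\<exists>x :: 'a. x \<noteq> 0 \<Longrightarrow> 0 \<le> vnorm lip0 f"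
  proof (elim exE)
    fix x :: 'a assume x: "x \<noteq> 0"
    have "0 \<le> vnorm lip0 f * norm (x - 0)"
      using lip0_bound[OF that, of x 0] abs_ge_zero order_trans by blast
    then show ?thesis
      using x by (simp add: zero_le_mult_iff)
  qed
  moreover have "vnorm lip0 f = 0" if 0: "\<forall>x :: 'a. x = 0"
  proof -
    have "vnorm lip0 f = (SUP p :: 'a \<times> 'a. 0)"
      unfolding lip0_def nspace.simps by (intro SUP_cong) (use 0 in \<open>auto split: prod.split\<close>)
    then show ?thesis by simp
  qed
  ultimately show ?thesis by force
qed

lemma normed_space_lip0 [simp]: "normed_space (lip0 :: ('a::real_normed_vector \<Rightarrow> real) nspace)"
proof (intro normed_space.intro module_realI normed_space_axioms.intro)
  let ?L = "lip0 :: ('a \<Rightarrow> real) nspace"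
  show "\<zero>\<^bsub>?L\<^esub> \<in> carrier ?L"
    by (rule lip0_carrierI[where C = 0]) auto
  fix f g h :: "'a \<Rightarrow> real"
  assume f: "f \<in> carrier ?L" and g: "g \<in> carrier ?L"
  note nonneg = lip0_norm_nonneg[OF f] lip0_norm_nonneg[OF g]
  have add: "\<bar>(f x + g x) - (f y + g y)\<bar> \<le> (vnorm ?L f + vnorm ?L g) * norm (x - y)" for x y
    using lip0_bound[OF f, of x y] lip0_bound[OF g, of x y] by (simp add: distrib_right)
  show "f \<oplus>\<^bsub>?L\<^esub> g \<in> carrier ?L"
    by (rule lip0_carrierI[OF _ _ add_nonneg_nonneg[OF nonneg]])
      (use add lip0_at_0[OF f] lip0_at_0[OF g] in auto)
  show "vnorm ?L (f \<oplus>\<^bsub>?L\<^esub> g) \<le> vnorm ?L f + vnorm ?L g"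
    using lip0_norm_le[OF add_nonneg_nonneg[OF nonneg] add] by simp
  have smult: "\<bar>a * f x - a * f y\<bar> \<le> (\<bar>a\<bar> * vnorm ?L f) * norm (x - y)" for a x y
    using mult_left_mono[OF lip0_bound[OF f, of x y], of "\<bar>a\<bar>"]
    by (simp add: right_diff_distrib[symmetric] abs_mult mult.assoc)
  show m: "a \<odot>\<^bsub>?L\<^esub> f \<in> carrier ?L" for a
    by (rule lip0_carrierI[where C = "\<bar>a\<bar> * vnorm ?L f"])
      (use smult[of a] lip0_at_0[OF f] nonneg in auto)
  have le: "vnorm ?L (a \<odot>\<^bsub>?L\<^esub> f) \<le> \<bar>a\<bar> * vnorm ?L f" for a
    using lip0_norm_le[OF _ smult, of a] nonneg(1) by simp
  show "vnorm ?L (a \<odot>\<^bsub>?L\<^esub> f) = \<bar>a\<bar> * vnorm ?L f" for a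
  proof (cases "a = 0")
    case True
    then show ?thesis
      using le[of 0] lip0_norm_nonneg[OF m[of 0]] by simp
  next
    case False
    have "\<bar>f x - f y\<bar> \<le> (vnorm ?L (a \<odot>\<^bsub>?L\<^esub> f) / \<bar>a\<bar>) * norm (x - y)" for x y
    proof -
      have "\<bar>a\<bar> * \<bar>f x - f y\<bar> = \<bar>(a \<odot>\<^bsub>?L\<^esub> f) x - (a \<odot>\<^bsub>?L\<^esub> f) y\<bar>"
        by (simp add: right_diff_distrib[symmetric] abs_mult)
      also have "\<dots> \<le> vnorm ?L (a \<odot>\<^bsub>?L\<^esub> f) * norm (x - y)"
        by (rule lip0_bound[OF m])
      finally have "\<bar>a\<bar> * \<bar>f x - f y\<bar> \<le> vnorm ?L (a \<odot>\<^bsub>?L\<^esub> f) * norm (x - y)" .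
      then have "\<bar>f x - f y\<bar> \<le> vnorm ?L (a \<odot>\<^bsub>?L\<^esub> f) * norm (x - y) / \<bar>a\<bar>"
        by (intro mult_imp_le_div_pos) (use False in \<open>simp_all add: mult.commute\<close>)
      then show ?thesis by simp
    qed
    then have "vnorm ?L f \<le> vnorm ?L (a \<odot>\<^bsub>?L\<^esub> f) / \<bar>a\<bar>"
      by (rule lip0_norm_le[rotated]) (use lip0_norm_nonneg[OF m[of a]] in simp)
    then show ?thesis
      using le[of a] False by (simp add: pos_le_divide_eq mult.commute)
  qed
  show "vnorm ?L f = 0 \<longleftrightarrow> f = \<zero>\<^bsub>?L\<^esub>"
  proof
    assume 0: "vnorm ?L f = 0"
    show "f = \<zero>\<^bsub>?L\<^esub>"
      using lip0_bound[OF f, of _ 0] 0 lip0_at_0[OF f] by (auto simp: fun_eq_iff)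
  next
    assume 0: "f = \<zero>\<^bsub>?L\<^esub>"
    have "vnorm ?L f \<le> 0"
      by (rule lip0_norm_le) (use 0 in auto)
    then show "vnorm ?L f = 0"
      using nonneg(1) by simp
  qed
qed (auto simp: algebra_simps)

lemma delta_apply: "f \<in> carrier lip0 \<Longrightarrow> delta x f = f x"
  by (simp add: delta_def)

lemma delta_dual: "delta x \<in> bounded_ops lip0 real_space"
  unfolding delta_def
proof (rule bounded_ops_restrictI[where C = "norm x"])
  fix f :: "'a \<Rightarrow> real" assume f: "f \<in> carrier lip0"
  show "vnorm real_space (f x) \<le> norm x * vnorm lip0 f"
    using lip0_bound[OF f, of x 0] lip0_at_0[OF f] by (simp add: mult.commute)
qed auto

lemma delta_dist_le:
  "opnorm lip0 real_space (delta x \<oplus>\<^bsub>dual lip0\<^esub> (-1) \<odot>\<^bsub>dual lip0\<^esub> delta y) \<le> norm (x - y)"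
proof (rule opnorm_le)
  fix f :: "'a \<Rightarrow> real" assume f: "f \<in> carrier lip0"
  show "vnorm real_space ((delta x \<oplus>\<^bsub>dual lip0\<^esub> (-1) \<odot>\<^bsub>dual lip0\<^esub> delta y) f) \<le> norm (x - y) * vnorm lip0 f"
    using lip0_bound[OF f, of x y] f by (simp add: delta_apply mult.commute)
qed auto

lemma submodule_linspan:
  assumes V: "normed_space V" and B: "B \<subseteq> carrier V"
  shows "submodule (linspan V B) real_ring V"
proof (rule normed_space.submodule_realI[OF V])
  show "linspan V B \<subseteq> carrier V"
    by (rule linspan_subset_carrier[OF V B])
qed (auto simp: linspan_def submodule_realD)

lemma submodule_closure:
  assumes V: "normed_space V" and H: "submodule H real_ring V"
  shows "submodule (vtopology V closure_of H) real_ring V"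
proof -
  interpret V: normed_space V by fact
  note D = submodule_realD[OF H]
  have Hc: "x \<in> carrier V" if "x \<in> H" for x
    using D(1) that by blast
  have closure: "vtopology V closure_of H = {x \<in> carrier V. \<forall>r>0. \<exists>y\<in>H. vdist V x y < r}" (is "_ = ?C")
    by (simp add: V.metric.metric_closure_of Hc cong: conj_cong bex_cong)
  show ?thesis
    unfolding closure
  proof (rule V.submodule_realI)
    show "\<zero>\<^bsub>V\<^esub> \<in> ?C"
      using D(2) by (auto intro!: bexI[of _ "\<zero>\<^bsub>V\<^esub>"])
    fix x y
    assume x: "x \<in> ?C"
      and y: "y \<in> ?C"
    show "x \<oplus>\<^bsub>V\<^esub> y \<in> ?C"
    proof (intro CollectI conjI allI impI)
      fix r :: real assume "0 < r"
      then have "0 < r / 2" by simp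
      then obtain u v where u: "u \<in> H" "vdist V x u < r / 2" and v: "v \<in> H" "vdist V y v < r / 2"
        using x y by blast
      have c: "x \<in> carrier V" "y \<in> carrier V" "u \<in> carrier V" "v \<in> carrier V"
        using x y u v Hc by auto
      have "(x \<oplus>\<^bsub>V\<^esub> y) \<oplus>\<^bsub>V\<^esub> (-1) \<odot>\<^bsub>V\<^esub> (u \<oplus>\<^bsub>V\<^esub> v) =
        (x \<oplus>\<^bsub>V\<^esub> (-1) \<odot>\<^bsub>V\<^esub> u) \<oplus>\<^bsub>V\<^esub> (y \<oplus>\<^bsub>V\<^esub> (-1) \<odot>\<^bsub>V\<^esub> v)"
        using c V by (simp add: V.smult_vadd V.M.a_ac)
      then have "vdist V (x \<oplus>\<^bsub>V\<^esub> y) (u \<oplus>\<^bsub>V\<^esub> v) \<le> vdist V x u + vdist V y v"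
        using c V V.norm_triangle[of "x \<oplus>\<^bsub>V\<^esub> (-1) \<odot>\<^bsub>V\<^esub> u" "y \<oplus>\<^bsub>V\<^esub> (-1) \<odot>\<^bsub>V\<^esub> v"]
        by (simp add: V.vdist_eq)
      then show "\<exists>w\<in>H. vdist V (x \<oplus>\<^bsub>V\<^esub> y) w < r"
        using u v D(3) by (intro bexI[of _ "u \<oplus>\<^bsub>V\<^esub> v"]) auto
    qed (use x y in simp)
  next
    fix a x assume x: "x \<in> ?C"
    show "a \<odot>\<^bsub>V\<^esub> x \<in> ?C"
    proof (intro CollectI conjI allI impI)
      fix r :: real assume "0 < r"
      then have r: "0 < r / (1 + \<bar>a\<bar>)" by simp
      then obtain u where u: "u \<in> H" "vdist V x u < r / (1 + \<bar>a\<bar>)"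
        using x by blast
      have c: "x \<in> carrier V" "u \<in> carrier V"
        using x u Hc by auto
      have "a \<odot>\<^bsub>V\<^esub> x \<oplus>\<^bsub>V\<^esub> (-1) \<odot>\<^bsub>V\<^esub> (a \<odot>\<^bsub>V\<^esub> u) = a \<odot>\<^bsub>V\<^esub> (x \<oplus>\<^bsub>V\<^esub> (-1) \<odot>\<^bsub>V\<^esub> u)"
        using c V by (simp add: V.smult_vadd)
      then have "vdist V (a \<odot>\<^bsub>V\<^esub> x) (a \<odot>\<^bsub>V\<^esub> u) = \<bar>a\<bar> * vdist V x u"
        using c V by (simp add: V.vdist_eq V.norm_smult)
      also have "\<dots> \<le> (1 + \<bar>a\<bar>) * vdist V x u"
        by (intro mult_right_mono) auto
      also have "\<dots> < r"
        using u(2) by (simp add: less_divide_eq mult.commute)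
      finally show "\<exists>w\<in>H. vdist V (a \<odot>\<^bsub>V\<^esub> x) w < r"
        using u D(4) by blast
    qed (use x V in simp)
  qed auto
qed

lemma subset_metric_closure:
  assumes V: "normed_space V" and H: "H \<subseteq> carrier V"
  shows "H \<subseteq> vtopology V closure_of H"
proof -
  interpret V: normed_space V by fact
  show ?thesis
    by (rule closure_of_subset) (use H in simp)
qed

text \<open>
  Stated with a Lipschitz bound on the closure, as it is applied to a difference of two functionals
  that are defined only there.
\<close>

lemma lipschitz_zero_on_closure:
  assumes V: "normed_space V" and H: "H \<subseteq> carrier V"
    and f: "\<And>x y. x \<in> C \<Longrightarrow> y \<in> C \<Longrightarrow> \<bar>f x - f y\<bar> \<le> c * vdist V x y"
    and c: "0 \<le> c" and C: "C = vtopology V closure_of H" and zero: "\<And>x. x \<in> H \<Longrightarrow> f x = 0" and x: "x \<in> C"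
  shows "f x = (0::real)"
proof (rule ccontr)
  assume "f x \<noteq> 0"
  interpret V: normed_space V by fact
  have HC: "H \<subseteq> C"
    unfolding C by (rule subset_metric_closure[OF V H])
  have pos: "0 < \<bar>f x\<bar> / (1 + c)"
    using \<open>f x \<noteq> 0\<close> c by simp
  have "\<forall>r>0. \<exists>y\<in>H. vdist V x y < r"
    using x unfolding C V.metric.metric_closure_of by auto
  then obtain y where y: "y \<in> H" "vdist V x y < \<bar>f x\<bar> / (1 + c)"
    using pos by blast
  have "\<bar>f x\<bar> \<le> c * vdist V x y"
    using f[OF x subsetD[OF HC y(1)]] zero[OF y(1)] by simp
  also have "\<dots> \<le> (1 + c) * vdist V x y"
    by (intro mult_right_mono) auto
  also have "\<dots> < \<bar>f x\<bar>"
    using y(2) c by (simp add: less_divide_eq mult.commute)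
  finally show False by simp
qed

lemma free_space_simps [simp]:
  "zero free_space = zero (dual lip0)" "add free_space = add (dual lip0)"
  "smult free_space = smult (dual lip0)" "vnorm free_space = vnorm (dual lip0)"
  "carrier free_space = vtopology (dual lip0) closure_of linspan (dual lip0) (range delta)"
  by (simp_all add: free_space_def)

lemma range_delta_dual: "range delta \<subseteq> carrier (dual lip0)"
  using delta_dual by auto

lemma submodule_free_space: "submodule (carrier free_space) real_ring (dual lip0)"
  unfolding free_space_simps
  by (intro submodule_closure submodule_linspan range_delta_dual) simp_all

lemma normed_space_free_space [simp]:
  "normed_space (free_space :: (('a::real_normed_vector \<Rightarrow> real) \<Rightarrow> real) nspace)" (is "normed_space ?F")
proof -
  have "normed_space ((dual lip0)\<lparr>carrier := carrier ?F\<rparr>)"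
    by (rule normed_space_subspace[OF _ submodule_free_space]) simp
  also have "(dual lip0)\<lparr>carrier := carrier ?F\<rparr> = ?F"
    by (simp add: free_space_def)
  finally show ?thesis .
qed

lemma free_space_subset_dual: "\<mu> \<in> carrier free_space \<Longrightarrow> \<mu> \<in> bounded_ops lip0 real_space"
  using submodule_realD(1)[OF submodule_free_space] by auto

lemma linspan_delta_subset_free_space: "linspan (dual lip0) (range delta) \<subseteq> carrier free_space"
  unfolding free_space_simps
  by (intro subset_metric_closure linspan_subset_carrier range_delta_dual) simp_all

lemma delta_free_space: "delta x \<in> carrier free_space"
  by (rule subsetD[OF linspan_delta_subset_free_space subsetD[OF linspan_superset rangeI]])

text \<open>
  The set where two functionals agree is a subspace containing the evaluations, and the free space is
  the closure of their linear span.
\<close>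

lemma functionals_eq_on_free_space:
  assumes f: "f \<in> bounded_ops free_space real_space" and g: "g \<in> bounded_ops free_space real_space"
    and eq: "\<And>x. f (delta x) = g (delta x)" and \<mu>: "\<mu> \<in> carrier free_space"
  shows "f \<mu> = g \<mu>"
proof -
  let ?D = "dual lip0"
  interpret D: normed_space ?D by simp
  interpret F: normed_space free_space by simp
  let ?H = "linspan ?D (range delta)"
  have H: "submodule ?H real_ring ?D"
    by (rule submodule_linspan[OF _ range_delta_dual]) simp
  have HC: "?H \<subseteq> carrier free_space"
    by (rule linspan_delta_subset_free_space)
  have "?H \<subseteq> {\<mu> \<in> carrier free_space. f \<mu> = g \<mu>}" (is "_ \<subseteq> ?E")
  proof (rule linspan_least)
    note fD = dual_add[OF f] dual_smult[OF f] dual_add[OF g] dual_smult[OF g]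
    show "submodule ?E real_ring ?D"
    proof (rule D.submodule_realI)
      show "?E \<subseteq> carrier ?D"
        using submodule_realD(1)[OF submodule_free_space] by blast
      show "\<zero>\<^bsub>?D\<^esub> \<in> ?E"
        using F.zero_mem bounded_ops_zero[OF F.normed_space_axioms normed_space_real_space f]
          bounded_ops_zero[OF F.normed_space_axioms normed_space_real_space g]
        unfolding free_space_simps(1) by simp
      fix \<mu> \<nu> assume "\<mu> \<in> ?E" "\<nu> \<in> ?E"
      then show "\<mu> \<oplus>\<^bsub>?D\<^esub> \<nu> \<in> ?E"
        using F.add_mem[of \<mu> \<nu>] fD(1)[of \<mu> \<nu>] fD(3)[of \<mu> \<nu>] unfolding free_space_simps(2) by auto
    next
      fix a \<mu> assume "\<mu> \<in> ?E"
      then show "a \<odot>\<^bsub>?D\<^esub> \<mu> \<in> ?E"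
        using F.smult_mem[of \<mu> a] fD(2)[of \<mu> a] fD(4)[of \<mu> a] unfolding free_space_simps(3) by auto
    qed
    show "range delta \<subseteq> ?E"
      using delta_free_space eq by auto
  qed
  then have zero: "f \<nu> - g \<nu> = 0" if "\<nu> \<in> ?H" for \<nu>
    using that by auto
  let ?c = "opnorm free_space real_space f + opnorm free_space real_space g"
  have c: "0 \<le> ?c"
    by (intro add_nonneg_nonneg dual_opnorm_nonneg f g) simp_all
  have "\<bar>(f \<mu> - g \<mu>) - (f \<nu> - g \<nu>)\<bar> \<le> ?c * vdist ?D \<mu> \<nu>"
    if m: "\<mu> \<in> carrier free_space" and n: "\<nu> \<in> carrier free_space" for \<mu> \<nu>
  proof -
    have "vdist ?D \<mu> \<nu> = vdist free_space \<mu> \<nu>"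
      using D.vdist_eq[of \<mu> \<nu>] F.vdist_eq[OF m n] free_space_subset_dual[OF m] free_space_subset_dual[OF n]
      unfolding free_space_simps(2-4) by simp
    moreover have "\<bar>f \<mu> - f \<nu>\<bar> \<le> opnorm free_space real_space f * vdist free_space \<mu> \<nu>"
      using vdist_bounded_ops_le[OF F.normed_space_axioms normed_space_real_space f m n]
        normed_space.vdist_eq[OF normed_space_real_space, of "f \<mu>" "f \<nu>"] by simp
    moreover have "\<bar>g \<mu> - g \<nu>\<bar> \<le> opnorm free_space real_space g * vdist free_space \<mu> \<nu>"
      using vdist_bounded_ops_le[OF F.normed_space_axioms normed_space_real_space g m n]
        normed_space.vdist_eq[OF normed_space_real_space, of "g \<mu>" "g \<nu>"] by simp
    ultimately show ?thesis
      by (simp add: distrib_right)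
  qed
  then have "f \<mu> - g \<mu> = 0"
    using lipschitz_zero_on_closure[OF D.normed_space_axioms submodule_realD(1)[OF H], of
        "carrier free_space" "\<lambda>\<mu>. f \<mu> - g \<mu>" ?c \<mu>] c zero \<mu> by simp
  then show ?thesis by simp
qed

text \<open>
  The inverse takes a functional \<open>g\<close> to \<open>\<lambda>x. g (delta x)\<close>. This function has Lipschitz constant
  at most the norm of \<open>g\<close> because \<open>delta\<close> does not increase distances.
\<close>

theorem isometric_iso_lip0_dual_map:
  "isometric_iso lip0 (dual free_space) (\<lambda>f\<in>carrier lip0. lip0_dual_map f)"
proof -
  let ?L = "lip0 :: ('a \<Rightarrow> real) nspace" and ?F = "free_space :: (('a \<Rightarrow> real) \<Rightarrow> real) nspace"
  let ?J = "lip0_dual_map :: ('a \<Rightarrow> real) \<Rightarrow> _"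
  have J_apply: "?J f \<mu> = \<mu> f" if "\<mu> \<in> carrier ?F" for f \<mu>
    using that unfolding lip0_dual_map_def by (simp del: free_space_simps)
  have bound: "\<bar>\<mu> f\<bar> \<le> vnorm ?L f * vnorm ?F \<mu>" if "f \<in> carrier ?L" "\<mu> \<in> carrier ?F" for f \<mu>
    using dual_bound[OF normed_space_lip0 free_space_subset_dual[OF that(2)] that(1)]
    by (simp add: mult.commute)
  have J_dual: "?J f \<in> bounded_ops ?F real_space" if f: "f \<in> carrier ?L" for f
    unfolding lip0_dual_map_def
    by (rule bounded_ops_restrictI[where C = "vnorm ?L f"])
      (use f bound[OF f] in \<open>auto simp del: free_space_simps(4,5)\<close>)
  have le: "opnorm ?F real_space (?J f) \<le> vnorm ?L f" if f: "f \<in> carrier ?L" for f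
    by (rule opnorm_le)
      (use bound[OF f] J_apply lip0_norm_nonneg[OF f] in \<open>auto simp del: free_space_simps\<close>)
  have lip: "\<bar>g (delta x) - g (delta y)\<bar> \<le> opnorm ?F real_space g * norm (x - y)"
    if g: "g \<in> bounded_ops ?F real_space" for g and x y :: 'a
  proof -
    have "\<bar>g (delta x) - g (delta y)\<bar> =
      \<bar>g (delta x \<oplus>\<^bsub>?F\<^esub> (-1) \<odot>\<^bsub>?F\<^esub> delta y)\<bar>"
      using bounded_ops_diff[OF normed_space_free_space g delta_free_space delta_free_space, of x y]
      by (simp del: free_space_simps)
    also have "\<dots> \<le> opnorm ?F real_space g * vnorm ?F (delta x \<oplus>\<^bsub>?F\<^esub> (-1) \<odot>\<^bsub>?F\<^esub> delta y)"
      by (rule dual_bound[OF normed_space_free_space g])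
        (intro normed_space.add_mem normed_space.smult_mem normed_space_free_space delta_free_space)
    also have "\<dots> \<le> opnorm ?F real_space g * norm (x - y)"
      using delta_dist_le[of x y] dual_opnorm_nonneg[OF normed_space_free_space g]
      unfolding free_space_simps(2-4) op_space_simps(5) by (rule mult_left_mono)
    finally show ?thesis .
  qed
  have J_delta: "?J f (delta x) = f x" if "f \<in> carrier ?L" for f x
    using J_apply[OF delta_free_space] delta_apply[OF that] by metis
  have norm: "vnorm (dual ?F) (?J f) = vnorm ?L f" if f: "f \<in> carrier ?L" for f
  proof -
    have "vnorm ?L f \<le> opnorm ?F real_space (?J f)"
      by (rule lip0_norm_le[OF dual_opnorm_nonneg[OF normed_space_free_space J_dual[OF f]]])
        (use lip[OF J_dual[OF f]] J_delta[OF f] in simp)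
    then show ?thesis
      using le[OF f] by simp
  qed
  have bij: "bij_betw ?J (carrier ?L) (bounded_ops ?F real_space)"
  proof (rule bij_betwI)
    show "?J \<in> carrier ?L \<rightarrow> bounded_ops ?F real_space"
      using J_dual by blast
    let ?K = "\<lambda>g x. g (delta x)"
    show K: "?K \<in> bounded_ops ?F real_space \<rightarrow> carrier ?L"
    proof
      fix g assume g: "g \<in> bounded_ops ?F real_space"
      have "delta 0 = \<zero>\<^bsub>?F\<^esub>"
        by (auto simp: delta_def fun_eq_iff lip0_at_0)
      then have "g (delta 0) = 0"
        using bounded_ops_zero[OF normed_space_free_space normed_space_real_space g] by simp
      then show "?K g \<in> carrier ?L"
        by (rule lip0_carrierI[OF _ lip[OF g] dual_opnorm_nonneg[OF normed_space_free_space g]])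
    qed
    show "?K (?J f) = f" if "f \<in> carrier ?L" for f
      using J_delta[OF that] by simp
    show "?J (?K g) = g" if g: "g \<in> bounded_ops ?F real_space" for g
    proof (rule extensionalityI[of _ "carrier ?F"])
      have Kg: "?K g \<in> carrier ?L"
        using K g by blast
      show "?J (?K g) \<in> extensional (carrier ?F)"
        by (rule bounded_ops_ext[OF J_dual[OF Kg]])
      show "g \<in> extensional (carrier ?F)"
        by (rule bounded_ops_ext[OF g])
      show "?J (?K g) \<mu> = g \<mu>" if "\<mu> \<in> carrier ?F" for \<mu>
        by (rule functionals_eq_on_free_space[OF J_dual[OF Kg] g _ that]) (simp add: J_delta[OF Kg])
    qed
  qed
  have ext_eqI: "f = g" if "f \<in> bounded_ops ?F real_space" "g \<in> extensional (carrier ?F)"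
    "\<And>\<mu>. \<mu> \<in> carrier ?F \<Longrightarrow> f \<mu> = g \<mu>" for f g
    using that bounded_ops_ext extensionalityI by blast
  have op: "(\<lambda>f\<in>carrier ?L. ?J f) \<in> bounded_ops ?L (dual ?F)"
  proof (rule bounded_ops_restrictI[OF normed_space_lip0, where C = 1])
    fix f assume f: "f \<in> carrier ?L"
    show "?J f \<in> carrier (dual ?F)"
      using J_dual[OF f] by simp
    show "vnorm (dual ?F) (?J f) \<le> 1 * vnorm ?L f"
      using norm[OF f] by simp
    have smult: "\<mu> (a \<odot>\<^bsub>?L\<^esub> f) = a * \<mu> f" if "\<mu> \<in> carrier ?F" for \<mu> a
      by (rule dual_smult[OF free_space_subset_dual[OF that] f])
    show "?J (a \<odot>\<^bsub>?L\<^esub> f) = a \<odot>\<^bsub>dual ?F\<^esub> ?J f" for a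
      by (rule ext_eqI[OF J_dual[OF normed_space.smult_mem[OF normed_space_lip0 f]]])
        (use smult J_apply in \<open>simp_all del: free_space_simps lip0_simps\<close>)
    show "?J (f \<oplus>\<^bsub>?L\<^esub> g) = ?J f \<oplus>\<^bsub>dual ?F\<^esub> ?J g" if g: "g \<in> carrier ?L" for g
      by (rule ext_eqI[OF J_dual[OF normed_space.add_mem[OF normed_space_lip0 f g]]])
        (use dual_add[OF free_space_subset_dual f g] J_apply in \<open>simp_all del: free_space_simps lip0_simps\<close>)
  qed
  show ?thesis
    unfolding isometric_iso_def carrier_dual
    using op norm bij by (simp del: free_space_simps cong: bij_betw_cong)
qed

text \<open>
  Needed because an isometric isomorphism is \<open>undefined\<close> off its domain by definition, whereas
  \<open>lip0_dual_map\<close> is given by one formula everywhere.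
\<close>

lemma has_BAP_conj_restrict:
  "has_BAP_conj A Z Y (\<lambda>y\<in>carrier Y. J y) \<longleftrightarrow> has_BAP_conj A Z Y J"
proof -
  have "conj_ball A l Z Y (\<lambda>y\<in>carrier Y. J y) = conj_ball A l Z Y J" for l
    unfolding conj_ball_def by (intro Collect_cong conj_cong refl bex_cong ball_cong) (simp_all add: bounded_ops_mem)
  then show ?thesis
    by (simp add: has_BAP_conj_def)
qed

theorem proposition3p5:
  fixes A :: "'u ideal"
  assumes large: "fits TYPE('u) (bidual (free_space :: (('a::banach \<Rightarrow> real) \<Rightarrow> real) nspace))"
    and ideal: "operator_ideal A"
    and dd: "\<And>V W. \<lbrakk>banach_space V; banach_space W;
               fits TYPE('u) (bidual V); fits TYPE('u) (bidual W)\<rbrakk> \<Longrightarrow> A V W = dd_ideal A V W"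
    and into: "\<And>Z T. \<lbrakk>banach_space Z; fits TYPE('u) (bidual Z); T \<in> A Z Z\<rbrakk>
               \<Longrightarrow> biadjoint_into_space A Z T"
  shows "has_BAP_conj A (free_space :: (('a \<Rightarrow> real) \<Rightarrow> real) nspace) lip0 lip0_dual_map \<longleftrightarrow>
         has_BAP A (free_space :: (('a \<Rightarrow> real) \<Rightarrow> real) nspace) \<and>
         strongly_ext_loc_reflexive (free_space :: (('a \<Rightarrow> real) \<Rightarrow> real) nspace)"
  using BAP_conj_iff_BAP_and_reflexive[OF ideal normed_space_free_space large into
      normed_space_lip0 isometric_iso_lip0_dual_map]
  unfolding has_BAP_conj_restrict .

end
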